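(* Let $1<p<\infty$ and let $g\in L^\infty$ be a matching function (i.e. $g\widetilde g=1$) which is continuous at the point $1$ or at the point $-1$. If the operator $T(g):H^p\to H^p$ is Fredholm and $n:=\operatorname{ind}T(g)$, then $\boldsymbol\sigma(g)=g(1)$ if $g$ is continuous at the point $1$, and $\boldsymbol\sigma(g)=g(-1)(-1)^n$ if $g$ is continuous at the point $-1$.
   Context: $\mathbb{T}$ is the unit circle, $L^p=L^p(\mathbb{T})$, $1/p+1/q=1$, $H^p=\{f\in L^p:\widehat f_n=0\text{ for }n<0\}$, $\overline{H^p}=\{f\in L^p:\widehat f_n=0\text{ for }n>0\}$; for $f\in H^p$, $f(0)=\widehat f_0$, and for $f\in\overline{H^p}$, $f(\infty)=\widehat f_0$. $P$ is the Riesz projection of $L^p$ onto $H^p$, $\widetilde a(t)=a(1/t)$, $T(a)f=P(af)$ on $H^p$. The index is $\dim\ker-\dim\operatorname{coker}$. Wiener--Hopf factorization of $a\in L^\infty$ in $H^p$: $a=a_-t^{\nu}a_+$ with $\nu\in\mathbb{Z}$, $a_+\in H^q$, $a_+^{-1}\in H^p$, $a_-\in\overline{H^p}$, $a_-^{-1}\in\overline{H^q}$, $a_-(\infty)=1$, such that the operator $a_+^{-1}Pa_-^{-1}I$, defined on $\operatorname{span}\{t^k:k\ge0\}$, extends boundedly to $H^p$. It is unique, and it exists if and only if $T(a)$ is Fredholm on $H^p$, in which case $\nu=-\operatorname{ind}T(a)$. For a matching function $g$ with $T(g)$ Fredholm on $H^p$, with factorization $g=g_-t^{\nu}g_+$,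 one has $g_+(0)\in\{1,-1\}$; the factorization signature is $\boldsymbol\sigma(g):=g_+(0)$. *)

theory Defs
  imports "HOL-Probability.Probability"
begin

text \<open>
  Elements of the Lebesgue spaces on the unit circle are represented by functions on the complex
  plane of which only the restriction to the circle matters; two functions represent the same
  element iff they agree almost everywhere with respect to \<open>circle_measure\<close>. All notions
  below respect this identification, except for continuity at a point, see the end of the theory.
\<close>

abbreviation circle :: "complex set" where
  "circle \<equiv> sphere 0 1"

text \<open>Normalised arc length.\<close>

definition circle_measure :: "complex measure" where
  "circle_measure = distr (uniform_measure lborel {- pi<..pi}) (restrict_space borel circle) cis"

lemma space_circle_measure [simp]: "space circle_measure = circle"
  by (simp add: circle_measure_def space_restrict_space)

lemma sets_circle_measure [measurable_cong]:
  "sets circle_measure = sets (restrict_space borel circle)"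
  by (simp add: circle_measure_def)

lemma measurable_cis_circle:
  "cis \<in> measurable (uniform_measure lborel {- pi<..pi}) (restrict_space borel circle)"
proof -
  have "cis \<in> borel_measurable borel"
    by (intro borel_measurable_continuous_onI continuous_intros)
  then show ?thesis
    by (auto intro!: measurable_restrict_space2)
qed

lemma prob_space_circle_measure: "prob_space circle_measure"
  unfolding circle_measure_def
  by (intro prob_space.prob_space_distr prob_space_uniform_measure measurable_cis_circle) auto

subsection \<open>Lebesgue and Hardy spaces\<close>

definition Lp :: "real \<Rightarrow> (complex \<Rightarrow> complex) set" where
  "Lp p = {f \<in> borel_measurable circle_measure.
             integrable circle_measure (\<lambda>t. norm (f t) powr p)}"

definition Lp_norm :: "real \<Rightarrow> (complex \<Rightarrow> complex) \<Rightarrow> real" where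
  "Lp_norm p f = (LINT t|circle_measure. norm (f t) powr p) powr (1 / p)"

definition Linf :: "(complex \<Rightarrow> complex) set" where
  "Linf = {f \<in> borel_measurable circle_measure. \<exists>C. AE t in circle_measure. norm (f t) \<le> C}"

definition null_funs :: "(complex \<Rightarrow> complex) set" where
  "null_funs = {f \<in> borel_measurable circle_measure. AE t in circle_measure. f t = 0}"

definition fourier_coeff :: "(complex \<Rightarrow> complex) \<Rightarrow> int \<Rightarrow> complex" where
  "fourier_coeff f n = (LINT t|circle_measure. f t * t powi (- n))"

definition Hp :: "real \<Rightarrow> (complex \<Rightarrow> complex) set" where
  "Hp p = {f \<in> Lp p. \<forall>n<0. fourier_coeff f n = 0}"

definition Hp_bar :: "real \<Rightarrow> (complex \<Rightarrow> complex) set" where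
  "Hp_bar p = {f \<in> Lp p. \<forall>n>0. fourier_coeff f n = 0}"

definition value_at_0 :: "(complex \<Rightarrow> complex) \<Rightarrow> complex" where
  "value_at_0 f = fourier_coeff f 0"

definition value_at_infinity :: "(complex \<Rightarrow> complex) \<Rightarrow> complex" where
  "value_at_infinity f = fourier_coeff f 0"

definition conj_exponent :: "real \<Rightarrow> real" where
  "conj_exponent p = p / (p - 1)"

lemma conj_exponent: "1 < p \<Longrightarrow> 1 / p + 1 / conj_exponent p = 1"
  by (simp add: conj_exponent_def field_simps)

subsection \<open>Toeplitz operators\<close>

text \<open>
  The Riesz projection replaces the Fourier coefficients of negative index by 0. For
  \<open>1 < p\<close> and \<open>f \<in> Lp p\<close> a function \<open>h\<close> as below
  exists by M. Riesz's theorem, and it is determined up to a null function.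
\<close>

definition riesz_proj :: "real \<Rightarrow> (complex \<Rightarrow> complex) \<Rightarrow> complex \<Rightarrow> complex" where
  "riesz_proj p f = (SOME h. h \<in> Hp p \<and> (\<forall>n\<ge>0. fourier_coeff h n = fourier_coeff f n))"

definition toeplitz ::
    "real \<Rightarrow> (complex \<Rightarrow> complex) \<Rightarrow> (complex \<Rightarrow> complex) \<Rightarrow> complex \<Rightarrow> complex" where
  "toeplitz p a f = riesz_proj p (\<lambda>t. a t * f t)"

subsection \<open>Fredholm operators on Hardy spaces\<close>

text \<open>
  For linear subspaces \<open>W \<subseteq> V\<close>, the cosets of the elements of \<open>B\<close> form a basis of the quotient
  space \<open>V / W\<close> (and distinct elements of \<open>B\<close> have distinct cosets).
\<close>

definition quot_basis ::
    "(complex \<Rightarrow> complex) set \<Rightarrow> (complex \<Rightarrow> complex) set \<Rightarrow> (complex \<Rightarrow> complex) set \<Rightarrow> bool" where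
  "quot_basis V W B \<longleftrightarrow> finite B \<and> B \<subseteq> V \<and>
     (\<forall>v\<in>V. \<exists>c. (\<lambda>t. v t - (\<Sum>b\<in>B. c b * b t)) \<in> W) \<and>
     (\<forall>c. (\<lambda>t. \<Sum>b\<in>B. c b * b t) \<in> W \<longrightarrow> (\<forall>b\<in>B. c b = 0))"

definition finite_dim_quot :: "(complex \<Rightarrow> complex) set \<Rightarrow> (complex \<Rightarrow> complex) set \<Rightarrow> bool" where
  "finite_dim_quot V W \<longleftrightarrow> (\<exists>B. quot_basis V W B)"

definition dim_quot :: "(complex \<Rightarrow> complex) set \<Rightarrow> (complex \<Rightarrow> complex) set \<Rightarrow> nat" where
  "dim_quot V W = (THE n. \<exists>B. quot_basis V W B \<and> card B = n)"

definition ker_op ::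
    "real \<Rightarrow> ((complex \<Rightarrow> complex) \<Rightarrow> complex \<Rightarrow> complex) \<Rightarrow> (complex \<Rightarrow> complex) set" where
  "ker_op p A = {f \<in> Hp p. AE t in circle_measure. A f t = 0}"

definition range_op ::
    "real \<Rightarrow> ((complex \<Rightarrow> complex) \<Rightarrow> complex \<Rightarrow> complex) \<Rightarrow> (complex \<Rightarrow> complex) set" where
  "range_op p A = {h \<in> Hp p. \<exists>f\<in>Hp p. AE t in circle_measure. A f t = h t}"

definition Lp_closed_in_Hp :: "real \<Rightarrow> (complex \<Rightarrow> complex) set \<Rightarrow> bool" where
  "Lp_closed_in_Hp p R \<longleftrightarrow>
     (\<forall>h\<in>Hp p. (\<exists>r. (\<forall>k::nat. r k \<in> R) \<and> (\<lambda>k. Lp_norm p (\<lambda>t. r k t - h t)) \<longlonglongrightarrow> 0) \<longrightarrow> h \<in> R)"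

text \<open>A linear operator on \<open>Hp p\<close> given on representatives.\<close>

definition bounded_linear_on_Hp ::
    "real \<Rightarrow> ((complex \<Rightarrow> complex) \<Rightarrow> complex \<Rightarrow> complex) \<Rightarrow> bool" where
  "bounded_linear_on_Hp p A \<longleftrightarrow>
     (\<forall>f\<in>Hp p. A f \<in> Hp p) \<and>
     (\<forall>f\<in>Hp p. \<forall>h\<in>Hp p. AE t in circle_measure. A (\<lambda>s. f s + h s) t = A f t + A h t) \<and>
     (\<forall>c. \<forall>f\<in>Hp p. AE t in circle_measure. A (\<lambda>s. c * f s) t = c * A f t) \<and>
     (\<exists>C. \<forall>f\<in>Hp p. Lp_norm p (A f) \<le> C * Lp_norm p f)"

text \<open>
  The kernel, as a space of elements of \<open>Hp p\<close>, is \<open>ker_op p A\<close> modulo null functions;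
  \<open>range_op p A\<close> contains all null functions, so the cokernel is \<open>Hp p / range_op p A\<close>.
\<close>

definition fredholm :: "real \<Rightarrow> ((complex \<Rightarrow> complex) \<Rightarrow> complex \<Rightarrow> complex) \<Rightarrow> bool" where
  "fredholm p A \<longleftrightarrow> bounded_linear_on_Hp p A \<and> Lp_closed_in_Hp p (range_op p A) \<and>
     finite_dim_quot (ker_op p A) null_funs \<and> finite_dim_quot (Hp p) (range_op p A)"

definition fredholm_index :: "real \<Rightarrow> ((complex \<Rightarrow> complex) \<Rightarrow> complex \<Rightarrow> complex) \<Rightarrow> int" where
  "fredholm_index p A =
     int (dim_quot (ker_op p A) null_funs) - int (dim_quot (Hp p) (range_op p A))"

subsection \<open>Wiener--Hopf factorization and the factorization signature\<close>

text \<open>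
  Since \<open>inverse 0 = 0\<close>, the existence of the inverses of the factors is expressed by requiring
  them to be nonzero almost everywhere. In the boundedness condition the Riesz projection acts on
  \<open>Lp q\<close>, the space containing the product of the inverse of \<open>am\<close> with a polynomial.
\<close>

definition wiener_hopf_factorization ::
    "real \<Rightarrow> (complex \<Rightarrow> complex) \<Rightarrow> (complex \<Rightarrow> complex) \<Rightarrow> int \<Rightarrow> (complex \<Rightarrow> complex) \<Rightarrow> bool" where
  "wiener_hopf_factorization p a am \<nu> ap \<longleftrightarrow>
     (let q = conj_exponent p in
       (AE t in circle_measure. a t = am t * t powi \<nu> * ap t) \<and>
       (AE t in circle_measure. ap t \<noteq> 0) \<and> (AE t in circle_measure. am t \<noteq> 0) \<and>
       ap \<in> Hp q \<and> (\<lambda>t. inverse (ap t)) \<in> Hp p \<and>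
       am \<in> Hp_bar p \<and> (\<lambda>t. inverse (am t)) \<in> Hp_bar q \<and>
       value_at_infinity am = 1 \<and>
       (\<exists>S. bounded_linear_on_Hp p S \<and>
          (\<forall>f :: complex poly. AE t in circle_measure.
             S (poly f) t = inverse (ap t) * riesz_proj q (\<lambda>s. inverse (am s) * poly f s) t)))"

definition reflect :: "(complex \<Rightarrow> complex) \<Rightarrow> complex \<Rightarrow> complex" where
  "reflect a = (\<lambda>t. a (1 / t))"

definition matching :: "(complex \<Rightarrow> complex) \<Rightarrow> bool" where
  "matching g \<longleftrightarrow> (AE t in circle_measure. g t * reflect g t = 1)"

text \<open>The factorization depends on the Hardy space in which it is taken, hence on \<open>p\<close>.\<close>

definition factorization_signature :: "real \<Rightarrow> (complex \<Rightarrow> complex) \<Rightarrow> complex" where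
  "factorization_signature p g =
     (THE s. \<exists>gm \<nu> gp. wiener_hopf_factorization p g gm \<nu> gp \<and> s = value_at_0 gp)"

text \<open>
  An element of \<open>Linf\<close> is continuous at \<open>z\<close> if it has a representative which is; here it is
  identified with such a representative, so that its value at \<open>z\<close> makes sense. An element that is
  continuous at several points has a representative that is continuous at each of them.
\<close>

definition continuous_at_circle_point :: "(complex \<Rightarrow> complex) \<Rightarrow> complex \<Rightarrow> bool" where
  "continuous_at_circle_point g z \<longleftrightarrow> continuous (at z within circle) g"

end

theory Submission
  imports Defs "HOL-Complex_Analysis.Complex_Analysis"
begin

text \<open>
  If \<open>T(g)\<close> is Fredholm, the kernels of \<open>T(t\<^sup>k g)\<close> decrease with \<open>k\<close>; let \<open>k\<close> be the least index for
  which the kernel is trivial and \<open>a = t\<^sup>k g\<close>. A suitable multiple \<open>f\<close> of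
  an element of the previous kernel satisfies \<open>T(a) f = 1\<close>. The matching relation and
  injectivity force \<open>a f = c f(1/t)\<close> with \<open>c = f(0)\<close> and \<open>c\<^sup>2 = 1\<close>, so the range of \<open>T(a)\<close> contains
  the polynomials; being closed, it is everything. Hence \<open>T(a)\<close> is invertible, \<open>k = ind T(g)\<close>, the
  inverse provides \<open>1/f \<in> H\<^sup>q\<close>, the factors of \<open>g\<close> are \<open>c f(1/t)\<close>, \<open>t\<^sup>-\<^sup>k\<close> and \<open>1/f\<close>, and the
  signature is \<open>c\<close>.

  Now let \<open>a\<close> be continuous at \<open>z = 1\<close> or \<open>z = -1\<close>, so that \<open>a(z)\<^sup>2 = 1\<close>. Since \<open>c\<close> depends
  continuously on \<open>a\<close>, we may assume that \<open>a\<close> is constant near \<open>z\<close>. If the constant were \<open>-c\<close>, the even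
  function \<open>f(t) + f(1/t)\<close> would vanish near \<open>z\<close>, which makes \<open>f\<close> divisible by \<open>t - z\<close> in \<open>H\<^sup>p\<close>; then
  \<open>1/f \<in> H\<^sup>q\<close> would make \<open>1/(t - z)\<close> integrable.
\<close>

section \<open>The circle measure\<close>

text \<open>That \<open>1 / f\<close> lies in H^q cannot be read off from \<open>f\<close>; it comes
  from duality. The functional that sends \<open>f u\<close> to the mean of \<open>u\<close> is
  bounded because T(a) is bounded below and the Riesz projection is bounded, which is why M. Riesz's
  theorem and the open mapping theorem precede the operator theory. The boundedness condition of the
  factorization then comes for free: the operator in question is the inverse of T(a). The sign
  \<open>c\<close> takes two values only, so its continuity in \<open>a\<close> is local constancy,
  and \<open>a\<close> may be replaced by a nearby symbol. The replacement is essential: continuity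
  at \<open>z\<close> gives no rate at which \<open>f + reflect f\<close> vanishes there, whereas
  for a symbol that is constant on an arc this sum is 0 on the arc and can be divided by
  \<open>t - z\<close> within L^p. The final contradiction is a borderline one: Hoelder's inequality
  for conjugate exponents ends at integrability, and \<open>1 / (t - z)\<close> just fails to be
  integrable.\<close>

abbreviation \<mu> :: "complex measure" where "\<mu> \<equiv> circle_measure"

interpretation circle: prob_space \<mu>
  by (rule prob_space_circle_measure)

lemma measurable_circleI:
  "f \<in> borel_measurable borel \<Longrightarrow> f \<in> borel_measurable \<mu>"
  by (simp add: measurable_restrict_space1 cong: measurable_cong_sets[OF sets_circle_measure refl])

lemma measurable_circle_ident [measurable]: "(\<lambda>t. t) \<in> borel_measurable \<mu>"
  by (rule measurable_circleI) simp

lemma measurable_circle_continuous_on: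
  fixes f :: "complex \<Rightarrow> 'a::topological_space"
  shows "continuous_on circle f \<Longrightarrow> f \<in> borel_measurable \<mu>"
  using borel_measurable_continuous_on_restrict measurable_cong_sets[OF sets_circle_measure refl]
  by blast

lemma circle_nonzero: "t \<in> circle \<Longrightarrow> t \<noteq> 0"
  by auto

lemma AE_circle: "(\<And>t. t \<in> circle \<Longrightarrow> P t) \<Longrightarrow> AE t in \<mu>. P t"
  by (rule AE_I2) simp

lemma measurable_inversion [measurable]: "(\<lambda>t. 1 / t) \<in> measurable \<mu> \<mu>"
proof -
  have "(\<lambda>t::complex. 1 / t) \<in> measurable (restrict_space borel circle) (restrict_space borel circle)"
    by (rule measurable_restrict_space2)
       (auto simp: norm_divide intro!: measurable_restrict_space1)
  then show ?thesis
    by (simp cong: measurable_cong_sets[OF sets_circle_measure sets_circle_measure])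
qed

text \<open>In the angle, inversion is negation, which preserves Lebesgue measure; it turns the
  half-open interval into \<open>{- pi..<pi}\<close>, which differs from the original in the two
  endpoints only.\<close>

lemma distr_inversion: "distr \<mu> \<mu> (\<lambda>t. 1 / t) = \<mu>"
proof -
  define U where "U = uniform_measure lborel {- pi<..pi::real}"
  define R where "R = (restrict_space borel circle :: complex measure)"
  have cis: "cis \<in> measurable U R"
    unfolding U_def R_def by (rule measurable_cis_circle)
  have inv: "(\<lambda>t::complex. 1 / t) \<in> measurable R R"
    using measurable_inversion unfolding R_def
    by (simp cong: measurable_cong_sets[OF sets_circle_measure sets_circle_measure])
  have sU: "sets U = sets borel" by (simp add: U_def)
  have minus: "uminus \<in> measurable U U" by (simp add: U_def)
  have U_uminus: "distr U U uminus = U"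
  proof (rule measure_eqI)
    fix A assume "A \<in> sets (distr U U uminus)"
    then have A [measurable]: "A \<in> sets borel" by (simp add: sU)
    have nA: "uminus -` A \<in> sets borel"
      using measurable_sets[OF borel_measurable_uminus[OF measurable_ident_sets[OF refl]] A]
      by simp
    have "emeasure lborel ({- pi<..pi} \<inter> uminus -` A)
        = emeasure (distr lborel borel uminus) ({- pi<..pi} \<inter> uminus -` A)"
      by (simp add: lborel_distr_uminus)
    also have "\<dots> = emeasure lborel (uminus -` ({- pi<..pi} \<inter> uminus -` A))"
      using nA by (subst emeasure_distr) auto
    also have "uminus -` ({- pi<..pi} \<inter> uminus -` A) = {- pi..<pi} \<inter> A"
      by auto
    also have "emeasure lborel ({- pi..<pi} \<inter> A) = emeasure lborel ({- pi<..pi} \<inter> A)"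
    proof (rule emeasure_eq_AE)
      have "AE x in lborel. x \<noteq> pi" "AE x in lborel. x \<noteq> -pi"
        by (rule AE_lborel_singleton)+
      then show "AE x in lborel. (x \<in> {- pi..<pi} \<inter> A) = (x \<in> {- pi<..pi} \<inter> A)"
        by eventually_elim auto
    qed auto
    finally show "emeasure (distr U U uminus) A = emeasure U A"
      using A nA by (subst emeasure_distr[OF minus]) (auto simp: sU U_def)
  qed simp
  have "distr \<mu> \<mu> (\<lambda>t. 1 / t) = distr (distr U R cis) R (\<lambda>t. 1 / t)"
    unfolding circle_measure_def U_def R_def by (rule distr_cong) auto
  also have "\<dots> = distr U R ((\<lambda>t. 1 / t) \<circ> cis)"
    by (rule distr_distr[OF inv cis])
  also have "(\<lambda>t. 1 / t) \<circ> cis = cis \<circ> uminus"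
    by (auto simp: fun_eq_iff cis_inverse[symmetric] inverse_eq_divide)
  also have "distr U R (cis \<circ> uminus) = distr (distr U U uminus) R cis"
    by (rule distr_distr[OF cis minus, symmetric])
  also have "\<dots> = \<mu>"
    by (simp add: U_uminus) (simp add: U_def R_def circle_measure_def)
  finally show ?thesis .
qed

lemma measurable_reflect [measurable]:
  "f \<in> borel_measurable \<mu> \<Longrightarrow> reflect f \<in> borel_measurable \<mu>"
  unfolding reflect_def by (rule measurable_compose[OF measurable_inversion])

lemma integral_reflect:
  assumes [measurable]: "f \<in> borel_measurable \<mu>"
  shows "(LINT t|\<mu>. reflect f t) = (LINT t|\<mu>. f t)"
  unfolding reflect_def using integral_distr[of "\<lambda>t. 1 / t" \<mu> \<mu> f] by (simp add: distr_inversion)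

lemma integrable_inversion:
  fixes f :: "complex \<Rightarrow> 'a::{banach, second_countable_topology}"
  assumes "integrable \<mu> f"
  shows "integrable \<mu> (\<lambda>t. f (1 / t))"
  using integrable_distr[of "\<lambda>t. 1 / t" \<mu> \<mu> f] assms by (simp add: distr_inversion)

lemma AE_inversion:
  assumes "AE t in \<mu>. P t"
  shows "AE t in \<mu>. P (1 / t)"
proof -
  have "AE t in distr \<mu> \<mu> (\<lambda>t. 1 / t). P t" by (subst distr_inversion) (rule assms)
  then show ?thesis by (rule AE_distrD[OF measurable_inversion])
qed

lemma AE_reflect: "AE t in \<mu>. f t = g t \<Longrightarrow> AE t in \<mu>. reflect f t = reflect g t"
  unfolding reflect_def by (rule AE_inversion)

lemma integral_circle:
  fixes f :: "complex \<Rightarrow> complex"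
  assumes "f \<in> borel_measurable \<mu>"
  shows "(LINT t|\<mu>. f t) = (LBINT x:{- pi<..pi}. f (cis x)) / (2 * pi)"
proof -
  have f: "f \<in> borel_measurable (restrict_space borel circle)"
    using assms by (simp cong: measurable_cong_sets[OF sets_circle_measure refl])
  have "(LINT t|\<mu>. f t) = (LINT x|uniform_measure lborel {- pi<..pi}. f (cis x))"
    unfolding circle_measure_def by (rule integral_distr[OF measurable_cis_circle f])
  also have "uniform_measure lborel {- pi<..pi}
      = density lborel (\<lambda>x. ennreal (indicator {- pi<..pi} x / (2 * pi)))"
    unfolding uniform_measure_def
    by (auto intro!: density_cong simp: indicator_def ennreal_1[symmetric] divide_ennreal simp del: ennreal_1)
  also have "(LINT x|\<dots>. f (cis x)) = (LBINT x. (indicator {- pi<..pi} x / (2 * pi)) *\<^sub>R f (cis x))"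
    using measurable_compose[OF measurable_cis_circle f]
    by (intro integral_density) (auto simp: indicator_def)
  also have "\<dots> = (LBINT x. (indicator {- pi<..pi} x *\<^sub>R f (cis x)) / (2 * pi))"
    by (intro Bochner_Integration.integral_cong refl) (simp add: scaleR_conv_of_real)
  also have "\<dots> = (LBINT x:{- pi<..pi}. f (cis x)) / (2 * pi)"
    unfolding set_lebesgue_integral_def by (rule integral_divide_zero)
  finally show ?thesis .
qed

text \<open>The quotient \<open>(f z - f 0) / z\<close> has a removable singularity, so by Cauchy's
  theorem its integral around the circle is 0; with \<open>dz = i z dx\<close> that integral is, up
  to a factor, the mean of \<open>f - f 0\<close>.\<close>

lemma mean_value_property:
  assumes "open A" "cball 0 1 \<subseteq> A" "f holomorphic_on A"
  shows "(LINT t|\<mu>. f t) = f 0"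
proof -
  define F where "F = (\<lambda>z. if z = 0 then deriv f 0 else (f z - f 0) / (z - 0))"
  have "0 \<in> interior A"
    using assms by (auto simp: interior_open)
  then have F: "F holomorphic_on A"
    unfolding F_def by (rule pole_lemma[OF assms(3)])
  have "(F has_contour_integral 0) (part_circlepath 0 1 (- pi) pi)"
  proof (rule Cauchy_theorem_convex_simple)
    show "F holomorphic_on cball 0 1" using F assms(2) by (rule holomorphic_on_subset)
    show "path_image (part_circlepath 0 1 (- pi) pi) \<subseteq> cball 0 1"
      using path_image_part_circlepath_subset'[of 1 0 "-pi" pi] by auto
  qed (auto simp: exp_minus)
  then have "((\<lambda>x. F (cis x) * \<i> * cis x) has_integral 0) {- pi..pi}"
    by (subst (asm) has_contour_integral_part_circlepath_iff) auto
  moreover have "- \<i> * (a * \<i> * b) = a * b" for a b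
    by (simp add: complex_eq_iff)
  ultimately have "((\<lambda>x. F (cis x) * cis x) has_integral 0) {- pi..pi}"
    using has_integral_mult_right[of "\<lambda>x. F (cis x) * \<i> * cis x" 0 "{- pi..pi}" "- \<i>"] by simp
  then have "((\<lambda>x. f 0 + F (cis x) * cis x) has_integral (2 * pi) *\<^sub>R f 0 + 0) {- pi..pi}"
    using has_integral_const_real[of "f 0" "-pi" pi] by (intro has_integral_add) auto
  then have int: "((\<lambda>x. f (cis x)) has_integral (2 * pi) *\<^sub>R f 0) {- pi..pi}"
    by (simp add: F_def)
  have c: "continuous_on circle f"
    using assms(2) by (intro continuous_on_subset[OF holomorphic_on_imp_continuous_on[OF assms(3)]]) auto
  have "continuous_on {- pi..pi} (\<lambda>x. f (cis x))"
    by (rule continuous_on_compose2[OF c]) (auto intro!: continuous_intros)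
  then have si: "set_integrable lborel {- pi..pi} (\<lambda>x. f (cis x))"
    by (intro borel_integrable_atLeastAtMost') auto
  have "(LBINT x:{- pi<..pi}. f (cis x)) = (LBINT x:{- pi..pi}. f (cis x))"
    unfolding set_lebesgue_integral_def
  proof (rule integral_cong_AE)
    show "AE x in lborel. indicator {- pi<..pi} x *\<^sub>R f (cis x) = indicator {- pi..pi} x *\<^sub>R f (cis x)"
      using AE_lborel_singleton[of "-pi"] by eventually_elim (auto simp: indicator_def)
  next
    show "(\<lambda>x. indicator {- pi<..pi} x *\<^sub>R f (cis x)) \<in> borel_measurable lborel"
      by (rule borel_measurable_integrable, fold set_integrable_def, rule set_integrable_subset[OF si]) auto
    show "(\<lambda>x. indicator {- pi..pi} x *\<^sub>R f (cis x)) \<in> borel_measurable lborel"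
      using si unfolding set_integrable_def by (rule borel_measurable_integrable)
  qed
  also have "\<dots> = (2 * pi) *\<^sub>R f 0"
    using set_borel_integral_eq_integral(2)[OF si] int by (simp add: integral_unique)
  finally show ?thesis
    using integral_circle[OF measurable_circle_continuous_on[OF c]] by (simp add: scaleR_conv_of_real)
qed

lemma integral_power_circle: "(LINT t|\<mu>. t ^ n) = (if n = 0 then 1 else 0)"
  by (subst mean_value_property[of UNIV]) (auto intro!: holomorphic_intros)

lemma measurable_powi [measurable]: "(\<lambda>t::complex. t powi k) \<in> borel_measurable \<mu>"
  by (intro measurable_circle_continuous_on continuous_intros) auto

lemma integral_powi_circle: "(LINT t|\<mu>. t powi k) = (if k = 0 then 1 else 0)"
proof (cases "k \<ge> 0")
  case True
  then obtain n where "k = int n" by (rule nonneg_int_cases)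
  then show ?thesis using integral_power_circle[of n] by (simp add: power_int_of_nat)
next
  case False
  then obtain n where k: "k = - int n" "n \<noteq> 0"
    by (cases k rule: int_cases4) auto
  have "(LINT t|\<mu>. t powi k) = (LINT t|\<mu>. reflect (\<lambda>t. t ^ n) t)"
    by (simp add: k reflect_def power_int_minus power_int_of_nat power_divide inverse_eq_divide)
  also have "\<dots> = (LINT t|\<mu>. t ^ n)" by (rule integral_reflect) simp
  finally show ?thesis using integral_power_circle[of n] k by simp
qed

section \<open>Lebesgue spaces\<close>

lemma LpD: "f \<in> Lp p \<Longrightarrow> f \<in> borel_measurable \<mu>"
  "f \<in> Lp p \<Longrightarrow> integrable \<mu> (\<lambda>t. norm (f t) powr p)"
  by (simp_all add: Lp_def)

lemma Lp_norm_nonneg [simp]: "0 \<le> Lp_norm p f"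
  by (simp add: Lp_norm_def)

lemma Lp_norm_powr: "0 < p \<Longrightarrow> Lp_norm p f powr p = (LINT t|\<mu>. norm (f t) powr p)"
  by (simp add: Lp_norm_def powr_powr)

lemma Lp_norm_le_iff:
  "0 < p \<Longrightarrow> 0 \<le> C \<Longrightarrow> Lp_norm p f \<le> C \<longleftrightarrow> (LINT t|\<mu>. norm (f t) powr p) \<le> C powr p"
  by (metis Lp_norm_nonneg Lp_norm_powr powr_mono2 less_imp_le not_le powr_less_mono2)

lemma Lp_cong_AE:
  assumes "f \<in> borel_measurable \<mu>" "g \<in> borel_measurable \<mu>" "AE t in \<mu>. f t = g t"
  shows "f \<in> Lp p \<longleftrightarrow> g \<in> Lp p" "Lp_norm p f = Lp_norm p g"
proof -
  have *: "AE t in \<mu>. norm (f t) powr p = norm (g t) powr p" using assms(3) by auto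
  show "f \<in> Lp p \<longleftrightarrow> g \<in> Lp p"
    using assms integrable_cong_AE[OF _ _ *] by (simp add: Lp_def)
  show "Lp_norm p f = Lp_norm p g"
    unfolding Lp_norm_def using assms by (subst integral_cong_AE[OF _ _ *]) auto
qed

lemma Lp_norm_eq_0_iff:
  assumes "0 < p" "f \<in> Lp p"
  shows "Lp_norm p f = 0 \<longleftrightarrow> (AE t in \<mu>. f t = 0)"
  using integral_nonneg_eq_0_iff_AE[OF LpD(2)[OF assms(2)]] assms(1)
  by (simp add: Lp_norm_def)

lemma Lp_scale:
  assumes "f \<in> Lp p"
  shows "(\<lambda>t. c * f t) \<in> Lp p"
  using LpD[OF assms] by (simp add: Lp_def norm_mult powr_mult)

lemma Lp_norm_scale:
  assumes "0 < p"
  shows "Lp_norm p (\<lambda>t. c * f t) = norm c * Lp_norm p f"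
  using assms by (simp add: Lp_norm_def norm_mult powr_mult powr_powr)

lemma Lp_dominated:
  assumes "0 < p" "f \<in> Lp p" "g \<in> borel_measurable \<mu>" "0 \<le> C"
    and "AE t in \<mu>. norm (g t) \<le> C * norm (f t)"
  shows "g \<in> Lp p" "Lp_norm p g \<le> C * Lp_norm p f"
proof -
  have *: "AE t in \<mu>. norm (g t) powr p \<le> C powr p * norm (f t) powr p"
    using assms(5)
  proof eventually_elim
    case (elim t)
    then have "norm (g t) powr p \<le> (C * norm (f t)) powr p"
      using assms(1) by (intro powr_mono2) auto
    then show ?case using assms(4) by (simp add: powr_mult)
  qed
  have i: "integrable \<mu> (\<lambda>t. C powr p * norm (f t) powr p)"
    using LpD(2)[OF assms(2)] by simp
  have ig: "integrable \<mu> (\<lambda>t. norm (g t) powr p)"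
    by (rule Bochner_Integration.integrable_bound[OF i]) (use assms(3) * in \<open>auto simp: abs_mult\<close>)
  then show "g \<in> Lp p" using assms(3) by (simp add: Lp_def)
  have "(LINT t|\<mu>. norm (g t) powr p) \<le> (LINT t|\<mu>. C powr p * norm (f t) powr p)"
    by (rule integral_mono_AE[OF ig i *])
  also have "\<dots> = (C * Lp_norm p f) powr p"
    using assms(1,4) by (simp add: powr_mult Lp_norm_powr)
  finally show "Lp_norm p g \<le> C * Lp_norm p f"
    using assms(1,4) by (subst Lp_norm_le_iff) auto
qed

lemma prob_circle [simp]: "circle.prob circle = 1"
  using circle.prob_space by simp

lemma const_in_Lp [simp]: "(\<lambda>t. c) \<in> Lp p"
  by (simp add: Lp_def)

lemma Lp_norm_const [simp]: "0 < p \<Longrightarrow> Lp_norm p (\<lambda>t. c) = norm c"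
  by (simp add: Lp_norm_def powr_powr)

lemma bounded_in_Lp:
  assumes "0 < p" "f \<in> borel_measurable \<mu>" "0 \<le> C" "AE t in \<mu>. norm (f t) \<le> C"
  shows "f \<in> Lp p" "Lp_norm p f \<le> C"
  using Lp_dominated[of p "\<lambda>t. 1" f C] assms by auto

section \<open>The inequalities of Minkowski and Hoelder\<close>

lemma powr_convex_combination:
  fixes x y :: real
  assumes "1 \<le> p" "0 \<le> x" "0 \<le> y" "0 \<le> u" "0 \<le> v" "u + v = 1"
  shows "(u * x + v * y) powr p \<le> u * x powr p + v * y powr p"
\<comment> \<open>At the endpoint 0 the claim is \<open>w powr p \<le> w\<close> for a weight
  \<open>w\<close> between 0 and 1; convexity is applied to positive arguments.\<close>
proof (cases "x = 0 \<or> y = 0")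
  case True
  have "w powr p \<le> w" if "0 \<le> w" "w \<le> 1" for w :: real
    using powr_mono'[of 1 p w] that assms(1) by simp
  then have "u powr p * x powr p \<le> u * x powr p" "v powr p * y powr p \<le> v * y powr p"
    using assms by (auto intro!: mult_right_mono)
  then show ?thesis
    using True by (auto simp: powr_mult)
next
  case False
  then show ?thesis
    using convex_onD[OF powr_convex[OF assms(1)], of v x y] assms by (auto simp: eq_diff_eq[symmetric])
qed

text \<open>By homogeneity: \<open>norm (f t + g t) / (a + b)\<close> is bounded by the convex
  combination of \<open>norm (f t) / a\<close> and \<open>norm (g t) / b\<close> with weights
  \<open>u\<close> and \<open>v\<close>. Positive upper bounds \<open>a\<close>, \<open>b\<close>
  stand in for the norms, which may be 0, and are then let down to them.\<close>

lemma Lp_add: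
  assumes "1 \<le> p" "f \<in> Lp p" "g \<in> Lp p"
  shows "(\<lambda>t. f t + g t) \<in> Lp p" "Lp_norm p (\<lambda>t. f t + g t) \<le> Lp_norm p f + Lp_norm p g"
proof -
  note [measurable] = LpD(1)[OF assms(2)] LpD(1)[OF assms(3)]
  have p: "0 < p" using assms(1) by simp
  define I where "I = (\<lambda>f :: complex \<Rightarrow> complex. LINT t|\<mu>. norm (f t) powr p)"
  have key: "(\<lambda>t. f t + g t) \<in> Lp p \<and> Lp_norm p (\<lambda>t. f t + g t) \<le> a + b"
    if ab: "0 < a" "0 < b" "Lp_norm p f \<le> a" "Lp_norm p g \<le> b" for a b
  proof -
    define u v where "u = a / (a + b)" and "v = b / (a + b)"
    have uv: "0 \<le> u" "0 \<le> v" "u + v = 1" using ab by (auto simp: u_def v_def add_divide_distrib[symmetric])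
    have *: "norm (f t + g t) powr p
        \<le> (a + b) powr p * (u * (norm (f t) / a) powr p + v * (norm (g t) / b) powr p)" for t
    proof -
      have "norm (f t + g t) powr p \<le> (norm (f t) + norm (g t)) powr p"
        using p norm_triangle_ineq by (intro powr_mono2) auto
      also have "norm (f t) + norm (g t) = (a + b) * (u * (norm (f t) / a) + v * (norm (g t) / b))"
      proof -
        have "u * (norm (f t) / a) = norm (f t) / (a + b)" "v * (norm (g t) / b) = norm (g t) / (a + b)"
          using ab by (simp_all add: u_def v_def)
        then show ?thesis using ab by (simp add: add_divide_distrib[symmetric])
      qed
      also have "\<dots> powr p = (a + b) powr p * (u * (norm (f t) / a) + v * (norm (g t) / b)) powr p"
        using ab uv by (intro powr_mult)
      also have "\<dots> \<le> (a + b) powr p * (u * (norm (f t) / a) powr p + v * (norm (g t) / b) powr p)"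
        using ab uv assms(1) by (intro mult_left_mono powr_convex_combination) auto
      finally show ?thesis .
    qed
    have if_: "integrable \<mu> (\<lambda>t. (norm (f t) / a) powr p)" and ig: "integrable \<mu> (\<lambda>t. (norm (g t) / b) powr p)"
      using LpD(2)[OF assms(2)] LpD(2)[OF assms(3)] ab by (simp_all add: powr_divide)
    have dom: "integrable \<mu> (\<lambda>t. (a + b) powr p * (u * (norm (f t) / a) powr p + v * (norm (g t) / b) powr p))"
      using if_ ig by simp
    have int: "integrable \<mu> (\<lambda>t. norm (f t + g t) powr p)"
      by (rule Bochner_Integration.integrable_bound[OF dom])
         (use * in \<open>auto intro: order_trans[OF _ abs_ge_self]\<close>)
    have "(LINT t|\<mu>. norm (f t + g t) powr p)
        \<le> (LINT t|\<mu>. (a + b) powr p * (u * (norm (f t) / a) powr p + v * (norm (g t) / b) powr p))"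
      by (rule integral_mono[OF int dom *])
    also have "\<dots> = (a + b) powr p * (u * (LINT t|\<mu>. (norm (f t) / a) powr p) + v * (LINT t|\<mu>. (norm (g t) / b) powr p))"
      using if_ ig by simp
    also have "\<dots> = (a + b) powr p * (u * (I f / a powr p) + v * (I g / b powr p))"
      using ab by (simp add: powr_divide I_def)
    also have "\<dots> \<le> (a + b) powr p * (u * 1 + v * 1)"
      using ab p uv by (intro mult_left_mono add_mono) (auto simp: Lp_norm_le_iff I_def divide_le_eq_1)
    also have "\<dots> = (a + b) powr p" using uv by simp
    finally show ?thesis
      using int p ab by (subst Lp_norm_le_iff) (auto simp: Lp_def)
  qed
  show "(\<lambda>t. f t + g t) \<in> Lp p"
    using key[of "Lp_norm p f + 1" "Lp_norm p g + 1"] by (auto simp: add_nonneg_pos)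
  show "Lp_norm p (\<lambda>t. f t + g t) \<le> Lp_norm p f + Lp_norm p g"
  proof (rule field_le_epsilon)
    fix e :: real assume "0 < e"
    then show "Lp_norm p (\<lambda>t. f t + g t) \<le> Lp_norm p f + Lp_norm p g + e"
      using key[of "Lp_norm p f + e / 2" "Lp_norm p g + e / 2"] by (auto simp: add_nonneg_pos)
  qed
qed

lemma Lp_diff:
  assumes "1 \<le> p" "f \<in> Lp p" "g \<in> Lp p"
  shows "(\<lambda>t. f t - g t) \<in> Lp p" "Lp_norm p (\<lambda>t. f t - g t) \<le> Lp_norm p f + Lp_norm p g"
  using Lp_add[OF assms(1,2) Lp_scale[OF assms(3), of "-1"]] Lp_norm_scale[of p "-1" g] assms(1) by auto

lemma Lp_norm_minus_commute: "Lp_norm p (\<lambda>t. f t - g t) = Lp_norm p (\<lambda>t. g t - f t)"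
  by (simp add: Lp_norm_def norm_minus_commute)

lemma Lp_norm_triangle_diff:
  assumes "1 \<le> p" "f \<in> Lp p" "g \<in> Lp p" "h \<in> Lp p"
  shows "Lp_norm p (\<lambda>t. f t - h t) \<le> Lp_norm p (\<lambda>t. f t - g t) + Lp_norm p (\<lambda>t. g t - h t)"
  using Lp_add(2)[OF assms(1) Lp_diff(1)[OF assms(1,2,3)] Lp_diff(1)[OF assms(1,3,4)]] by simp

text \<open>Young's inequality for the functions divided by \<open>a\<close> and \<open>b\<close>,
  positive upper bounds of their norms; letting these decrease to the norms covers functions of norm
  0.\<close>

lemma Lp_Hoelder:
  assumes "1 < p" "1 < q" "1 / p + 1 / q = 1" "f \<in> Lp p" "g \<in> Lp q"
  shows "integrable \<mu> (\<lambda>t. f t * g t)"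
    "(LINT t|\<mu>. norm (f t * g t)) \<le> Lp_norm p f * Lp_norm q g"
    "norm (LINT t|\<mu>. f t * g t) \<le> Lp_norm p f * Lp_norm q g"
proof -
  note [measurable] = LpD(1)[OF assms(4)] LpD(1)[OF assms(5)]
  define I where "I = (LINT t|\<mu>. norm (f t) powr p)"
  define J where "J = (LINT t|\<mu>. norm (g t) powr q)"
  have key: "integrable \<mu> (\<lambda>t. f t * g t) \<and> (LINT t|\<mu>. norm (f t * g t)) \<le> a * b"
    if ab: "0 < a" "0 < b" "Lp_norm p f \<le> a" "Lp_norm q g \<le> b" for a b
  proof -
    have *: "norm (f t * g t) \<le> a * b * ((norm (f t) / a) powr p / p + (norm (g t) / b) powr q / q)" for t
    proof -
      have "norm (f t) / a * (norm (g t) / b) \<le> (norm (f t) / a) powr p / p + (norm (g t) / b) powr q / q"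
        using assms(1-3) ab by (intro Youngs_inequality) auto
      then have "a * b * (norm (f t) / a * (norm (g t) / b))
          \<le> a * b * ((norm (f t) / a) powr p / p + (norm (g t) / b) powr q / q)"
        using ab by (intro mult_left_mono) auto
      then show ?thesis using ab by (simp add: norm_mult)
    qed
    have if_: "integrable \<mu> (\<lambda>t. (norm (f t) / a) powr p)" and ig: "integrable \<mu> (\<lambda>t. (norm (g t) / b) powr q)"
      using LpD(2)[OF assms(4)] LpD(2)[OF assms(5)] ab by (simp_all add: powr_divide)
    have dom: "integrable \<mu> (\<lambda>t. a * b * ((norm (f t) / a) powr p / p + (norm (g t) / b) powr q / q))"
      using if_ ig by simp
    have int: "integrable \<mu> (\<lambda>t. f t * g t)"
      by (rule Bochner_Integration.integrable_bound[OF dom])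
         (use * in \<open>auto intro: order_trans[OF _ abs_ge_self]\<close>)
    have "(LINT t|\<mu>. norm (f t * g t))
        \<le> (LINT t|\<mu>. a * b * ((norm (f t) / a) powr p / p + (norm (g t) / b) powr q / q))"
      by (rule integral_mono[OF integrable_norm[OF int] dom *])
    also have "\<dots> = a * b * ((LINT t|\<mu>. (norm (f t) / a) powr p) / p + (LINT t|\<mu>. (norm (g t) / b) powr q) / q)"
      using if_ ig by simp
    also have "\<dots> = a * b * ((I / a powr p) / p + (J / b powr q) / q)"
      using ab by (simp add: powr_divide I_def J_def)
    also have "\<dots> \<le> a * b * (1 / p + 1 / q)"
      using ab assms(1-2)
      by (intro mult_left_mono add_mono divide_right_mono)
         (auto simp: Lp_norm_le_iff I_def J_def divide_le_eq_1)
    also have "\<dots> = a * b" using assms(3) by simp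
    finally show ?thesis using int by simp
  qed
  show "integrable \<mu> (\<lambda>t. f t * g t)"
    using key[of "Lp_norm p f + 1" "Lp_norm q g + 1"] by (auto simp: add_nonneg_pos)
  show *: "(LINT t|\<mu>. norm (f t * g t)) \<le> Lp_norm p f * Lp_norm q g"
  proof (rule tendsto_lowerbound)
    show "((\<lambda>e. (Lp_norm p f + e) * (Lp_norm q g + e)) \<longlongrightarrow> Lp_norm p f * Lp_norm q g) (at_right 0)"
      by (auto intro!: tendsto_eq_intros)
    show "\<forall>\<^sub>F e in at_right 0. (LINT t|\<mu>. norm (f t * g t)) \<le> (Lp_norm p f + e) * (Lp_norm q g + e)"
      using eventually_at_right_less[of 0]
      by eventually_elim (use key in \<open>auto simp: add_nonneg_pos\<close>)
  qed simp
  show "norm (LINT t|\<mu>. f t * g t) \<le> Lp_norm p f * Lp_norm q g"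
    by (rule order_trans[OF integral_norm_bound *])
qed

lemma Lp_integrable:
  assumes "1 \<le> p" "f \<in> Lp p"
  shows "integrable \<mu> f" "(LINT t|\<mu>. norm (f t)) \<le> Lp_norm p f" "norm (LINT t|\<mu>. f t) \<le> Lp_norm p f"
proof -
  have "integrable \<mu> f \<and> (LINT t|\<mu>. norm (f t)) \<le> Lp_norm p f"
  proof (cases "p = 1")
    case True
    then show ?thesis
      using assms(2) by (auto simp: Lp_def Lp_norm_def integrable_norm_iff)
  next
    case False
    then have p: "1 < p" using assms(1) by simp
    define q where "q = conj_exponent p"
    have q: "1 < q" "1 / p + 1 / q = 1"
      using p conj_exponent[OF p] by (simp_all add: q_def conj_exponent_def)
    show ?thesis
      using Lp_Hoelder(1,2)[OF p q assms(2) const_in_Lp[of 1]] q by auto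
  qed
  then show "integrable \<mu> f" "(LINT t|\<mu>. norm (f t)) \<le> Lp_norm p f" by auto
  then show "norm (LINT t|\<mu>. f t) \<le> Lp_norm p f"
    using order_trans[OF integral_norm_bound] by blast
qed

text \<open>Fatou's lemma: pointwise convergence with bounded norms is enough, and convergence in
  norm is not claimed. It serves for the tails of series and for \<open>1 / f\<close> as a limit of
  truncations.\<close>

lemma Lp_limit:
  assumes "0 < p" "0 \<le> C" and x: "\<And>k. x k \<in> Lp p" "\<And>k. Lp_norm p (x k) \<le> C"
    and [measurable]: "s \<in> borel_measurable \<mu>" and lim: "AE t in \<mu>. (\<lambda>k. x k t) \<longlonglongrightarrow> s t"
  shows "s \<in> Lp p" "Lp_norm p s \<le> C"
proof -
  note [measurable] = LpD(1)[OF x(1)]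
  have nn: "(\<integral>\<^sup>+t. ennreal (norm (x k t) powr p) \<partial>\<mu>) \<le> ennreal (C powr p)" for k
    using x[of k] assms(1,2) LpD(2)[OF x(1)]
    by (subst nn_integral_eq_integral) (auto simp: Lp_norm_le_iff)
  have "(\<integral>\<^sup>+t. ennreal (norm (s t) powr p) \<partial>\<mu>) = (\<integral>\<^sup>+t. liminf (\<lambda>k. ennreal (norm (x k t) powr p)) \<partial>\<mu>)"
    using lim
  proof (intro nn_integral_cong_AE, eventually_elim)
    case (elim t)
    then have "(\<lambda>k. ennreal (norm (x k t) powr p)) \<longlonglongrightarrow> ennreal (norm (s t) powr p)"
      using assms(1) by (intro tendsto_intros tendsto_powr') auto
    then show ?case by (rule lim_imp_Liminf[OF sequentially_bot, symmetric])
  qed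
  also have "\<dots> \<le> liminf (\<lambda>k. \<integral>\<^sup>+t. ennreal (norm (x k t) powr p) \<partial>\<mu>)"
    by (rule nn_integral_liminf) measurable
  also have "\<dots> \<le> ennreal (C powr p)"
    using nn by (intro Liminf_le) auto
  finally have le: "(\<integral>\<^sup>+t. ennreal (norm (s t) powr p) \<partial>\<mu>) \<le> ennreal (C powr p)" .
  then have "integrable \<mu> (\<lambda>t. norm (s t) powr p)"
    by (intro integrableI_nonneg) (auto simp: top.extremum_strict intro: le_less_trans)
  then show s: "s \<in> Lp p" by (simp add: Lp_def)
  show "Lp_norm p s \<le> C"
    using le assms(1,2) LpD(2)[OF s]
    by (subst (asm) nn_integral_eq_integral) (auto simp: Lp_norm_le_iff)
qed

lemma Lp_dominated_convergence:
  assumes "0 < p" "f \<in> Lp p" and [measurable]: "\<And>k. x k \<in> borel_measurable \<mu>"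
    and dom: "\<And>k. AE t in \<mu>. norm (x k t) \<le> C * norm (f t)"
    and lim: "AE t in \<mu>. (\<lambda>k. x k t) \<longlonglongrightarrow> 0"
  shows "(\<lambda>k. Lp_norm p (x k)) \<longlonglongrightarrow> 0"
proof -
  have "(\<lambda>k. LINT t|\<mu>. norm (x k t) powr p) \<longlonglongrightarrow> (LINT t|\<mu>. 0)"
  proof (rule integral_dominated_convergence)
    show "integrable \<mu> (\<lambda>t. \<bar>C\<bar> powr p * norm (f t) powr p)"
      using LpD(2)[OF assms(2)] by simp
    show "AE t in \<mu>. (\<lambda>k. norm (x k t) powr p) \<longlonglongrightarrow> 0"
      using lim
    proof eventually_elim
      case (elim t)
      then have "(\<lambda>k. norm (x k t)) \<longlonglongrightarrow> 0" by (rule tendsto_norm_zero)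
      from tendsto_powr'[OF this tendsto_const[of p]] show ?case using assms(1) by auto
    qed
    show "AE t in \<mu>. norm (norm (x k t) powr p) \<le> \<bar>C\<bar> powr p * norm (f t) powr p" for k
      using dom[of k]
    proof eventually_elim
      case (elim t)
      then have "norm (x k t) \<le> \<bar>C\<bar> * norm (f t)"
        by (rule order_trans) (auto intro: mult_right_mono)
      then have "norm (x k t) powr p \<le> (\<bar>C\<bar> * norm (f t)) powr p"
        using assms(1) by (intro powr_mono2) auto
      then show ?case by (simp add: powr_mult)
    qed
  qed auto
  from tendsto_powr'[OF this tendsto_const[of "1 / p"]] assms(1)
  show ?thesis by (simp add: Lp_norm_def)
qed

lemma Lp_norm_reflect:
  assumes "f \<in> Lp p"
  shows "reflect f \<in> Lp p" "Lp_norm p (reflect f) = Lp_norm p f"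
proof -
  have [measurable]: "f \<in> borel_measurable \<mu>" by (rule LpD(1)[OF assms])
  show "reflect f \<in> Lp p"
    using integrable_inversion[OF LpD(2)[OF assms]] measurable_reflect[OF LpD(1)[OF assms]]
    by (simp add: Lp_def reflect_def)
  have "(LINT t|\<mu>. norm (f (1 / t)) powr p) = (LINT t|\<mu>. norm (f t) powr p)"
    using integral_distr[OF measurable_inversion, of "\<lambda>t. norm (f t) powr p"]
    by (simp add: distr_inversion)
  then show "Lp_norm p (reflect f) = Lp_norm p f" by (simp add: Lp_norm_def reflect_def)
qed

text \<open>Riesz-Fischer for series with geometrically decaying terms and with an explicit bound on
  the tails, the form of completeness on which the open mapping theorem is built.\<close>

lemma Lp_complete:
  assumes p: "1 \<le> p" and x: "\<And>k. x k \<in> Lp p" "\<And>k. Lp_norm p (x k) \<le> C * (1 / 2) ^ k"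
  obtains s where "s \<in> Lp p" "\<And>m. Lp_norm p (\<lambda>t. s t - (\<Sum>k<m. x k t)) \<le> 2 * C * (1 / 2) ^ m"
proof -
  note [measurable] = LpD(1)[OF x(1)]
  have p0: "0 < p" using p by simp
  have C: "0 \<le> C" using order_trans[OF Lp_norm_nonneg x(2)[of 0]] by simp
  have geo: "(\<Sum>k<n. C * (1 / 2) ^ k) \<le> 2 * C" for n
  proof -
    have "(\<Sum>k<n. (1 / 2 :: real) ^ k) = 2 - 2 * (1 / 2) ^ n"
      by (induction n) auto
    then show ?thesis using C by (simp add: sum_distrib_left[symmetric] right_diff_distrib)
  qed
  \<comment> \<open>The moduli, taken as complex functions so that the norm estimate for sums
    applies to the majorant series too.\<close>
  define y where "y = (\<lambda>k t. complex_of_real (norm (x k t)))"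
  have y: "y k \<in> Lp p" "Lp_norm p (y k) = Lp_norm p (x k)" for k
    using LpD[OF x(1)[of k]] by (auto simp: y_def Lp_def Lp_norm_def)
  have sums: "(\<lambda>t. \<Sum>k\<in>I. z k t) \<in> Lp p \<and> Lp_norm p (\<lambda>t. \<Sum>k\<in>I. z k t) \<le> (\<Sum>k\<in>I. Lp_norm p (z k))"
    if "\<And>k. z k \<in> Lp p" for z :: "nat \<Rightarrow> complex \<Rightarrow> complex" and I
  proof (induction I rule: infinite_finite_induct)
    case (insert i I)
    then show ?case
      using Lp_add[OF p that[of i], of "\<lambda>t. \<Sum>k\<in>I. z k t"] by (auto intro: Lp_add(1)[OF p])
  qed (use p0 in auto)
  have sy: "Lp_norm p (\<lambda>t. \<Sum>k<n. y k t) \<le> 2 * C" for n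
    using sums[where z=y, OF y(1), of "{..<n}"] sum_mono[of "{..<n}" "\<lambda>k. Lp_norm p (y k)" "\<lambda>k. C * (1 / 2) ^ k"]
      x(2) y(2) geo[of n] by auto
  have "(\<integral>\<^sup>+t. (SUP n. ennreal (norm (\<Sum>k<n. y k t) powr p)) \<partial>\<mu>)
      = (SUP n. \<integral>\<^sup>+t. ennreal (norm (\<Sum>k<n. y k t) powr p) \<partial>\<mu>)"
  proof (rule nn_integral_monotone_convergence_SUP)
    have "(\<Sum>k<m. norm (x k t)) \<le> (\<Sum>k<n. norm (x k t))" if "m \<le> n" for m n t
      using that by (intro sum_mono2) auto
    then show "incseq (\<lambda>n t. ennreal (norm (\<Sum>k<n. y k t) powr p))"
      using p0 unfolding y_def
      by (auto simp: incseq_def le_fun_def sum_nonneg intro!: ennreal_leI powr_mono2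
          simp flip: of_real_sum)
  qed (auto simp: y_def)
  also have "\<dots> \<le> ennreal ((2 * C) powr p)"
    using sy sums[where z=y, OF y(1)] p0 C
    by (intro SUP_least, subst nn_integral_eq_integral) (auto simp: Lp_norm_le_iff Lp_def)
  also have "\<dots> < \<infinity>" by simp
  finally have "AE t in \<mu>. (SUP n. ennreal (norm (\<Sum>k<n. y k t) powr p)) \<noteq> \<infinity>"
    by (intro nn_integral_PInf_AE) (auto simp: y_def)
  then have summ: "AE t in \<mu>. summable (\<lambda>k. x k t)"
  proof eventually_elim
    case (elim t)
    then obtain B where B: "(SUP n. ennreal (norm (\<Sum>k<n. y k t) powr p)) = ennreal B" "0 \<le> B"
      by (metis ennreal_cases infinity_ennreal_def)
    have "(\<Sum>k<n. norm (x k t)) \<le> B powr (1 / p)" for n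
    proof -
      have "ennreal (norm (\<Sum>k<n. y k t) powr p) \<le> ennreal B"
        unfolding B(1)[symmetric] by (rule SUP_upper) simp
      then have "norm (\<Sum>k<n. y k t) powr p \<le> B" using B(2) by simp
      then have "(norm (\<Sum>k<n. y k t) powr p) powr (1 / p) \<le> B powr (1 / p)"
        using p0 by (intro powr_mono2) auto
      then show ?thesis
        using p0 by (simp add: powr_powr y_def sum_nonneg flip: of_real_sum)
    qed
    then have "summable (\<lambda>k. norm (x k t))"
      by (intro bounded_imp_summable[where B = "B powr (1 / p)"]) (simp_all del: sum.lessThan_Suc flip: lessThan_Suc_atMost)
    then show ?case by (rule summable_norm_cancel)
  qed
  define s where "s = (\<lambda>t. \<Sum>k. x k t)"
  have [measurable]: "s \<in> borel_measurable \<mu>" unfolding s_def by measurable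
  \<comment> \<open>Blocks of the series are bounded independently of their length; Fatou's lemma
    carries the bound over to the whole tail.\<close>
  have tail: "Lp_norm p (\<lambda>t. \<Sum>k=m..<m + n. x k t) \<le> 2 * C * (1 / 2) ^ m" for m n
  proof -
    have "Lp_norm p (\<lambda>t. \<Sum>k=m..<m + n. x k t) \<le> (\<Sum>k=m..<m + n. C * (1 / 2) ^ k)"
      using sums[where z=x, OF x(1), of "{m..<m + n}"] sum_mono[of "{m..<m + n}" "\<lambda>k. Lp_norm p (x k)"] x(2)
      by (meson order_trans)
    also have "\<dots> = (\<Sum>k<n. C * (1 / 2) ^ k) * (1 / 2) ^ m"
      by (simp add: sum_distrib_left sum.atLeastLessThan_shift_0[of _ m] atLeast0LessThan power_add mult_ac)
    also have "\<dots> \<le> 2 * C * (1 / 2) ^ m" using geo by (intro mult_right_mono) auto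
    finally show ?thesis .
  qed
  have part: "(\<lambda>t. s t - (\<Sum>k<m. x k t)) \<in> Lp p \<and> Lp_norm p (\<lambda>t. s t - (\<Sum>k<m. x k t)) \<le> 2 * C * (1 / 2) ^ m" for m
  proof -
    have lim: "AE t in \<mu>. (\<lambda>n. \<Sum>k=m..<m + n. x k t) \<longlonglongrightarrow> s t - (\<Sum>k<m. x k t)"
      using summ
    proof eventually_elim
      case (elim t)
      then have "(\<lambda>n. \<Sum>k<n. x k t) \<longlonglongrightarrow> s t" unfolding s_def by (rule summable_LIMSEQ)
      then have "(\<lambda>n. (\<Sum>k<n + m. x k t) - (\<Sum>k<m. x k t)) \<longlonglongrightarrow> s t - (\<Sum>k<m. x k t)"
        by (intro tendsto_intros LIMSEQ_ignore_initial_segment)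
      moreover have "(\<Sum>k<n + m. x k t) - (\<Sum>k<m. x k t) = (\<Sum>k=m..<m + n. x k t)" for n
        using sum_diff_nat_ivl[of 0 m "n + m" "\<lambda>k. x k t"] by (simp add: atLeast0LessThan add.commute)
      ultimately show ?case by simp
    qed
    show ?thesis
      using Lp_limit[OF p0 _ conjunct1[OF sums[where z=x, OF x(1)]] tail _ lim] C by auto
  qed
  show ?thesis
    using part[of 0] part by (intro that[of s]) auto
qed

lemma Linf_mult:
  assumes "0 < p" "a \<in> Linf" "f \<in> Lp p"
  shows "(\<lambda>t. a t * f t) \<in> Lp p"
proof -
  obtain C where C: "AE t in \<mu>. norm (a t) \<le> C" using assms(2) by (auto simp: Linf_def)
  show ?thesis
  proof (rule Lp_dominated(1)[OF assms(1,3), of _ "max C 0"])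
    show "AE t in \<mu>. norm (a t * f t) \<le> max C 0 * norm (f t)"
      using C by eventually_elim (auto simp: norm_mult intro: mult_right_mono)
  qed (use assms LpD in \<open>auto simp: Linf_def\<close>)
qed

section \<open>Trigonometric polynomials\<close>

text \<open>Only the values on the circle matter, hence the last clause.\<close>

inductive trig :: "(complex \<Rightarrow> complex) \<Rightarrow> bool" where
  trig_monom: "trig (\<lambda>t. c * t powi k)"
| trig_add: "trig f \<Longrightarrow> trig g \<Longrightarrow> trig (\<lambda>t. f t + g t)"
| trig_cong: "trig f \<Longrightarrow> (\<And>t. t \<in> circle \<Longrightarrow> g t = f t) \<Longrightarrow> trig g"

lemma trig_const: "trig (\<lambda>t. c)"
  using trig_monom[of c 0] by simp

lemma trig_mult:
  assumes "trig f" "trig g"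
  shows "trig (\<lambda>t. f t * g t)"
  using assms(1)
proof (induction rule: trig.induct)
  case (trig_monom c k)
  from assms(2) show ?case
  proof (induction rule: trig.induct)
    case (trig_monom d l)
    show ?case
      by (rule trig_cong[OF trig.trig_monom[of "c * d" "k + l"]]) (auto simp: power_int_add circle_nonzero)
  next
    case (trig_add f g)
    then show ?case using trig.trig_add by (fastforce simp: distrib_left)
  next
    case (trig_cong f g)
    then show ?case by (auto intro: trig.trig_cong)
  qed
next
  case (trig_add f h)
  then show ?case using trig.trig_add by (fastforce simp: distrib_right)
next
  case (trig_cong f h)
  then show ?case by (auto intro: trig.trig_cong)
qed

lemma cnj_circle: "t \<in> circle \<Longrightarrow> cnj t = 1 / t"
  by (metis complex_cnj_cnj complex_div_cnj complex_mod_cnj divide_conv_cnj mem_sphere_0 mult_1 one_power2 of_real_1 power_one)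

lemma cnj_powi: "t \<in> circle \<Longrightarrow> cnj (t powi k) = t powi (- k)"
  by (simp add: power_int_minus complex_cnj_power_int power_int_divide_distrib cnj_circle inverse_eq_divide)

lemma trig_cnj:
  assumes "trig f"
  shows "trig (\<lambda>t. cnj (f t))"
  using assms
proof (induction rule: trig.induct)
  case (trig_monom c k)
  show ?case by (rule trig_cong[OF trig.trig_monom[of "cnj c" "- k"]]) (simp only: complex_cnj_mult cnj_powi)
next
  case (trig_add f g)
  then show ?case using trig.trig_add by fastforce
next
  case (trig_cong f h)
  then show ?case by (auto intro: trig.trig_cong)
qed

lemma trig_Re: "trig f \<Longrightarrow> trig (\<lambda>t. of_real (Re (f t)))"
proof -
  assume f: "trig f"
  have "trig (\<lambda>t. (1 / 2) * (f t + cnj (f t)))"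
    by (intro trig_mult trig_const trig_add f trig_cnj)
  then show ?thesis by (simp add: complex_add_cnj)
qed

lemma trig_reflect:
  assumes "trig f"
  shows "trig (reflect f)"
  using assms unfolding reflect_def
proof (induction rule: trig.induct)
  case (trig_monom c k)
  have "(\<lambda>t. c * (1 / t) powi k) = (\<lambda>t. c * t powi (- k))"
    by (simp add: power_int_minus power_int_divide_distrib inverse_eq_divide)
  then show ?case using trig.trig_monom by simp
next
  case (trig_add f g)
  then show ?case using trig.trig_add by fastforce
next
  case (trig_cong f h)
  then show ?case by (auto intro!: trig.trig_cong[OF trig_cong(3)] trig_cong(2) simp: norm_divide)
qed

lemma trig_continuous: "trig f \<Longrightarrow> continuous_on circle f"
proof (induction rule: trig.induct)
  case (trig_cong f g)
  then show ?case using continuous_on_cong[OF refl trig_cong(2), of circle] by simp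
qed (auto intro!: continuous_intros)

lemma trig_measurable: "trig f \<Longrightarrow> f \<in> borel_measurable \<mu>"
  by (intro measurable_circle_continuous_on trig_continuous)

lemma continuous_on_circle_bounded:
  fixes f :: "complex \<Rightarrow> complex"
  assumes "continuous_on circle f"
  obtains C where "0 \<le> C" "\<And>t. t \<in> circle \<Longrightarrow> norm (f t) \<le> C"
proof -
  have "bounded (f ` circle)"
    by (intro compact_imp_bounded compact_continuous_image assms) auto
  then obtain C where "\<And>t. t \<in> circle \<Longrightarrow> norm (f t) \<le> C"
    by (metis bounded_iff imageI)
  then show ?thesis using that[of "max C 0"] by (metis max.cobounded2 max.coboundedI1)
qed

lemma continuous_on_circle_in_Lp:
  assumes "0 < p" "continuous_on circle f"
  shows "f \<in> Lp p"
proof -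
  obtain C where "0 \<le> C" "\<And>t. t \<in> circle \<Longrightarrow> norm (f t) \<le> C"
    using continuous_on_circle_bounded[OF assms(2)] by blast
  then show ?thesis
    using bounded_in_Lp(1)[OF assms(1) measurable_circle_continuous_on[OF assms(2)], of C] AE_circle by auto
qed

lemma trig_in_Lp: "0 < p \<Longrightarrow> trig f \<Longrightarrow> f \<in> Lp p"
  by (intro continuous_on_circle_in_Lp trig_continuous)

lemma poly_in_Lp: "0 < p \<Longrightarrow> poly a \<in> Lp p"
  by (intro continuous_on_circle_in_Lp continuous_intros)

text \<open>The additional division by \<open>t\<close> keeps the constant term out of the second
  summand, so that \<open>a\<close> carries exactly the coefficients of index at least 0.\<close>

lemma trig_laurent:
  assumes "trig f"
  obtains a b where "\<And>t. t \<in> circle \<Longrightarrow> f t = poly a t + poly b (1 / t) / t"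
proof -
  from assms have "\<exists>a b. \<forall>t\<in>circle. f t = poly a t + poly b (1 / t) / t"
  proof (induction rule: trig.induct)
    case (trig_monom c k)
    show ?case
    proof (cases "k \<ge> 0")
      case True
      then obtain n where "k = int n" by (rule nonneg_int_cases)
      then show ?thesis by (intro exI[of _ "monom c n"] exI[of _ 0]) (simp add: poly_monom)
    next
      case False
      then obtain n where "k = - int (Suc n)" by (metis not_le negD)
      then show ?thesis
        by (intro exI[of _ 0] exI[of _ "monom c n"])
           (simp add: poly_monom power_int_minus power_divide inverse_eq_divide flip: power_Suc2 del: of_nat_Suc)
    qed
  next
    case (trig_add f g)
    then obtain a b a' b' where "\<forall>t\<in>circle. f t = poly a t + poly b (1 / t) / t"
      "\<forall>t\<in>circle. g t = poly a' t + poly b' (1 / t) / t" by blast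
    then show ?case
      by (intro exI[of _ "a + a'"] exI[of _ "b + b'"]) (auto simp: add_divide_distrib)
  qed auto
  then show ?thesis using that by blast
qed

lemma poly_trig: "trig (poly a)"
proof (induction a rule: pCons_induct)
  case (pCons c a)
  have "trig (\<lambda>t. c + (1 * t powi 1) * poly a t)"
    by (intro trig_add trig_mult trig_const trig_monom pCons)
  then show ?case by simp
qed (use trig_const[of 0] in simp)

lemma laurent_trig: "trig (\<lambda>t. poly a t + poly b (1 / t) / t)"
proof -
  have "trig (\<lambda>t. poly a t + reflect (\<lambda>t. t powi 1 * poly b t) t)"
    using trig_monom[of 1 1] by (intro trig_add trig_mult trig_reflect poly_trig) auto
  then show ?thesis by (simp add: reflect_def)
qed

section \<open>Density of the trigonometric polynomials\<close>

lemma trig_uniform_approx: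
  fixes f :: "complex \<Rightarrow> complex"
  assumes "continuous_on circle f" "0 < e"
  obtains u where "trig u" "\<And>t. t \<in> circle \<Longrightarrow> norm (f t - u t) < e"
proof -
  obtain P where P: "polynomial_function P" "\<And>t. t \<in> circle \<Longrightarrow> norm (f t - P t) < e"
    using Stone_Weierstrass_polynomial_function[OF _ assms] by auto
  have real: "trig (\<lambda>t. of_real (h t))" if "real_polynomial_function h" for h :: "complex \<Rightarrow> real"
    using that
  proof (induction rule: real_polynomial_function.induct)
    case (linear h)
    interpret bounded_linear h by fact
    \<comment> \<open>A real-linear functional is determined by its values at 1 and
      \<open>\<i>\<close>. The coordinate \<open>Im t\<close> is written as
      \<open>Re (- \<i> * t)\<close>, so that only real parts of monomials occur.\<close>
    have h: "h t = Re t * h 1 + Re (- \<i> * t) * h \<i>" for t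
    proof -
      have "t = Re t *\<^sub>R 1 + Im t *\<^sub>R \<i>" by (simp add: complex_eq_iff)
      then have "h t = h (Re t *\<^sub>R 1 + Im t *\<^sub>R \<i>)" by (rule arg_cong)
      then show ?thesis by (simp only: add scaleR) simp
    qed
    have "trig (\<lambda>t. of_real (Re t) * of_real (h 1) + of_real (Re (- \<i> * t)) * of_real (h \<i>))"
      using trig_monom[of 1 1] trig_monom[of "- \<i>" 1] by (intro trig_add trig_mult trig_const trig_Re) auto
    then show ?case by (rule trig_cong) (subst h, simp)
  qed (auto intro: trig_const trig_add trig_mult)
  have "real_polynomial_function (Re \<circ> P)" "real_polynomial_function (Im \<circ> P)"
    using P(1) bounded_linear_Re bounded_linear_Im by (simp_all add: polynomial_function_def)
  from this[THEN real] have "trig (\<lambda>t. of_real (Re (P t)) + \<i> * of_real (Im (P t)))"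
    by (intro trig_add trig_mult trig_const) simp_all
  then have "trig P" by (simp add: complex_eq[symmetric])
  then show ?thesis using P(2) by (rule that)
qed

lemma measurable_Collect_LIMSEQ:
  fixes f :: "nat \<Rightarrow> 'a \<Rightarrow> 'b::{second_countable_topology, real_normed_vector}"
  assumes [measurable]: "\<And>k. f k \<in> borel_measurable M" "l \<in> borel_measurable M"
  shows "Measurable.pred M (\<lambda>x. (\<lambda>k. f k x) \<longlonglongrightarrow> l x)"
proof -
  have "(\<lambda>k. f k x) \<longlonglongrightarrow> l x \<longleftrightarrow> (\<forall>j. \<exists>m. \<forall>k\<in>{m..}. dist (f k x) (l x) < inverse (real (Suc j)))" for x
  proof
    assume *: "\<forall>j. \<exists>m. \<forall>k\<in>{m..}. dist (f k x) (l x) < inverse (real (Suc j))"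
    show "(\<lambda>k. f k x) \<longlonglongrightarrow> l x"
    proof (rule metric_LIMSEQ_I)
      fix r :: real assume "0 < r"
      then obtain j where "inverse (real (Suc j)) < r" using reals_Archimedean by blast
      with * show "\<exists>no. \<forall>n\<ge>no. dist (f n x) (l x) < r" by (meson atLeast_iff less_trans)
    qed
  next
    assume "(\<lambda>k. f k x) \<longlonglongrightarrow> l x"
    from metric_LIMSEQ_D[OF this]
    show "\<forall>j. \<exists>m. \<forall>k\<in>{m..}. dist (f k x) (l x) < inverse (real (Suc j))"
      by (metis atLeast_iff inverse_positive_iff_positive of_nat_0_less_iff zero_less_Suc)
  qed
  then show ?thesis by simp
qed

text \<open>Bounded pointwise approximation serves every exponent at once through dominated
  convergence, and also the pairing with a merely integrable function. Continuous approximations on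
  the line are moved to the circle by \<open>Arg\<close> and then replaced by trigonometric
  polynomials.\<close>

lemma trig_AE_approx:
  assumes [measurable]: "\<psi> \<in> borel_measurable \<mu>" and bd: "\<And>t. norm (\<psi> t) \<le> 1"
  shows "\<exists>u. (\<forall>k. trig (u k)) \<and> (\<forall>k. \<forall>t\<in>circle. norm (u k t) \<le> 2) \<and>
    (AE t in \<mu>. (\<lambda>k. u k t) \<longlonglongrightarrow> \<psi> t)"
proof -
  have \<psi>R: "\<psi> \<in> borel_measurable (restrict_space borel circle)"
    using assms(1) by (simp cong: measurable_cong_sets[OF sets_circle_measure refl])
  define h where "h = (\<lambda>x. \<psi> (cis x))"
  have "h \<in> borel_measurable borel"
    using measurable_compose[OF measurable_cis_circle \<psi>R] by (simp add: h_def)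
  then have "h \<in> borel_measurable lebesgue"
    by (intro measurable_completion) simp
  then have "h measurable_on UNIV" by (simp add: lebesgue_measurable_imp_measurable_on)
  then obtain N g where N: "negligible N" and g: "\<And>n. continuous_on UNIV (g n)"
    and lim: "\<And>x. x \<notin> N \<Longrightarrow> (\<lambda>n. g n x) \<longlonglongrightarrow> h x"
    by (auto simp: measurable_on_def)
  \<comment> \<open>Radial retraction to the unit disc: it bounds the approximations and fixes the
    values of the limit.\<close>
  define cl where "cl = (\<lambda>z::complex. z / of_real (max 1 (norm z)))"
  have cl: "norm (cl z) \<le> 1" for z by (auto simp: cl_def norm_divide divide_le_eq)
  have cl_id: "cl z = z" if "norm z \<le> 1" for z using that by (simp add: cl_def max_absorb1)
  have cont_cl: "isCont cl z" for z
    unfolding cl_def by (intro continuous_intros) auto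
  \<comment> \<open>\<open>Arg\<close> jumps at -1. The cutoff vanishes there, which restores
    continuity on the circle, and is eventually 1 at every other point.\<close>
  define \<kappa> where "\<kappa> = (\<lambda>k::nat. \<lambda>r::real. max 0 (min 1 (real k * (1 + r))))"
  define \<phi> where "\<phi> = (\<lambda>k t. of_real (\<kappa> k (Re t)) * cl (g k (Arg t)))"
  have \<kappa>_norm: "norm (\<phi> k t) \<le> \<kappa> k (Re t)" for k t
    using cl[of "g k (Arg t)"] by (auto simp: \<phi>_def norm_mult \<kappa>_def intro!: mult_left_le)
  have \<kappa>1: "0 \<le> \<kappa> k r" "\<kappa> k r \<le> 1" for k r by (auto simp: \<kappa>_def)
  have cont: "continuous_on circle (\<phi> k)" for k
  proof (unfold continuous_on_eq_continuous_within, intro ballI)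
    fix z :: complex assume z: "z \<in> circle"
    show "continuous (at z within circle) (\<phi> k)"
    proof (cases "z = -1")
      case True
      have "((\<lambda>t. \<kappa> k (Re t)) \<longlongrightarrow> \<kappa> k (Re z)) (at z within circle)"
        unfolding \<kappa>_def by (intro tendsto_intros)
      then have "((\<lambda>t. \<kappa> k (Re t)) \<longlongrightarrow> 0) (at z within circle)"
        using True by (simp add: \<kappa>_def)
      then have "(\<phi> k \<longlongrightarrow> 0) (at z within circle)"
        by (rule Lim_null_comparison[rotated]) (intro always_eventually allI \<kappa>_norm)
      moreover have "\<phi> k z = 0" using True by (simp add: \<phi>_def \<kappa>_def)
      ultimately show ?thesis by (simp add: continuous_within)
    next
      case False
      then have nz: "z \<notin> \<real>\<^sub>\<le>\<^sub>0"
        using z by (auto simp: complex_nonpos_Reals_iff complex_eq_iff cmod_def real_sqrt_eq_1_iff power2_eq_1_iff)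
      have "isCont (g k) (Arg z)" using g by (simp add: continuous_on_eq_continuous_at)
      then have "isCont (\<lambda>t. g k (Arg t)) z"
        by (rule isCont_o2[OF continuous_at_Arg[OF nz]])
      then have "isCont (\<lambda>t. cl (g k (Arg t))) z"
        by (rule isCont_o2[OF _ cont_cl])
      moreover have "isCont Re z" by (intro linear_continuous_at bounded_linear_Re)
      ultimately have "isCont (\<phi> k) z"
        unfolding \<phi>_def \<kappa>_def by (intro continuous_intros)
      then show ?thesis by (rule continuous_at_imp_continuous_at_within)
    qed
  qed
  have "\<exists>u. trig u \<and> (\<forall>t\<in>circle. norm (\<phi> k t - u t) < inverse (Suc k))" for k
    using trig_uniform_approx[OF cont[of k], of "inverse (Suc k)"] by (metis inverse_positive_iff_positive of_nat_0_less_iff zero_less_Suc)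
  then obtain u where u: "\<And>k. trig (u k)" "\<And>k t. t \<in> circle \<Longrightarrow> norm (\<phi> k t - u k t) < inverse (Suc k)"
    by metis
  have AE_R: "AE x in lborel. x \<in> {- pi<..pi} \<longrightarrow> (\<lambda>k. u k (cis x)) \<longlonglongrightarrow> \<psi> (cis x)"
  proof -
    obtain N' where N': "N' \<in> null_sets lborel" "N \<subseteq> N'"
      using N by (auto simp: negligible_iff_null_sets null_sets_completion_iff2)
    have "AE x in lborel. x \<notin> N"
      using AE_not_in[OF N'(1)] by eventually_elim (use N'(2) in blast)
    then show ?thesis
      using AE_lborel_singleton[of pi]
    proof eventually_elim
      case (elim x)
      show ?case
      proof
        assume x: "x \<in> {- pi<..pi}"
        then have x': "- pi < x" "x < pi" using elim(2) by auto
        have Arg: "Arg (cis x) = x" using x by (intro Arg_cis) auto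
        have "cos \<bar>x\<bar> > cos pi" using x' by (intro cos_monotone_0_pi) auto
        then have pos: "1 + cos x > 0" by simp
        have "\<forall>\<^sub>F k in sequentially. \<kappa> k (cos x) = 1"
        proof (rule eventually_sequentiallyI)
          fix k assume k: "k \<ge> nat \<lceil>1 / (1 + cos x)\<rceil>"
          then have "1 / (1 + cos x) \<le> real k" by linarith
          then have "1 \<le> real k * (1 + cos x)" using pos by (simp add: divide_le_eq)
          then show "\<kappa> k (cos x) = 1" by (simp add: \<kappa>_def)
        qed
        then have c1: "(\<lambda>k. \<kappa> k (cos x)) \<longlonglongrightarrow> 1" by (rule tendsto_eventually)
        have "(\<lambda>k. cl (g k x)) \<longlonglongrightarrow> cl (h x)"
          by (rule isCont_tendsto_compose[OF cont_cl lim[OF elim(1)]])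
        then have "(\<lambda>k. cl (g k x)) \<longlonglongrightarrow> h x" using bd by (simp add: cl_id h_def)
        with c1 have "(\<lambda>k. of_real (\<kappa> k (cos x)) * cl (g k x)) \<longlonglongrightarrow> of_real 1 * h x"
          by (intro tendsto_intros)
        then have \<phi>: "(\<lambda>k. \<phi> k (cis x)) \<longlonglongrightarrow> h x" by (simp add: \<phi>_def Arg)
        have "(\<lambda>k. \<phi> k (cis x) - u k (cis x)) \<longlonglongrightarrow> 0"
          by (rule Lim_null_comparison[OF _ LIMSEQ_inverse_real_of_nat])
             (use u(2)[of "cis x"] in \<open>auto intro!: always_eventually less_imp_le\<close>)
        from tendsto_diff[OF \<phi> this] show "(\<lambda>k. u k (cis x)) \<longlonglongrightarrow> \<psi> (cis x)"
          by (simp add: h_def)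
      qed
    qed
  qed
  have "AE t in \<mu>. (\<lambda>k. u k t) \<longlonglongrightarrow> \<psi> t"
  proof -
    have uR: "u k \<in> borel_measurable (restrict_space borel circle)" for k
      using trig_measurable[OF u(1)[of k]] by (simp cong: measurable_cong_sets[OF sets_circle_measure refl])
    have "{t \<in> space (restrict_space borel circle). (\<lambda>k. u k t) \<longlonglongrightarrow> \<psi> t} \<in> sets (restrict_space borel circle)"
      using measurable_Collect_LIMSEQ[OF uR \<psi>R] by (simp add: pred_def)
    from AE_distr_iff[OF measurable_cis_circle this]
    show ?thesis
      using AE_R unfolding circle_measure_def by (simp add: AE_uniform_measureI)
  qed
  \<comment> \<open>The 2 is the bound 1 for \<open>\<phi> k\<close> plus the error
    \<open>inverse (Suc k)\<close>, which is at most 1.\<close>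
  moreover have "norm (u k t) \<le> 2" if "t \<in> circle" for k t
  proof -
    have "norm (u k t) \<le> norm (\<phi> k t) + norm (\<phi> k t - u k t)"
      by (metis norm_minus_commute norm_triangle_sub)
    also have "\<dots> \<le> 1 + 1"
    proof (rule add_mono)
      show "norm (\<phi> k t) \<le> 1" using \<kappa>_norm \<kappa>1(2) by (rule order_trans)
      have "inverse (real (Suc k)) \<le> 1" by (simp add: field_simps)
      then show "norm (\<phi> k t - u k t) \<le> 1" using u(2)[OF that, of k] by linarith
    qed
    finally show ?thesis by simp
  qed
  ultimately show ?thesis using u(1) by (intro exI[of _ u]) simp
qed

lemma borel_measurable_cnj [measurable (raw)]:
  "f \<in> borel_measurable M \<Longrightarrow> (\<lambda>x. cnj (f x)) \<in> borel_measurable M"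
  by (rule borel_measurable_continuous_on) (intro continuous_intros)

lemma integrable_mult_bounded:
  fixes f g :: "complex \<Rightarrow> complex"
  assumes "integrable \<mu> f" "g \<in> borel_measurable \<mu>" "\<And>t. t \<in> circle \<Longrightarrow> norm (g t) \<le> C"
  shows "integrable \<mu> (\<lambda>t. f t * g t)"
proof (rule Bochner_Integration.integrable_bound)
  show "integrable \<mu> (\<lambda>t. C * norm (f t))" using assms(1) by simp
  show "AE t in \<mu>. norm (f t * g t) \<le> norm (C * norm (f t))"
  proof (rule AE_circle)
    fix t :: complex assume "t \<in> circle"
    then have "norm (f t) * norm (g t) \<le> norm (f t) * \<bar>C\<bar>"
      by (intro mult_left_mono order_trans[OF assms(3) abs_ge_self]) auto
    then show "norm (f t * g t) \<le> norm (C * norm (f t))"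
      by (simp add: norm_mult abs_mult mult.commute)
  qed
qed (use assms borel_measurable_integrable in auto)

text \<open>Truncation at height \<open>Suc n\<close> makes the function bounded, and division by
  that height brings it into the unit disc, where bounded pointwise approximation applies. The
  exponent 1 is included for the sake of \<open>1 / (t - z)\<close>.\<close>

lemma Lp_trig_approx:
  assumes p: "1 \<le> p" and f: "f \<in> Lp p" and e: "0 < e"
  obtains u where "trig u" "Lp_norm p (\<lambda>t. f t - u t) < e"
proof -
  have p0: "0 < p" using p by simp
  note [measurable] = LpD(1)[OF f]
  define g where "g = (\<lambda>n t. if norm (f t) \<le> real (Suc n) then f t else 0)"
  have [measurable]: "g n \<in> borel_measurable \<mu>" for n unfolding g_def by measurable
  have g_bd: "norm (g n t) \<le> real (Suc n)" for n t by (auto simp: g_def)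
  have "(\<lambda>n. Lp_norm p (\<lambda>t. f t - g n t)) \<longlonglongrightarrow> 0"
  proof (rule Lp_dominated_convergence[OF p0 f])
    show "AE t in \<mu>. norm (f t - g n t) \<le> 1 * norm (f t)" for n by (auto simp: g_def)
    show "AE t in \<mu>. (\<lambda>n. f t - g n t) \<longlonglongrightarrow> 0"
    proof (rule AE_I2)
      fix t
      have "\<forall>\<^sub>F n in sequentially. f t - g n t = 0"
      proof (rule eventually_sequentiallyI)
        fix n assume "nat \<lceil>norm (f t)\<rceil> \<le> n"
        then have "norm (f t) \<le> real (Suc n)" by linarith
        then show "f t - g n t = 0" by (simp add: g_def)
      qed
      then show "(\<lambda>n. f t - g n t) \<longlonglongrightarrow> 0" by (rule tendsto_eventually)
    qed
  qed simp
  then have "\<forall>\<^sub>F n in sequentially. Lp_norm p (\<lambda>t. f t - g n t) < e / 2"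
    by (rule order_tendstoD(2)) (use e in simp)
  then obtain n where n: "Lp_norm p (\<lambda>t. f t - g n t) < e / 2"
    by (auto simp: eventually_sequentially)
  define \<psi> where "\<psi> = (\<lambda>t. g n t / real (Suc n))"
  have \<psi> [measurable]: "\<psi> \<in> borel_measurable \<mu>" unfolding \<psi>_def by measurable
  have \<psi>1: "norm (\<psi> t) \<le> 1" for t
    using g_bd[of n t] by (simp add: \<psi>_def norm_divide divide_le_eq del: of_nat_Suc)
  obtain u where u: "\<And>k. trig (u k)" "\<And>k t. t \<in> circle \<Longrightarrow> norm (u k t) \<le> 2"
    "AE t in \<mu>. (\<lambda>k. u k t) \<longlonglongrightarrow> \<psi> t"
    using trig_AE_approx[OF \<psi> \<psi>1] by blast
  note [measurable] = trig_measurable[OF u(1)]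
  have "(\<lambda>k. Lp_norm p (\<lambda>t. \<psi> t - u k t)) \<longlonglongrightarrow> 0"
  proof (rule Lp_dominated_convergence[OF p0 const_in_Lp[of 1]])
    show "AE t in \<mu>. norm (\<psi> t - u k t) \<le> 3 * norm (1 :: complex)" for k
    proof (rule AE_circle)
      fix t :: complex assume "t \<in> circle"
      then show "norm (\<psi> t - u k t) \<le> 3 * norm (1 :: complex)"
        using norm_triangle_ineq4[of "\<psi> t" "u k t"] \<psi>1[of t] u(2)[of t k] by simp
    qed
    show "AE t in \<mu>. (\<lambda>k. \<psi> t - u k t) \<longlonglongrightarrow> 0"
      using u(3) by eventually_elim (auto intro!: tendsto_eq_intros)
  qed simp
  then have "\<forall>\<^sub>F k in sequentially. Lp_norm p (\<lambda>t. \<psi> t - u k t) < e / (2 * real (Suc n))"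
    by (rule order_tendstoD(2)) (use e in simp)
  then obtain k where k: "Lp_norm p (\<lambda>t. \<psi> t - u k t) < e / (2 * real (Suc n))"
    by (auto simp: eventually_sequentially)
  define v where "v = (\<lambda>t. of_real (real (Suc n)) * u k t)"
  have v: "trig v" unfolding v_def by (intro trig_mult trig_const u)
  have g: "g n \<in> Lp p" using bounded_in_Lp(1)[OF p0, of "g n" "real (Suc n)"] g_bd by simp
  have eq: "(\<lambda>t. g n t - v t) = (\<lambda>t. of_real (real (Suc n)) * (\<psi> t - u k t))"
    by (simp add: v_def \<psi>_def right_diff_distrib del: of_nat_Suc)
  have "Lp_norm p (\<lambda>t. g n t - v t) = real (Suc n) * Lp_norm p (\<lambda>t. \<psi> t - u k t)"
    unfolding eq by (simp only: Lp_norm_scale[OF p0] norm_of_real abs_of_nat)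
  also have "\<dots> < e / 2" using k by (simp add: field_simps)
  finally have "Lp_norm p (\<lambda>t. f t - v t) < e"
    using Lp_norm_triangle_diff[OF p f g trig_in_Lp[OF p0 v]] n by linarith
  then show ?thesis using v that by blast
qed

section \<open>Fourier coefficients\<close>

lemma norm_powi_circle: "t \<in> circle \<Longrightarrow> norm (t powi k) = 1"
  by (simp add: norm_power_int)

lemma integrable_powi: "integrable \<mu> f \<Longrightarrow> integrable \<mu> (\<lambda>t. f t * t powi k)"
  by (rule integrable_mult_bounded[where C = 1]) (auto simp: norm_power_int)

lemma fourier_coeff_add:
  "integrable \<mu> f \<Longrightarrow> integrable \<mu> g \<Longrightarrow>
    fourier_coeff (\<lambda>t. f t + g t) n = fourier_coeff f n + fourier_coeff g n"
  by (simp add: fourier_coeff_def distrib_right integrable_powi)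

lemma fourier_coeff_diff:
  "integrable \<mu> f \<Longrightarrow> integrable \<mu> g \<Longrightarrow>
    fourier_coeff (\<lambda>t. f t - g t) n = fourier_coeff f n - fourier_coeff g n"
  by (simp add: fourier_coeff_def left_diff_distrib integrable_powi)

lemma fourier_coeff_scale: "fourier_coeff (\<lambda>t. c * f t) n = c * fourier_coeff f n"
  by (simp add: fourier_coeff_def mult.assoc)

lemma fourier_coeff_zero [simp]: "fourier_coeff (\<lambda>t. 0) n = 0"
  by (simp add: fourier_coeff_def)

lemma fourier_coeff_sum:
  "(\<And>i. i \<in> I \<Longrightarrow> integrable \<mu> (f i)) \<Longrightarrow>
    fourier_coeff (\<lambda>t. \<Sum>i\<in>I. f i t) n = (\<Sum>i\<in>I. fourier_coeff (f i) n)"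
  by (simp add: fourier_coeff_def sum_distrib_right integrable_powi)

lemma fourier_coeff_cong_AE:
  assumes "f \<in> borel_measurable \<mu>" "g \<in> borel_measurable \<mu>" "AE t in \<mu>. f t = g t"
  shows "fourier_coeff f n = fourier_coeff g n"
  unfolding fourier_coeff_def using assms by (intro integral_cong_AE) auto

lemma fourier_coeff_cong_circle:
  "(\<And>t. t \<in> circle \<Longrightarrow> f t = g t) \<Longrightarrow> fourier_coeff f n = fourier_coeff g n"
  unfolding fourier_coeff_def by (intro Bochner_Integration.integral_cong) auto

lemma fourier_coeff_powi_mult: "fourier_coeff (\<lambda>t. t powi k * f t) n = fourier_coeff f (n - k)"
  unfolding fourier_coeff_def
proof (intro Bochner_Integration.integral_cong refl)
  fix t assume "t \<in> space \<mu>"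
  then have "t powi (- (n - k)) = t powi k * t powi (- n)"
    by (simp add: circle_nonzero flip: power_int_add)
  then show "t powi k * f t * t powi - n = f t * t powi - (n - k)" by simp
qed

lemma fourier_coeff_reflect:
  assumes [measurable]: "f \<in> borel_measurable \<mu>"
  shows "fourier_coeff (reflect f) n = fourier_coeff f (- n)"
proof -
  have "reflect f t * t powi (- n) = reflect (\<lambda>t. f t * t powi n) t" for t
    by (simp add: reflect_def power_int_minus power_int_divide_distrib inverse_eq_divide)
  then show ?thesis
    using integral_reflect[of "\<lambda>t. f t * t powi n"] by (simp add: fourier_coeff_def)
qed

lemma norm_fourier_coeff_le:
  assumes "integrable \<mu> f"
  shows "norm (fourier_coeff f n) \<le> (LINT t|\<mu>. norm (f t))"
proof -
  have "norm (fourier_coeff f n) \<le> (LINT t|\<mu>. norm (f t * t powi (- n)))"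
    unfolding fourier_coeff_def by (rule integral_norm_bound)
  also have "\<dots> = (LINT t|\<mu>. norm (f t))"
    by (intro Bochner_Integration.integral_cong refl) (simp add: norm_mult norm_power_int)
  finally show ?thesis .
qed

lemma norm_fourier_coeff_le_Lp: "1 \<le> p \<Longrightarrow> f \<in> Lp p \<Longrightarrow> norm (fourier_coeff f n) \<le> Lp_norm p f"
  using norm_fourier_coeff_le[of f n] Lp_integrable[of p f] by linarith

lemma fourier_coeff_Lp_tendsto:
  assumes "1 \<le> p" "f \<in> Lp p" "\<And>k. g k \<in> Lp p" "(\<lambda>k. Lp_norm p (\<lambda>t. g k t - f t)) \<longlonglongrightarrow> 0"
  shows "(\<lambda>k. fourier_coeff (g k) n) \<longlonglongrightarrow> fourier_coeff f n"
proof -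
  have "(\<lambda>k. fourier_coeff (g k) n - fourier_coeff f n) \<longlonglongrightarrow> 0"
  proof (rule Lim_null_comparison[OF always_eventually assms(4)], rule allI)
    fix k
    show "norm (fourier_coeff (g k) n - fourier_coeff f n) \<le> Lp_norm p (\<lambda>t. g k t - f t)"
      using norm_fourier_coeff_le_Lp[OF assms(1) Lp_diff(1)[OF assms(1,3,2)], of k n]
        Lp_integrable(1)[OF assms(1)] assms(2,3) by (simp add: fourier_coeff_diff)
  qed
  then show ?thesis by (simp add: LIM_zero_iff)
qed

lemma fourier_coeff_powi: "fourier_coeff (\<lambda>t. t powi k) n = (if n = k then 1 else 0)"
  using fourier_coeff_powi_mult[of k "\<lambda>t. 1" n] integral_powi_circle[of "k - n"]
  by (simp add: fourier_coeff_def)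

lemma poly_integrable: "integrable \<mu> (poly a)"
  by (rule Lp_integrable(1)[OF order_refl poly_in_Lp]) simp

lemma poly_as_powi_sum: "poly a (t::complex) = (\<Sum>i\<le>degree a. coeff a i * t powi int i)"
  by (simp add: poly_altdef)

lemma integrable_powi_const: "integrable \<mu> (\<lambda>t. c * t powi k)"
  by (rule Lp_integrable(1)[OF order_refl trig_in_Lp[OF _ trig_monom]]) simp

lemma fourier_coeff_poly: "fourier_coeff (poly a) n = (if 0 \<le> n then coeff a (nat n) else 0)"
proof -
  have "fourier_coeff (poly a) n = (\<Sum>i\<le>degree a. coeff a i * fourier_coeff (\<lambda>t. t powi int i) n)"
    unfolding poly_as_powi_sum[abs_def]
    by (subst fourier_coeff_sum) (auto intro: integrable_powi_const simp: fourier_coeff_scale simp del: power_int_of_nat)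
  also have "\<dots> = (\<Sum>i\<le>degree a. if 0 \<le> n \<and> i = nat n then coeff a i else 0)"
    by (intro sum.cong) (auto simp: fourier_coeff_powi simp del: power_int_of_nat)
  also have "\<dots> = (if 0 \<le> n then coeff a (nat n) else 0)"
    by (auto simp: coeff_eq_0)
  finally show ?thesis .
qed

lemma fourier_coeff_coanalytic:
  assumes "0 \<le> n"
  shows "fourier_coeff (\<lambda>t. poly b (1 / t) / t) n = 0"
proof -
  have "fourier_coeff (\<lambda>t. poly b (1 / t) / t) n = fourier_coeff (\<lambda>t. t powi (-1) * reflect (poly b) t) n"
    by (simp add: reflect_def power_int_minus field_simps)
  also have "\<dots> = fourier_coeff (reflect (poly b)) (n - (-1))"
    by (rule fourier_coeff_powi_mult)
  also have "\<dots> = fourier_coeff (poly b) (- (n + 1))"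
    using fourier_coeff_reflect[of "poly b" "n + 1"] borel_measurable_integrable[OF poly_integrable] by simp
  also have "\<dots> = 0" using assms by (simp add: fourier_coeff_poly)
  finally show ?thesis .
qed

lemma fourier_coeff_laurent:
  assumes "0 \<le> n"
  shows "fourier_coeff (\<lambda>t. poly a t + poly b (1 / t) / t) n = coeff a (nat n)"
proof -
  have "integrable \<mu> (\<lambda>t. poly b (1 / t) / t)"
    using Lp_integrable(1)[OF order_refl trig_in_Lp[OF _ laurent_trig[of 0 b]]] by simp
  then show ?thesis
    using assms by (simp add: fourier_coeff_add poly_integrable fourier_coeff_poly fourier_coeff_coanalytic)
qed

text \<open>The integrals of \<open>f\<close> against trigonometric polynomials vanish; letting
  these tend boundedly to the phase \<open>cnj (f t) / norm (f t)\<close> gives the integral of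
  \<open>norm (f t)\<close>. As \<open>f\<close> is only assumed integrable, products of H^p and H^q
  functions are covered.\<close>

lemma fourier_coeff_unique_zero:
  assumes f: "integrable \<mu> f" and z: "\<And>n. fourier_coeff f n = 0"
  shows "AE t in \<mu>. f t = 0"
proof -
  note [measurable] = borel_measurable_integrable[OF f]
  have trig0: "(LINT t|\<mu>. f t * u t) = 0" if "trig u" for u
    using that
  proof (induction rule: trig.induct)
    case (trig_monom c k)
    then show ?case
      using z[of "- k"] integral_mult_right_zero[of \<mu> c "\<lambda>t. f t * t powi k"]
      by (simp add: fourier_coeff_def mult_ac)
  next
    case (trig_add g h)
    have "integrable \<mu> (\<lambda>t. f t * u t)" if u: "trig u" for u
      using continuous_on_circle_bounded[OF trig_continuous[OF u]] integrable_mult_bounded[OF f trig_measurable[OF u]]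
      by metis
    then show ?case using trig_add by (simp add: distrib_left)
  next
    case (trig_cong g h)
    have "(LINT t|\<mu>. f t * h t) = (LINT t|\<mu>. f t * g t)"
      using trig_cong(2) by (intro Bochner_Integration.integral_cong) auto
    then show ?case using trig_cong by simp
  qed
  define \<psi> where "\<psi> = (\<lambda>t. cnj (f t) / of_real (norm (f t)))"
  have \<psi> [measurable]: "\<psi> \<in> borel_measurable \<mu>" unfolding \<psi>_def by measurable
  have \<psi>1: "norm (\<psi> t) \<le> 1" for t by (simp add: \<psi>_def norm_divide)
  obtain u where u: "\<And>k. trig (u k)" "\<And>k t. t \<in> circle \<Longrightarrow> norm (u k t) \<le> 2"
    "AE t in \<mu>. (\<lambda>k. u k t) \<longlonglongrightarrow> \<psi> t"
    using trig_AE_approx[OF \<psi> \<psi>1] by blast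
  note [measurable] = trig_measurable[OF u(1)]
  have "(\<lambda>k. LINT t|\<mu>. f t * u k t) \<longlonglongrightarrow> (LINT t|\<mu>. f t * \<psi> t)"
  proof (rule integral_dominated_convergence)
    show "integrable \<mu> (\<lambda>t. 2 * norm (f t))" using f by simp
    show "AE t in \<mu>. (\<lambda>k. f t * u k t) \<longlonglongrightarrow> f t * \<psi> t"
      using u(3) by eventually_elim (intro tendsto_intros)
    show "AE t in \<mu>. norm (f t * u k t) \<le> 2 * norm (f t)" for k
    proof (rule AE_circle)
      fix t :: complex assume "t \<in> circle"
      from mult_left_mono[OF u(2)[OF this] norm_ge_zero[of "f t"]]
      show "norm (f t * u k t) \<le> 2 * norm (f t)" by (simp add: norm_mult mult.commute)
    qed
  qed measurable
  then have "(LINT t|\<mu>. f t * \<psi> t) = 0"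
    by (simp only: trig0[OF u(1)] LIMSEQ_const_iff)
  moreover have "f t * \<psi> t = of_real (norm (f t))" for t
    by (cases "f t = 0") (auto simp: \<psi>_def complex_norm_square[symmetric] power2_eq_square)
  ultimately have "(LINT t|\<mu>. norm (f t)) = 0"
    by (simp add: complex_of_real_integrable_eq)
  then have "AE t in \<mu>. norm (f t) = 0"
    using f by (subst (asm) integral_nonneg_eq_0_iff_AE) auto
  then show ?thesis by simp
qed

lemma fourier_coeff_unique:
  assumes "integrable \<mu> f" "integrable \<mu> g" "\<And>n. fourier_coeff f n = fourier_coeff g n"
  shows "AE t in \<mu>. f t = g t"
  using fourier_coeff_unique_zero[of "\<lambda>t. f t - g t"] assms by (simp add: fourier_coeff_diff)

section \<open>M. Riesz's theorem\<close>

lemma cos_multiple_bound: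
  fixes p :: real
  assumes "1 < p" "p \<le> 2"
  shows "\<exists>A B. 0 \<le> A \<and> 0 < B \<and> (\<forall>x. \<bar>x\<bar> < pi / 2 \<longrightarrow> cos (p * x) \<le> A * cos x powr p - B)"
proof -
  \<comment> \<open>The midpoint of \<open>pi / (2 * p)\<close> and \<open>pi / 2\<close>: the angle
    \<open>p * x0\<close> then lies strictly between \<open>pi / 2\<close> and \<open>pi\<close>,
    where the cosine is negative.\<close>
  define x0 where "x0 = (pi / (2 * p) + pi / 2) / 2"
  have px0: "p * x0 = pi / 4 + p * (pi / 4)" using assms by (simp add: x0_def field_simps)
  have "pi / (2 * p) < pi / 2" using assms by (simp add: field_simps)
  moreover have "0 < pi / (2 * p)" using assms by simp
  ultimately have x0: "0 < x0" "x0 < pi / 2" by (auto simp: x0_def)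
  have px0_le: "pi / 2 < p * x0" "p * x0 < pi"
    using assms mult_strict_right_mono[of 1 p "pi / 4"] mult_right_mono[of p 2 "pi / 4"] pi_gt_zero
    unfolding px0 by linarith+
  define B where "B = - cos (p * x0)"
  \<comment> \<open>For \<open>\<bar>x\<bar> < x0\<close> the power of \<open>cos x\<close> is at
    least that of \<open>cos x0\<close>, so this \<open>A\<close> makes the right side at least
    1.\<close>
  define A where "A = (1 + B) / cos x0 powr p"
  have "cos (p * x0) < cos (pi / 2)"
    using px0_le by (intro cos_monotone_0_pi) auto
  then have B: "0 < B" by (simp add: B_def)
  have c0: "0 < cos x0" using x0 by (intro cos_gt_zero) auto
  have A: "0 \<le> A" using B by (simp add: A_def)
  have "cos (p * x) \<le> A * cos x powr p - B" if x: "\<bar>x\<bar> < pi / 2" for x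
  proof (cases "\<bar>x\<bar> \<ge> x0")
    case True
    \<comment> \<open>Here \<open>p \<le> 2\<close> enters: \<open>p * \<bar>x\<bar>\<close> stays
      below \<open>pi\<close>, where the cosine is decreasing.\<close>
    have "p * \<bar>x\<bar> \<le> 2 * (pi / 2)" using assms x by (intro mult_mono) auto
    then have "cos (p * \<bar>x\<bar>) \<le> cos (p * x0)"
      using True x0 assms by (intro cos_monotone_0_pi_le) auto
    moreover have "cos (p * \<bar>x\<bar>) = cos (p * x)"
      using assms cos_abs_real[of "p * x"] by (simp add: abs_mult)
    moreover have "0 \<le> A * cos x powr p" using A by simp
    ultimately show ?thesis by (simp add: B_def)
  next
    case False
    have "cos x0 \<le> cos \<bar>x\<bar>" using False x0 by (intro cos_monotone_0_pi_le) auto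
    then have "cos x0 powr p \<le> cos x powr p" using c0 assms by (intro powr_mono2) auto
    then have "A * cos x0 powr p \<le> A * cos x powr p" using A by (rule mult_left_mono)
    moreover have "A * cos x0 powr p = 1 + B" using c0 by (simp add: A_def)
    ultimately show ?thesis using cos_le_one[of "p * x"] by linarith
  qed
  then show ?thesis using A B by blast
qed

text \<open>Polar form. \<open>exp (of_real p * Ln z)\<close> is the branch of z^p in the right half
  plane; the negative term on the right is what will bound the norm of an analytic function by that
  of its real part.\<close>

lemma Re_powr_bound:
  fixes p :: real
  assumes "1 < p" "p \<le> 2"
  shows "\<exists>A B. 0 \<le> A \<and> 0 < B \<and>
    (\<forall>z. 0 < Re z \<longrightarrow> Re (exp (of_real p * Ln z)) \<le> A * Re z powr p - B * norm z powr p)"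
proof -
  obtain A B where AB: "0 \<le> A" "0 < B" "\<And>x. \<bar>x\<bar> < pi / 2 \<Longrightarrow> cos (p * x) \<le> A * cos x powr p - B"
    using cos_multiple_bound[OF assms] by blast
  have "Re (exp (of_real p * Ln z)) \<le> A * Re z powr p - B * norm z powr p" if z: "0 < Re z" for z
  proof -
    have nz: "z \<noteq> 0" using z by auto
    define r x where "r = norm z" and "x = Im (Ln z)"
    have r: "0 < r" using nz by (simp add: r_def)
    have x: "\<bar>x\<bar> < pi / 2" using Re_Ln_pos_lt[OF nz] z by (simp add: x_def)
    have c: "0 < cos x" using x by (intro cos_gt_zero_pi) auto
    have "Re z = Re (exp (Ln z))" using nz by simp
    also have "\<dots> = r * cos x" using nz by (simp only: Re_exp) (simp add: r_def x_def)
    finally have Rez: "Re z = r * cos x" .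
    have "Re (exp (of_real p * Ln z)) = exp (p * ln r) * cos (p * x)"
      using nz by (simp add: Re_exp r_def x_def)
    also have "\<dots> \<le> exp (p * ln r) * (A * cos x powr p - B)"
      using AB(3)[OF x] by (intro mult_left_mono) auto
    also have "exp (p * ln r) = r powr p" using r by (simp add: powr_def)
    also have "r powr p * (A * cos x powr p - B) = A * Re z powr p - B * norm z powr p"
      using r c by (simp add: Rez powr_mult right_diff_distrib r_def[symmetric])
    finally show ?thesis .
  qed
  then show ?thesis using AB(1,2) by blast
qed

text \<open>Minimum principle for the real part, from the maximum modulus principle for
  \<open>exp (- poly F z)\<close>.\<close>

lemma Re_poly_pos_disc:
  assumes "\<And>t. t \<in> circle \<Longrightarrow> 0 < Re (poly F t)" and z: "z \<in> cball 0 1"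
  shows "0 < Re (poly F z)"
proof -
  have "\<exists>w\<in>circle. \<forall>t\<in>circle. Re (poly F w) \<le> Re (poly F t)"
    by (rule continuous_attains_inf) (auto intro!: continuous_intros)
  then obtain w where w: "w \<in> circle" "\<And>t. t \<in> circle \<Longrightarrow> Re (poly F w) \<le> Re (poly F t)" by blast
  have "norm (exp (- poly F z)) \<le> exp (- Re (poly F w))"
  proof (rule maximum_modulus_frontier[of "\<lambda>z. exp (- poly F z)" "cball 0 1"])
    fix t :: complex assume "t \<in> frontier (cball 0 1)"
    then have "t \<in> circle" by simp
    then show "norm (exp (- poly F t)) \<le> exp (- Re (poly F w))"
      using w(2)[of t] by (simp add: norm_exp_eq_Re)
  qed (use z in \<open>auto intro!: holomorphic_intros continuous_intros\<close>)
  then have "Re (poly F w) \<le> Re (poly F z)" by (simp add: norm_exp_eq_Re)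
  then show ?thesis using assms(1)[OF w(1)] by simp
qed

text \<open>Integrate the pointwise bound for z^p at \<open>z = poly F t\<close>. The mean of the
  holomorphic power is its value at 0, a positive real number because \<open>poly F 0\<close> is
  one, so the integral of the bound cannot be negative.\<close>

lemma Lp_norm_analytic_le_Re_pos:
  fixes p :: real
  assumes p: "1 < p" "p \<le> 2"
  shows "\<exists>C\<ge>0. \<forall>F. (\<forall>t\<in>circle. 0 < Re (poly F t)) \<longrightarrow> Im (coeff F 0) = 0 \<longrightarrow>
    Lp_norm p (poly F) \<le> C * Lp_norm p (\<lambda>t. of_real (Re (poly F t)))"
proof -
  obtain A B where AB: "0 \<le> A" "0 < B"
    "\<And>z. 0 < Re z \<Longrightarrow> Re (exp (of_real p * Ln z)) \<le> A * Re z powr p - B * norm z powr p"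
    using Re_powr_bound[OF p] by blast
  have "Lp_norm p (poly F) \<le> (A / B) powr (1 / p) * Lp_norm p (\<lambda>t. of_real (Re (poly F t)))"
    if pos: "\<forall>t\<in>circle. 0 < Re (poly F t)" and im: "Im (coeff F 0) = 0" for F
  proof -
    define S where "S = {z. 0 < Re (poly F z)}"
    define G where "G = (\<lambda>z. exp (of_real p * Ln (poly F z)))"
    have S: "open S" unfolding S_def
      by (rule open_Collect_less) (auto intro!: continuous_intros)
    have disc: "cball 0 1 \<subseteq> S" using Re_poly_pos_disc[of F] pos by (auto simp: S_def)
    have hol: "G holomorphic_on S" unfolding G_def
      by (intro holomorphic_intros) (auto simp: S_def complex_nonpos_Reals_iff)
    have contG: "continuous_on circle G"
      using disc by (intro continuous_on_subset[OF holomorphic_on_imp_continuous_on[OF hol]]) auto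
    have "(LINT t|\<mu>. G t) = G 0" by (rule mean_value_property[OF S disc hol])
    moreover have "0 \<le> Re (G 0)"
    proof -
      have "0 < Re (poly F 0)" using subsetD[OF disc, of 0] by (simp add: S_def)
      then have "Im (Ln (poly F 0)) = 0"
        using im Im_Ln_eq_0[of "poly F 0"] by (cases "poly F 0 = 0") (auto simp: poly_0_coeff_0)
      then show ?thesis by (simp add: G_def Re_exp)
    qed
    ultimately have "0 \<le> Re (LINT t|\<mu>. G t)" by simp
    also have intG: "integrable \<mu> G"
      by (rule Lp_integrable(1)[OF order_refl continuous_on_circle_in_Lp[OF _ contG]]) simp
    then have "Re (LINT t|\<mu>. G t) = (LINT t|\<mu>. Re (G t))" by (rule integral_Re[symmetric])
    also have "\<dots> \<le> (LINT t|\<mu>. A * Re (poly F t) powr p - B * norm (poly F t) powr p)"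
    proof (rule integral_mono)
      show "integrable \<mu> (\<lambda>t. Re (G t))" using intG by simp
      have "(\<lambda>t. of_real (Re (poly F t))) \<in> Lp p"
        using p by (intro trig_in_Lp trig_Re poly_trig) auto
      then have "integrable \<mu> (\<lambda>t. \<bar>Re (poly F t)\<bar> powr p)" by (auto simp: Lp_def)
      moreover have "integrable \<mu> (\<lambda>t. \<bar>Re (poly F t)\<bar> powr p) \<longleftrightarrow> integrable \<mu> (\<lambda>t. Re (poly F t) powr p)"
        using pos by (intro Bochner_Integration.integrable_cong) (auto simp: less_imp_le)
      ultimately have 1: "integrable \<mu> (\<lambda>t. Re (poly F t) powr p)" by simp
      have "integrable \<mu> (\<lambda>t. norm (poly F t) powr p)"
        using LpD(2)[OF poly_in_Lp[of p F]] p by simp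
      with 1 show "integrable \<mu> (\<lambda>t. A * Re (poly F t) powr p - B * norm (poly F t) powr p)"
        by simp
      show "Re (G t) \<le> A * Re (poly F t) powr p - B * norm (poly F t) powr p" if "t \<in> space \<mu>" for t
        using AB(3)[of "poly F t"] pos that by (simp add: G_def)
    qed
    also have "\<dots> = A * (LINT t|\<mu>. norm (complex_of_real (Re (poly F t))) powr p) - B * (LINT t|\<mu>. norm (poly F t) powr p)"
    proof -
      have "(\<lambda>t. of_real (Re (poly F t))) \<in> Lp p"
        using p by (intro trig_in_Lp trig_Re poly_trig) auto
      then have 1: "integrable \<mu> (\<lambda>t. norm (complex_of_real (Re (poly F t))) powr p)" by (rule LpD(2))
      have 2: "integrable \<mu> (\<lambda>t. norm (poly F t) powr p)"
        using LpD(2)[OF poly_in_Lp[of p F]] p by simp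
      have "(LINT t|\<mu>. A * Re (poly F t) powr p - B * norm (poly F t) powr p)
          = (LINT t|\<mu>. A * norm (complex_of_real (Re (poly F t))) powr p - B * norm (poly F t) powr p)"
        using pos by (intro Bochner_Integration.integral_cong) (auto simp: less_imp_le)
      then show ?thesis using 1 2 by simp
    qed
    also have "\<dots> = A * Lp_norm p (\<lambda>t. of_real (Re (poly F t))) powr p - B * Lp_norm p (poly F) powr p"
      using p by (simp add: Lp_norm_powr)
    finally have le: "Lp_norm p (poly F) powr p \<le> A / B * Lp_norm p (\<lambda>t. of_real (Re (poly F t))) powr p"
      using AB(2) by (simp add: field_simps)
    have "Lp_norm p (poly F) = (Lp_norm p (poly F) powr p) powr (1 / p)"
      using p by (simp add: powr_powr)
    also have "\<dots> \<le> (A / B * Lp_norm p (\<lambda>t. of_real (Re (poly F t))) powr p) powr (1 / p)"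
      using le p by (intro powr_mono2) auto
    also have "\<dots> = (A / B) powr (1 / p) * Lp_norm p (\<lambda>t. of_real (Re (poly F t)))"
      using AB p by (subst powr_mult) (auto simp: powr_powr)
    finally show ?thesis .
  qed
  then show ?thesis by (intro exI[of _ "(A / B) powr (1 / p)"]) auto
qed

lemma real_trig_eq_Re_poly:
  assumes "trig w"
  shows "\<exists>F. Im (coeff F 0) = 0 \<and> (\<forall>t\<in>circle. Re (poly F t) = Re (w t))"
proof -
  obtain a b where ab: "\<And>t. t \<in> circle \<Longrightarrow> w t = poly a t + poly b (1 / t) / t"
    using trig_laurent[OF assms] by metis
  \<comment> \<open>On the circle the conjugate of the coanalytic part is the polynomial
    \<open>t * poly (map_poly cnj b) t\<close>, and conjugation leaves the real part alone.\<close>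
  define F where "F = a + pCons 0 (map_poly cnj b)"
  have "Re (poly F t) = Re (w t)" if t: "t \<in> circle" for t
  proof -
    have "cnj (poly b (1 / t) / t) = t * poly (map_poly cnj b) t"
      by (simp only: complex_cnj_divide poly_cnj complex_cnj_one cnj_circle[OF t]) simp
    then have "Re (poly b (1 / t) / t) = Re (t * poly (map_poly cnj b) t)"
      by (metis cnj.simps(1))
    then show ?thesis using ab[OF t] by (simp add: F_def)
  qed
  then show ?thesis
    \<comment> \<open>An imaginary constant does not affect the real part and is spent on
      normalising the constant term.\<close>
    by (intro exI[of _ "F - [:\<i> * of_real (Im (coeff F 0)):]"]) auto
qed

lemma integrable_continuous_circle:
  fixes h :: "complex \<Rightarrow> real"
  assumes "continuous_on circle h"
  shows "integrable \<mu> h"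
proof -
  have "integrable \<mu> (\<lambda>t. complex_of_real (h t))"
    using assms by (intro Lp_integrable(1)[OF order_refl continuous_on_circle_in_Lp]) (auto intro!: continuous_intros)
  then show ?thesis by (rule complex_of_real_integrable_eq[THEN iffD1])
qed

text \<open>The real part of \<open>z^2\<close> is \<open>2 * (Re z)^2 - norm z ^ 2\<close>, and the
  mean of the square of \<open>poly F\<close> is the square of a real number, hence
  nonnegative.\<close>

lemma integral_norm_square_analytic_le:
  assumes "Im (coeff F 0) = 0"
  shows "(LINT t|\<mu>. (norm (poly F t))\<^sup>2) \<le> 2 * (LINT t|\<mu>. (Re (poly F t))\<^sup>2)"
proof -
  have "(LINT t|\<mu>. (poly F t)\<^sup>2) = (poly F 0)\<^sup>2"
    by (rule mean_value_property[of UNIV]) (auto intro!: holomorphic_intros)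
  then have "Re (LINT t|\<mu>. (poly F t)\<^sup>2) = (Re (coeff F 0))\<^sup>2"
    using assms by (simp add: poly_0_coeff_0)
  moreover have "Re (LINT t|\<mu>. (poly F t)\<^sup>2) = (LINT t|\<mu>. Re ((poly F t)\<^sup>2))"
    by (intro integral_Re[symmetric] Lp_integrable(1)[OF order_refl continuous_on_circle_in_Lp])
       (auto intro!: continuous_intros)
  moreover have "(LINT t|\<mu>. Re ((poly F t)\<^sup>2)) = (LINT t|\<mu>. 2 * (Re (poly F t))\<^sup>2 - (norm (poly F t))\<^sup>2)"
    by (intro Bochner_Integration.integral_cong refl) (simp add: cmod_power2 Re_power2)
  moreover have "\<dots> = 2 * (LINT t|\<mu>. (Re (poly F t))\<^sup>2) - (LINT t|\<mu>. (norm (poly F t))\<^sup>2)"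
    by (subst Bochner_Integration.integral_diff)
       (auto intro!: integrable_continuous_circle continuous_intros)
  ultimately show ?thesis by (smt (verit) zero_le_power2)
qed

text \<open>Compare \<open>norm (f t)\<close> with \<open>e\<close>: where it is larger, the
  exponent \<open>p - 2\<close> being at most 0, a power of \<open>norm (f t)\<close> may be
  replaced by one of \<open>e\<close>. The 8 is what the remainder in the next lemma produces, and 9
  is 1 + 8.\<close>

lemma Lp_norm_le_of_square:
  assumes p: "1 \<le> p" "p \<le> 2" and e: "0 < e" and f: "continuous_on circle f"
    and le: "(LINT t|\<mu>. (norm (f t))\<^sup>2) \<le> 8 * e\<^sup>2"
  shows "Lp_norm p f \<le> 9 * e"
proof -
  have *: "norm (f t) powr p \<le> e powr p + e powr (p - 2) * (norm (f t))\<^sup>2" for t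
  proof (cases "norm (f t) \<le> e")
    case True
    then have "norm (f t) powr p \<le> e powr p" using p by (intro powr_mono2) auto
    then show ?thesis by (simp add: add_increasing2)
  next
    case False
    then have pos: "0 < norm (f t)" using e by linarith
    have "norm (f t) powr p = norm (f t) powr (p - 2) * norm (f t) powr 2"
      using powr_add[of "norm (f t)" "p - 2" 2] by (simp del: powr_numeral)
    also have "\<dots> \<le> e powr (p - 2) * norm (f t) powr 2"
      using False e p by (intro mult_right_mono powr_mono2') auto
    finally show ?thesis using pos by (simp add: add_increasing)
  qed
  have i2: "integrable \<mu> (\<lambda>t. (norm (f t))\<^sup>2)"
    using f by (intro integrable_continuous_circle continuous_intros)
  have fp: "f \<in> Lp p" using p f by (intro continuous_on_circle_in_Lp) auto
  have "(LINT t|\<mu>. norm (f t) powr p) \<le> (LINT t|\<mu>. e powr p + e powr (p - 2) * (norm (f t))\<^sup>2)"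
    using i2 * by (intro integral_mono LpD(2)[OF fp]) auto
  also have "\<dots> = e powr p + e powr (p - 2) * (LINT t|\<mu>. (norm (f t))\<^sup>2)"
    using i2 by simp
  also have "\<dots> \<le> e powr p + e powr (p - 2) * (8 * e powr 2)"
    using le e by (intro add_left_mono mult_left_mono) auto
  also have "\<dots> = 9 * e powr p"
  proof -
    have "e powr (p - 2) * e powr 2 = e powr p"
      using powr_add[of e "p - 2" 2] by (simp del: powr_numeral)
    then show ?thesis by (simp add: mult.left_commute del: powr_numeral)
  qed
  also have "\<dots> \<le> 9 powr p * e powr p"
    using p powr_mono[of 1 p 9] by (intro mult_right_mono) auto
  also have "\<dots> = (9 * e) powr p" using e by (simp add: powr_mult)
  finally show ?thesis using p e by (subst Lp_norm_le_iff) auto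
qed

text \<open>Positivity is removed by splitting the real part into its positive and negative parts.
  Lifted by \<open>e\<close>, each is within \<open>e\<close> of the positive real part of a
  polynomial, \<open>G\<close> or \<open>H\<close>, to which the positive case applies; the
  remainder \<open>F - G + H\<close> has a real part of modulus at most \<open>2 * e\<close> and is
  estimated in mean square.\<close>

lemma Lp_norm_analytic_le_Re:
  fixes p :: real
  assumes p: "1 < p" "p \<le> 2"
  shows "\<exists>C\<ge>0. \<forall>F. Im (coeff F 0) = 0 \<longrightarrow>
    Lp_norm p (poly F) \<le> C * Lp_norm p (\<lambda>t. of_real (Re (poly F t)))"
proof -
  obtain C where C: "0 \<le> C" "\<And>F. (\<And>t. t \<in> circle \<Longrightarrow> 0 < Re (poly F t)) \<Longrightarrow> Im (coeff F 0) = 0 \<Longrightarrow>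
    Lp_norm p (poly F) \<le> C * Lp_norm p (\<lambda>t. of_real (Re (poly F t)))"
    using Lp_norm_analytic_le_Re_pos[OF p] by blast
  have p1: "1 \<le> p" "0 < p" using p by auto
  have part: "\<exists>G. Im (coeff G 0) = 0 \<and> (\<forall>t\<in>circle. \<bar>Re (poly G t) - (h t + e)\<bar> < e) \<and>
      Lp_norm p (poly G) \<le> C * (Lp_norm p (\<lambda>t. of_real (h t)) + 2 * e)"
    if h: "continuous_on circle h" "\<And>t. 0 \<le> h t" and e: "0 < e" for h :: "complex \<Rightarrow> real" and e
  proof -
    have he: "continuous_on circle (\<lambda>t. complex_of_real (h t + e))"
      using h(1) by (intro continuous_intros)
    obtain v where v: "trig v" "\<And>t. t \<in> circle \<Longrightarrow> norm (of_real (h t + e) - v t) < e"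
      using trig_uniform_approx[OF he e] by metis
    obtain G where G: "Im (coeff G 0) = 0" "\<And>t. t \<in> circle \<Longrightarrow> Re (poly G t) = Re (v t)"
      using real_trig_eq_Re_poly[OF v(1)] by blast
    have close: "\<bar>Re (poly G t) - (h t + e)\<bar> < e" if "t \<in> circle" for t
      using v(2)[OF that] abs_Re_le_cmod[of "of_real (h t + e) - v t"] G(2)[OF that] by simp
    have pos: "0 < Re (poly G t)" if "t \<in> circle" for t
      using close[OF that] h(2)[of t] by linarith
    have hL: "(\<lambda>t. complex_of_real (h t)) \<in> Lp p"
      using h(1) p1 by (intro continuous_on_circle_in_Lp) (auto intro!: continuous_intros)
    have ReG: "(\<lambda>t. complex_of_real (Re (poly G t))) \<in> borel_measurable \<mu>"
      by (intro measurable_circle_continuous_on continuous_intros)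
    have "Lp_norm p (\<lambda>t. of_real (Re (poly G t))) \<le> 1 * Lp_norm p (\<lambda>t. of_real (h t) + of_real (2 * e))"
    proof (rule Lp_dominated(2)[OF p1(2) Lp_add(1)[OF p1(1) hL const_in_Lp] ReG])
      show "AE t in \<mu>. norm (complex_of_real (Re (poly G t))) \<le> 1 * norm (complex_of_real (h t) + of_real (2 * e))"
      proof (rule AE_circle)
        fix t :: complex assume t: "t \<in> circle"
        have "norm (complex_of_real (h t) + of_real (2 * e)) = h t + 2 * e"
          using h(2)[of t] e by (simp only: of_real_add[symmetric] norm_of_real)
        then show "norm (complex_of_real (Re (poly G t))) \<le> 1 * norm (complex_of_real (h t) + of_real (2 * e))"
          using close[OF t] pos[OF t] by simp
      qed
    qed simp
    also have "\<dots> \<le> Lp_norm p (\<lambda>t. of_real (h t)) + 2 * e"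
      using Lp_add(2)[OF p1(1) hL const_in_Lp[of "of_real (2 * e)"]] e p1 by simp
    finally have "C * Lp_norm p (\<lambda>t. of_real (Re (poly G t))) \<le> C * (Lp_norm p (\<lambda>t. of_real (h t)) + 2 * e)"
      using C(1) by (rule mult_left_mono)
    then show ?thesis using C(2)[OF pos G(1)] close G(1) by (intro exI[of _ G]) auto
  qed
  have "Lp_norm p (poly F) \<le> 2 * C * Lp_norm p (\<lambda>t. of_real (Re (poly F t)))"
    if im: "Im (coeff F 0) = 0" for F
  proof (rule field_le_epsilon)
    fix d :: real assume d: "0 < d"
    \<comment> \<open>The errors add up to \<open>4 * C * e\<close> from the two lifts and
      \<open>9 * e\<close> from the remainder.\<close>
    define e where "e = d / (4 * C + 9)"
    have e: "0 < e" using d C by (simp add: e_def)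
    define N where "N = Lp_norm p (\<lambda>t. of_real (Re (poly F t)))"
    have cm: "continuous_on circle (\<lambda>t. max (Re (poly F t)) 0)"
      "continuous_on circle (\<lambda>t. max (- Re (poly F t)) 0)"
      by (intro continuous_intros)+
    have ReF: "(\<lambda>t. complex_of_real (Re (poly F t))) \<in> Lp p"
      using p1 by (intro continuous_on_circle_in_Lp) (auto intro!: continuous_intros)
    have le_N: "Lp_norm p (\<lambda>t. complex_of_real (h t)) \<le> N"
      if "continuous_on circle h" "\<And>t. \<bar>h t\<bar> \<le> \<bar>Re (poly F t)\<bar>" for h
      using Lp_dominated(2)[OF p1(2) ReF, of "\<lambda>t. complex_of_real (h t)" 1] that
      by (auto simp: N_def intro!: measurable_circle_continuous_on continuous_intros)
    obtain G where G: "Im (coeff G 0) = 0" "\<And>t. t \<in> circle \<Longrightarrow> \<bar>Re (poly G t) - (max (Re (poly F t)) 0 + e)\<bar> < e"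
      "Lp_norm p (poly G) \<le> C * (Lp_norm p (\<lambda>t. of_real (max (Re (poly F t)) 0)) + 2 * e)"
      using part[OF cm(1) max.cobounded2 e] by blast
    obtain H where H: "Im (coeff H 0) = 0" "\<And>t. t \<in> circle \<Longrightarrow> \<bar>Re (poly H t) - (max (- Re (poly F t)) 0 + e)\<bar> < e"
      "Lp_norm p (poly H) \<le> C * (Lp_norm p (\<lambda>t. of_real (max (- Re (poly F t)) 0)) + 2 * e)"
      using part[OF cm(2) max.cobounded2 e] by blast
    have G': "Lp_norm p (poly G) \<le> C * (N + 2 * e)"
      using C(1) by (intro order_trans[OF G(3)] mult_left_mono add_right_mono le_N) (auto intro!: continuous_intros)
    have H': "Lp_norm p (poly H) \<le> C * (N + 2 * e)"
      using C(1) by (intro order_trans[OF H(3)] mult_left_mono add_right_mono le_N) (auto intro!: continuous_intros)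
    define D where "D = F - G + H"
    have ReD: "\<bar>Re (poly D t)\<bar> \<le> 2 * e" if t: "t \<in> circle" for t
      using G(2)[OF t] H(2)[OF t] by (auto simp: D_def max_def split: if_splits)
    have "(LINT t|\<mu>. (norm (poly D t))\<^sup>2) \<le> 2 * (LINT t|\<mu>. (Re (poly D t))\<^sup>2)"
      using im G(1) H(1) by (intro integral_norm_square_analytic_le) (simp add: D_def)
    also have "(LINT t|\<mu>. (Re (poly D t))\<^sup>2) \<le> (LINT t|\<mu>. 4 * e\<^sup>2)"
    proof (rule integral_mono)
      show "integrable \<mu> (\<lambda>t. (Re (poly D t))\<^sup>2)"
        by (intro integrable_continuous_circle continuous_intros)
      show "(Re (poly D t))\<^sup>2 \<le> 4 * e\<^sup>2" if "t \<in> space \<mu>" for t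
        using power_mono[OF ReD, of t 2] that by (simp add: power_mult_distrib)
    qed simp
    finally have "Lp_norm p (poly D) \<le> 9 * e"
      using p e by (intro Lp_norm_le_of_square) (auto intro!: continuous_intros)
    moreover have "poly F = (\<lambda>t. (poly G t + poly D t) - poly H t)" by (auto simp: D_def)
    then have "Lp_norm p (poly F) = Lp_norm p (\<lambda>t. (poly G t + poly D t) - poly H t)" by (rule arg_cong)
    moreover have "\<dots> \<le> Lp_norm p (\<lambda>t. poly G t + poly D t) + Lp_norm p (poly H)"
      using p1 by (intro Lp_diff(2) Lp_add(1) poly_in_Lp) auto
    moreover have "Lp_norm p (\<lambda>t. poly G t + poly D t) \<le> Lp_norm p (poly G) + Lp_norm p (poly D)"
      using p1 by (intro Lp_add(2) poly_in_Lp) auto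
    ultimately have "Lp_norm p (poly F) \<le> C * (N + 2 * e) + C * (N + 2 * e) + 9 * e"
      using G' H' by linarith
    also have "\<dots> = 2 * C * N + (4 * C + 9) * e" by (simp add: algebra_simps)
    also have "(4 * C + 9) * e = d" using C(1) by (simp add: e_def)
    finally show "Lp_norm p (poly F) \<le> 2 * C * Lp_norm p (\<lambda>t. of_real (Re (poly F t))) + d"
      by (simp add: N_def)
  qed
  then show ?thesis using C(1) by (intro exI[of _ "2 * C"]) auto
qed

text \<open>
  The functions \<open>poly a t + poly b (1 / t) / t\<close> are the trigonometric polynomials, and \<open>poly a\<close> is
  the analytic part.
\<close>

definition riesz_bound :: "real \<Rightarrow> real \<Rightarrow> bool" where
  "riesz_bound p K \<longleftrightarrow> 0 \<le> K \<and>
     (\<forall>a b. Lp_norm p (poly a) \<le> K * Lp_norm p (\<lambda>t. poly a t + poly b (1 / t) / t))"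

text \<open>The real and imaginary parts of \<open>f\<close> are the real parts of the analytic
  polynomials \<open>a + B\<close> and \<open>- \<i> * (a - B)\<close>, where \<open>B\<close> is
  the conjugate of the coanalytic part. Both are thus controlled by \<open>f\<close>, and the first
  plus \<open>\<i>\<close> times the second is \<open>2 * a\<close>.\<close>

lemma riesz_bound_le_2:
  assumes p: "1 < p" "p \<le> 2"
  shows "\<exists>K. riesz_bound p K"
proof -
  have p1: "1 \<le> p" "0 < p" using p by auto
  obtain C where C: "0 \<le> C" "\<And>F. Im (coeff F 0) = 0 \<Longrightarrow>
    Lp_norm p (poly F) \<le> C * Lp_norm p (\<lambda>t. of_real (Re (poly F t)))"
    using Lp_norm_analytic_le_Re[OF p] by blast
  have bound: "Lp_norm p (poly F) \<le> C * Lp_norm p h + norm (coeff F 0)"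
    if h: "trig h" "\<And>t. t \<in> circle \<Longrightarrow> \<bar>Re (poly F t)\<bar> \<le> norm (h t)" for F h
  proof -
    define c where "c = \<i> * of_real (Im (coeff F 0))"
    define G where "G = F - [:c:]"
    have "Lp_norm p (\<lambda>t. complex_of_real (Re (poly G t))) \<le> 1 * Lp_norm p h"
    proof (rule Lp_dominated(2)[OF p1(2) trig_in_Lp[OF p1(2) h(1)]])
      show "(\<lambda>t. complex_of_real (Re (poly G t))) \<in> borel_measurable \<mu>"
        by (intro measurable_circle_continuous_on continuous_intros)
      show "AE t in \<mu>. norm (complex_of_real (Re (poly G t))) \<le> 1 * norm (h t)"
        using h(2) by (intro AE_circle) (auto simp: G_def c_def)
    qed simp
    then have "C * Lp_norm p (\<lambda>t. complex_of_real (Re (poly G t))) \<le> C * Lp_norm p h"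
      using C(1) by (intro mult_left_mono) auto
    with C(2)[of G] have "Lp_norm p (poly G) \<le> C * Lp_norm p h" by (simp add: G_def c_def)
    moreover have "poly F = (\<lambda>t. poly G t + c)" by (auto simp: G_def)
    then have "Lp_norm p (poly F) \<le> Lp_norm p (poly G) + norm c"
      using Lp_add(2)[OF p1(1) poly_in_Lp[OF p1(2)] const_in_Lp[of c], of G] p1 by simp
    moreover have "norm c \<le> norm (coeff F 0)"
      by (simp add: c_def norm_mult abs_Im_le_cmod)
    ultimately show ?thesis by linarith
  qed
  have "Lp_norm p (poly a) \<le> (C + 1) * Lp_norm p (\<lambda>t. poly a t + poly b (1 / t) / t)" for a b
  proof -
    define f where "f = (\<lambda>t. poly a t + poly b (1 / t) / t)"
    define B where "B = pCons 0 (map_poly cnj b)"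
    have f: "trig f" unfolding f_def by (rule laurent_trig)
    have B: "poly B t = cnj (poly b (1 / t) / t)" if "t \<in> circle" for t
      by (simp only: complex_cnj_divide poly_cnj complex_cnj_one cnj_circle[OF that] B_def) simp
    have "norm (coeff a 0) \<le> Lp_norm p f"
      using norm_fourier_coeff_le_Lp[OF p1(1) trig_in_Lp[OF p1(2) f], of 0]
      by (simp add: f_def fourier_coeff_laurent)
    then have c0: "norm (coeff (a + B) 0) \<le> Lp_norm p f" "norm (coeff (smult (- \<i>) (a - B)) 0) \<le> Lp_norm p f"
      by (simp_all add: B_def norm_mult)
    have Re_rotate: "Re (- \<i> * (u - cnj v)) = Im (u + v)" for u v by simp
    have 1: "Lp_norm p (poly (a + B)) \<le> C * Lp_norm p f + Lp_norm p f"
    proof (rule order_trans[OF bound[OF f]])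
      fix t :: complex assume "t \<in> circle"
      then have "Re (poly (a + B) t) = Re (f t)" by (simp only: poly_add B f_def plus_complex.sel cnj.sel)
      then show "\<bar>Re (poly (a + B) t)\<bar> \<le> norm (f t)" by (simp add: abs_Re_le_cmod)
    qed (use c0 in simp)
    have 2: "Lp_norm p (poly (smult (- \<i>) (a - B))) \<le> C * Lp_norm p f + Lp_norm p f"
    proof (rule order_trans[OF bound[OF f]])
      fix t :: complex assume "t \<in> circle"
      then have "Re (poly (smult (- \<i>) (a - B)) t) = Im (f t)"
        by (simp only: poly_smult poly_diff B f_def Re_rotate)
      then show "\<bar>Re (poly (smult (- \<i>) (a - B)) t)\<bar> \<le> norm (f t)" by (simp add: abs_Im_le_cmod)
    qed (use c0 in simp)
    have eq: "poly (smult 2 a) = (\<lambda>t. poly (a + B) t + \<i> * poly (smult (- \<i>) (a - B)) t)"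
      by (simp add: fun_eq_iff algebra_simps)
    have "2 * Lp_norm p (poly a) = Lp_norm p (poly (smult 2 a))"
      using Lp_norm_scale[OF p1(2), of 2 "poly a"] by (simp add: poly_smult[abs_def])
    also have "\<dots> \<le> Lp_norm p (poly (a + B)) + Lp_norm p (\<lambda>t. \<i> * poly (smult (- \<i>) (a - B)) t)"
      unfolding eq using p1 by (intro Lp_add(2) Lp_scale poly_in_Lp) auto
    also have "Lp_norm p (\<lambda>t. \<i> * poly (smult (- \<i>) (a - B)) t) = Lp_norm p (poly (smult (- \<i>) (a - B)))"
      by (subst Lp_norm_scale[OF p1(2)]) simp
    finally have "Lp_norm p (poly a) \<le> C * Lp_norm p f + Lp_norm p f" using 1 2 by linarith
    then show ?thesis by (simp add: f_def algebra_simps)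
  qed
  then show ?thesis using C(1) unfolding riesz_bound_def by (intro exI[of _ "C + 1"]) auto
qed

section \<open>Doubling the exponent\<close>

lemma Lp_norm_square: "0 < p \<Longrightarrow> Lp_norm p (\<lambda>t. f t * f t) = (Lp_norm (2 * p) f)\<^sup>2"
proof -
  assume p: "0 < p"
  have e: "(norm (f t * f t)) powr p = norm (f t) powr (2 * p)" for t
    by (simp add: norm_mult powr_mult flip: powr_add)
  define I where "I = (LINT t|\<mu>. norm (f t) powr (2 * p))"
  have "I powr (1 / p) = (I powr (1 / (2 * p)))\<^sup>2"
    using p by (simp add: power2_eq_square flip: powr_add)
  then show ?thesis by (simp only: Lp_norm_def e I_def[symmetric])
qed

lemma Lp_norm_mult_le:
  assumes p: "0 < p" and f: "f \<in> Lp (2 * p)" and g: "g \<in> Lp (2 * p)"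
  shows "Lp_norm p (\<lambda>t. f t * g t) \<le> Lp_norm (2 * p) f * Lp_norm (2 * p) g"
proof -
  define F G where "F = (\<lambda>t. complex_of_real (norm (f t) powr p))" and "G = (\<lambda>t. complex_of_real (norm (g t) powr p))"
  note [measurable] = LpD(1)[OF f] LpD(1)[OF g]
  have e: "norm (complex_of_real (norm (h t) powr p)) powr 2 = norm (h t) powr (2 * p)" for h :: "complex \<Rightarrow> complex" and t
    by (simp add: powr_powr mult.commute del: powr_numeral)
  have FG: "F \<in> Lp 2" "G \<in> Lp 2"
    using LpD(2)[OF f] LpD(2)[OF g] unfolding Lp_def F_def G_def by (simp_all only: mem_Collect_eq e) simp_all
  have n: "Lp_norm 2 F = Lp_norm (2 * p) f powr p" "Lp_norm 2 G = Lp_norm (2 * p) g powr p"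
    using p unfolding Lp_norm_def F_def G_def e by (simp_all add: powr_powr)
  have "(LINT t|\<mu>. norm (f t * g t) powr p) = (LINT t|\<mu>. norm (F t * G t))"
    by (intro Bochner_Integration.integral_cong) (auto simp: F_def G_def norm_mult powr_mult)
  also have "\<dots> \<le> Lp_norm 2 F * Lp_norm 2 G"
    using FG by (intro Lp_Hoelder(2)) auto
  also have "\<dots> = (Lp_norm (2 * p) f * Lp_norm (2 * p) g) powr p"
    by (simp add: n powr_mult)
  finally show ?thesis using p by (subst Lp_norm_le_iff) auto
qed

text \<open>
  Cotlar's identity: if \<open>A\<close> and \<open>B\<close> are the two parts of \<open>f\<close>, then \<open>A\<^sup>2\<close> is the analytic part of
  \<open>A\<^sup>2 - B\<^sup>2 = f (A - B)\<close>.
\<close>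

lemma riesz_bound_double:
  assumes p: "1 \<le> p" and K: "riesz_bound p K"
  shows "riesz_bound (2 * p) (2 * K + 1)"
  unfolding riesz_bound_def
proof (intro conjI allI)
  have K0: "0 \<le> K" and Kb: "\<And>a b. Lp_norm p (poly a) \<le> K * Lp_norm p (\<lambda>t. poly a t + poly b (1 / t) / t)"
    using K by (auto simp: riesz_bound_def)
  then show "0 \<le> 2 * K + 1" by simp
  fix a b :: "complex poly"
  define f A B where "f = (\<lambda>t. poly a t + poly b (1 / t) / t)" and "A = poly a" and "B = (\<lambda>t. poly b (1 / t) / t)"
  have p2: "1 \<le> 2 * p" "0 < 2 * p" using p by auto
  have f: "f \<in> Lp (2 * p)" unfolding f_def by (rule trig_in_Lp[OF p2(2) laurent_trig])
  have A: "A \<in> Lp (2 * p)" unfolding A_def by (rule poly_in_Lp[OF p2(2)])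
  have "(\<lambda>t. poly 0 t + poly b (1 / t) / t) \<in> Lp (2 * p)" by (rule trig_in_Lp[OF p2(2) laurent_trig])
  then have B: "B \<in> Lp (2 * p)" by (simp add: B_def)
  define x y where "x = Lp_norm (2 * p) A" and "y = Lp_norm (2 * p) f"
  have x0: "0 \<le> x" "0 \<le> y" by (simp_all add: x_def y_def)
  \<comment> \<open>Writing \<open>A - B\<close> as \<open>2 * A - f\<close> bounds it by the
    unknown \<open>x\<close> and by \<open>y\<close>, which makes the estimate quadratic in
    \<open>x\<close>.\<close>
  have AB: "(\<lambda>t. A t - B t) = (\<lambda>t. (A t + A t) - f t)"
    by (auto simp: A_def B_def f_def)
  have "Lp_norm (2 * p) (\<lambda>t. A t - B t) \<le> Lp_norm (2 * p) (\<lambda>t. A t + A t) + y"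
    unfolding AB y_def by (intro Lp_diff(2) Lp_add(1) p2 A f)
  also have "Lp_norm (2 * p) (\<lambda>t. A t + A t) \<le> x + x"
    unfolding x_def by (intro Lp_add(2) p2 A)
  finally have ABn: "Lp_norm (2 * p) (\<lambda>t. A t - B t) \<le> 2 * x + y" by simp
  have "x\<^sup>2 = Lp_norm p (poly (a * a))"
    using Lp_norm_square[of p A] p by (simp add: x_def A_def poly_mult[abs_def])
  \<comment> \<open>\<open>pCons 0\<close> supplies one of the two factors \<open>1 / t\<close> in
    the square of the coanalytic part; the other is the division by \<open>t\<close>.\<close>
  also have "\<dots> \<le> K * Lp_norm p (\<lambda>t. poly (a * a) t + poly (- pCons 0 (b * b)) (1 / t) / t)"
    by (rule Kb)
  also have "(\<lambda>t. poly (a * a) t + poly (- pCons 0 (b * b)) (1 / t) / t) = (\<lambda>t. f t * (A t - B t))"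
    by (auto simp: f_def A_def B_def algebra_simps add_divide_distrib)
  also have "K * Lp_norm p (\<lambda>t. f t * (A t - B t)) \<le> K * (y * (2 * x + y))"
  proof (rule mult_left_mono[OF _ K0])
    have "Lp_norm p (\<lambda>t. f t * (A t - B t)) \<le> y * Lp_norm (2 * p) (\<lambda>t. A t - B t)"
      unfolding y_def using p by (intro Lp_norm_mult_le f Lp_diff(1) p2 A B) auto
    also have "\<dots> \<le> y * (2 * x + y)" using ABn x0 by (intro mult_left_mono) auto
    finally show "Lp_norm p (\<lambda>t. f t * (A t - B t)) \<le> y * (2 * x + y)" .
  qed
  finally have sq: "x\<^sup>2 \<le> K * (y * (2 * x + y))" .
  \<comment> \<open>Were \<open>x\<close> larger, \<open>x * x\<close> would exceed
    \<open>2 * K * x * y + x * y\<close>, where \<open>x * y\<close> is at least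
    \<open>K * y * y\<close>; this contradicts \<open>sq\<close>.\<close>
  have "x \<le> (2 * K + 1) * y"
  proof (rule ccontr)
    assume "\<not> ?thesis"
    then have less: "(2 * K + 1) * y < x" by simp
    then have "0 < x" using x0 K0 by (smt (verit) mult_nonneg_nonneg)
    then have "(2 * K + 1) * y * x < x * x" using less by (intro mult_strict_right_mono)
    moreover have "y * (K * y) \<le> y * x"
    proof (rule mult_left_mono[OF _ x0(2)])
      have "K * y \<le> (2 * K + 1) * y" using K0 x0 by (intro mult_right_mono) auto
      then show "K * y \<le> x" using less by linarith
    qed
    ultimately show False using sq by (simp add: power2_eq_square algebra_simps)
  qed
  then show "Lp_norm (2 * p) (poly a) \<le> (2 * K + 1) * Lp_norm (2 * p) (\<lambda>t. poly a t + poly b (1 / t) / t)"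
    by (simp add: x_def y_def A_def f_def)
qed

text \<open>Repeated halving brings the exponent down to at most 2. An exponent above 2 has half
  above 1, so the doubling step leads back up.\<close>

theorem riesz_bound_exists:
  assumes "1 < p"
  shows "\<exists>K. riesz_bound p K"
proof -
  have "\<exists>K. riesz_bound p K" if "1 < p" "p \<le> 2 ^ Suc m" for p m
    using that
  proof (induction m arbitrary: p)
    case 0
    then show ?case by (intro riesz_bound_le_2) auto
  next
    case (Suc m)
    show ?case
    proof (cases "p \<le> 2")
      case True
      then show ?thesis using Suc.prems by (intro riesz_bound_le_2) auto
    next
      case False
      then obtain K where "riesz_bound (p / 2) K" using Suc.IH[of "p / 2"] Suc.prems by auto
      from riesz_bound_double[OF _ this] False show ?thesis by auto
    qed
  qed
  moreover obtain m where "p < 2 ^ m" using real_arch_pow[of 2 p] by auto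
  then have "p \<le> 2 ^ Suc m" using assms by simp
  ultimately show ?thesis using assms by blast
qed

section \<open>The open mapping theorem\<close>

text \<open>Functions are representatives, so \<open>N\<close> is a seminorm and equality of classes
  reads \<open>N (\<lambda>t. f t - g t) = 0\<close>. Completeness is required for series with
  geometrically small terms, which is what the constructions below produce.\<close>

locale seminormed_functions =
  fixes X :: "('a \<Rightarrow> complex) set" and N :: "('a \<Rightarrow> complex) \<Rightarrow> real"
  assumes add: "f \<in> X \<Longrightarrow> g \<in> X \<Longrightarrow> (\<lambda>t. f t + g t) \<in> X"
    and scale: "f \<in> X \<Longrightarrow> (\<lambda>t. c * f t) \<in> X"
    and zero: "(\<lambda>t. 0) \<in> X"
    and norm_add: "f \<in> X \<Longrightarrow> g \<in> X \<Longrightarrow> N (\<lambda>t. f t + g t) \<le> N f + N g"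
    and norm_scale: "N (\<lambda>t. c * f t) = norm c * N f"
    and complete: "(\<And>k. x k \<in> X) \<Longrightarrow> (\<And>k::nat. N (x k) \<le> C * (1 / 2) ^ k) \<Longrightarrow>
      \<exists>s\<in>X. \<forall>m. N (\<lambda>t. s t - (\<Sum>k<m. x k t)) \<le> 2 * C * (1 / 2) ^ m"
begin

lemma diff: "f \<in> X \<Longrightarrow> g \<in> X \<Longrightarrow> (\<lambda>t. f t - g t) \<in> X"
  using add[of f "\<lambda>t. (-1) * g t"] scale[of g "-1"] by simp

lemma norm_minus_commute: "N (\<lambda>t. f t - g t) = N (\<lambda>t. g t - f t)"
  using norm_scale[of "-1" "\<lambda>t. g t - f t"] by simp

lemma norm_diff: "f \<in> X \<Longrightarrow> g \<in> X \<Longrightarrow> N (\<lambda>t. f t - g t) \<le> N f + N g"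
  using norm_add[of f "\<lambda>t. (-1) * g t"] scale[of g "-1"] norm_scale[of "-1" g] by simp

lemma norm_zero: "N (\<lambda>t. 0) = 0"
  using norm_scale[of 0 "\<lambda>t. 0"] by simp

lemma norm_nonneg: "f \<in> X \<Longrightarrow> 0 \<le> N f"
  using norm_diff[of f f] norm_zero by simp

lemma norm_triangle: "f \<in> X \<Longrightarrow> g \<in> X \<Longrightarrow> h \<in> X \<Longrightarrow>
    N (\<lambda>t. f t - h t) \<le> N (\<lambda>t. f t - g t) + N (\<lambda>t. g t - h t)"
  using norm_add[of "\<lambda>t. f t - g t" "\<lambda>t. g t - h t"] diff by simp

lemma norm_le_diff: "f \<in> X \<Longrightarrow> g \<in> X \<Longrightarrow> N f \<le> N (\<lambda>t. f t - g t) + N g"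
  using norm_add[of "\<lambda>t. f t - g t" g] diff by simp

lemma sum_in: "(\<And>i. i \<in> I \<Longrightarrow> x i \<in> X) \<Longrightarrow> (\<lambda>t. \<Sum>i\<in>I. x i t) \<in> X"
  by (induction I rule: infinite_finite_induct) (auto intro: zero add)

end

locale bounded_operator = seminormed_functions X N
  for X :: "('a \<Rightarrow> complex) set" and N +
  fixes T :: "('a \<Rightarrow> complex) \<Rightarrow> 'a \<Rightarrow> complex" and K :: real
  assumes maps: "f \<in> X \<Longrightarrow> T f \<in> X"
    and T_add: "f \<in> X \<Longrightarrow> g \<in> X \<Longrightarrow> N (\<lambda>t. T (\<lambda>s. f s + g s) t - (T f t + T g t)) = 0"
    and T_scale: "f \<in> X \<Longrightarrow> N (\<lambda>t. T (\<lambda>s. c * f s) t - c * T f t) = 0"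
    and T_bounded: "f \<in> X \<Longrightarrow> N (T f) \<le> K * N f"
begin

lemma T_diff: "f \<in> X \<Longrightarrow> g \<in> X \<Longrightarrow> N (\<lambda>t. T (\<lambda>s. f s - g s) t - (T f t - T g t)) = 0"
proof -
  assume f: "f \<in> X" and g: "g \<in> X"
  note d = diff[OF f g]
  have "N (\<lambda>t. T (\<lambda>s. f s - g s) t - (T f t - T g t))
      = N (\<lambda>t. (T (\<lambda>s. f s - g s) t + T g t) - T (\<lambda>s. (f s - g s) + g s) t)"
    by (simp add: algebra_simps)
  also have "\<dots> = 0" using T_add[OF d g] norm_minus_commute by metis
  finally show ?thesis .
qed

text \<open>Solving up to half of the error and repeating with the remainder gives a geometric
  series whose sum solves exactly. This ends the open mapping argument and, as a Neumann series,
  yields surjectivity of perturbed Toeplitz operators.\<close>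

lemma successive_approximation:
  assumes approx: "\<And>y. y \<in> X \<Longrightarrow> \<exists>x\<in>X. N x \<le> C * N y \<and> N (\<lambda>t. y t - T x t) \<le> N y / 2"
    and C: "0 \<le> C" and K: "0 \<le> K" and y: "y \<in> X"
  shows "\<exists>x\<in>X. N x \<le> 2 * C * N y \<and> N (\<lambda>t. y t - T x t) = 0"
proof -
  obtain R where R: "\<And>y. y \<in> X \<Longrightarrow> R y \<in> X \<and> N (R y) \<le> C * N y \<and> N (\<lambda>t. y t - T (R y) t) \<le> N y / 2"
    using approx by metis
  \<comment> \<open>\<open>z k\<close> is the part of \<open>y\<close> still unaccounted for after
    \<open>k\<close> corrections.\<close>
  define z where "z = rec_nat y (\<lambda>_ v t. v t - T (R v) t)"
  have z0: "z 0 = y" and zS: "z (Suc k) = (\<lambda>t. z k t - T (R (z k)) t)" for k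
    by (simp_all add: z_def)
  have z: "z k \<in> X \<and> N (z k) \<le> N y * (1 / 2) ^ k" for k
  proof (induction k)
    case (Suc k)
    then have "N (z (Suc k)) \<le> N (z k) / 2" unfolding zS using R by blast
    also have "\<dots> \<le> N y * (1 / 2) ^ Suc k" using Suc by simp
    finally show ?case using Suc R maps diff by (auto simp: zS)
  qed (simp add: z0 y)
  define x where "x = (\<lambda>k. R (z k))"
  have x: "x k \<in> X" for k using R z by (simp add: x_def)
  have xn: "N (x k) \<le> (C * N y) * (1 / 2) ^ k" for k
  proof -
    have "N (x k) \<le> C * N (z k)" using R z by (simp add: x_def)
    also have "\<dots> \<le> C * (N y * (1 / 2) ^ k)" using z C by (intro mult_left_mono) auto
    finally show ?thesis by (simp add: mult.assoc)
  qed
  obtain s where s: "s \<in> X" "\<And>m. N (\<lambda>t. s t - (\<Sum>k<m. x k t)) \<le> 2 * (C * N y) * (1 / 2) ^ m"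
    using complete[OF x xn] by blast
  \<comment> \<open>The operator is additive only up to functions of seminorm 0, so even this finite
    telescoping holds in the seminorm only.\<close>
  have part: "N (\<lambda>t. (y t - z m t) - T (\<lambda>s. \<Sum>k<m. x k s) t) \<le> 0" for m
  proof (induction m)
    case 0
    have "N (T (\<lambda>s. 0)) \<le> 0" using T_bounded[OF zero] norm_zero by simp
    then show ?case using norm_scale[of "-1" "T (\<lambda>s. 0)"] by (simp add: z0)
  next
    case (Suc m)
    let ?S = "\<lambda>m s. \<Sum>k<m. x k s"
    have S: "?S m \<in> X" for m by (rule sum_in) (rule x)
    let ?a = "\<lambda>t. (y t - z m t) - T (?S m) t"
    let ?b = "\<lambda>t. T (?S m) t + T (x m) t - T (\<lambda>s. ?S m s + x m s) t"
    have "N ?b = 0" using T_add[OF S x] norm_minus_commute by metis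
    moreover have "?a \<in> X" "?b \<in> X" using y z S x by (auto intro!: diff add maps)
    moreover have "(\<lambda>t. (y t - z (Suc m) t) - T (?S (Suc m)) t) = (\<lambda>t. ?a t + ?b t)"
      by (simp add: zS x_def algebra_simps)
    ultimately show ?case using Suc norm_add[of ?a ?b] by simp
  qed
  have "N (\<lambda>t. y t - T s t) \<le> (N y + K * (2 * (C * N y))) * (1 / 2) ^ m" for m
  proof -
    let ?S = "\<lambda>s. \<Sum>k<m. x k s"
    have S: "?S \<in> X" by (rule sum_in) (rule x)
    have d: "(\<lambda>t. ?S t - s t) \<in> X" using S s by (intro diff)
    have "N (\<lambda>t. T ?S t - T s t) \<le> N (\<lambda>t. (T ?S t - T s t) - T (\<lambda>t. ?S t - s t) t) + N (T (\<lambda>t. ?S t - s t))"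
      by (intro norm_le_diff diff maps S s(1) d)
    also have "N (\<lambda>t. (T ?S t - T s t) - T (\<lambda>t. ?S t - s t) t) = 0"
      using T_diff[OF S s(1)] norm_minus_commute by metis
    also have "N (T (\<lambda>t. ?S t - s t)) \<le> K * N (\<lambda>t. ?S t - s t)" by (rule T_bounded[OF d])
    also have "\<dots> \<le> K * (2 * (C * N y) * (1 / 2) ^ m)"
      using s(2)[of m] K norm_minus_commute[of ?S s] by (intro mult_left_mono) auto
    finally have 1: "N (\<lambda>t. T ?S t - T s t) \<le> K * (2 * (C * N y)) * (1 / 2) ^ m" by simp
    have "N (\<lambda>t. y t - T ?S t) \<le> N (\<lambda>t. (y t - T ?S t) - z m t) + N (z m)"
      using y S z by (intro norm_le_diff diff maps) auto
    also have "(\<lambda>t. (y t - T ?S t) - z m t) = (\<lambda>t. (y t - z m t) - T ?S t)" by (auto simp: algebra_simps)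
    finally have "N (\<lambda>t. y t - T ?S t) \<le> N y * (1 / 2) ^ m" using part[of m] z[of m] by linarith
    with 1 show ?thesis
      using norm_triangle[of y "T ?S" "T s"] y S s(1) maps by (auto simp: distrib_right)
  qed
  moreover have "(\<lambda>m. (N y + K * (2 * (C * N y))) * (1 / 2) ^ m) \<longlonglongrightarrow> (N y + K * (2 * (C * N y))) * 0"
    by (intro tendsto_intros LIMSEQ_power_zero) simp
  ultimately have "N (\<lambda>t. y t - T s t) \<le> 0" by (intro LIMSEQ_le_const[of _ 0]) auto
  moreover have "0 \<le> N (\<lambda>t. y t - T s t)" using y s(1) by (intro norm_nonneg diff maps)
  moreover have "N s \<le> 2 * C * N y" using s(2)[of 0] by simp
  ultimately show ?thesis using s(1) by (intro bexI[of _ s]) auto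
qed

text \<open>Baire's argument. Some ball is approximated arbitrarily well by images of functions of
  norm at most \<open>k\<close>; differences move the ball to the origin, scaling gives approximate
  solutions with a linear bound, and these are improved to exact ones.\<close>

theorem open_mapping:
  assumes onto: "\<And>y. y \<in> X \<Longrightarrow> \<exists>x\<in>X. N (\<lambda>t. y t - T x t) = 0" and K: "0 \<le> K"
  shows "\<exists>C\<ge>0. \<forall>y\<in>X. \<exists>x\<in>X. N x \<le> C * N y \<and> N (\<lambda>t. y t - T x t) = 0"
proof -
  have "\<exists>(k::nat) y0 r. y0 \<in> X \<and> 0 < r \<and>
    (\<forall>y\<in>X. N (\<lambda>t. y t - y0 t) < r \<longrightarrow> (\<forall>e>0. \<exists>x\<in>X. N x \<le> real k \<and> N (\<lambda>t. y t - T x t) < e))"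
  proof (rule ccontr)
    assume "\<not> ?thesis"
    then have neg: "\<exists>y\<in>X. N (\<lambda>t. y t - y0 t) < r \<and> (\<exists>e>0. \<forall>x\<in>X. N x \<le> real k \<longrightarrow> e \<le> N (\<lambda>t. y t - T x t))"
      if "y0 \<in> X" "0 < r" for y0 r and k :: nat
      using that by (metis not_le)
    \<comment> \<open>One step of a nested sequence of balls: the new ball lies in the old one, and
      the images of functions of norm at most \<open>k\<close> stay at distance
      \<open>2 * r'\<close> or more from its centre.\<close>
    have step: "\<exists>y' r'. (y' \<in> X \<and> 0 < r') \<and> N (\<lambda>t. y' t - y t) \<le> r / 2 \<and> r' \<le> r / 2 \<and>
        (\<forall>x\<in>X. N x \<le> real k \<longrightarrow> 2 * r' \<le> N (\<lambda>t. y' t - T x t))"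
      if y: "y \<in> X" and r: "0 < r" for y r and k :: nat
    proof -
      obtain y' e where "y' \<in> X" "N (\<lambda>t. y' t - y t) < r / 2" "0 < e"
        "\<forall>x\<in>X. N x \<le> real k \<longrightarrow> e \<le> N (\<lambda>t. y' t - T x t)"
        using neg[OF y half_gt_zero[OF r], of k] by blast
      then show ?thesis using r
        by (intro exI[of _ y'] exI[of _ "min r e / 2"]) (auto simp: min_def)
    qed
    define P where "P = (\<lambda>(k::nat) (s :: ('a \<Rightarrow> complex) \<times> real). fst s \<in> X \<and> 0 < snd s)"
    define Q where "Q = (\<lambda>(k::nat) (s :: ('a \<Rightarrow> complex) \<times> real) (s' :: ('a \<Rightarrow> complex) \<times> real).
      N (\<lambda>t. fst s' t - fst s t) \<le> snd s / 2 \<and> snd s' \<le> snd s / 2 \<and>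
        (\<forall>x\<in>X. N x \<le> real k \<longrightarrow> 2 * snd s' \<le> N (\<lambda>t. fst s' t - T x t)))"
    have "\<exists>f. \<forall>k. P k (f k) \<and> Q k (f k) (f (Suc k))"
    proof (rule dependent_nat_choice)
      show "\<exists>s. P 0 s" using zero by (intro exI[of _ "(\<lambda>t. 0, 1)"]) (simp add: P_def)
      show "\<exists>s'. P (Suc k) s' \<and> Q k s s'" if "P k s" for s k
        using step[of "fst s" "snd s" k] that by (auto simp: P_def Q_def)
    qed
    then obtain f where f: "\<And>k. P k (f k)" "\<And>k. Q k (f k) (f (Suc k))" by blast
    define y r where "y = (\<lambda>k. fst (f k))" and "r = (\<lambda>k. snd (f k))"
    have y: "y k \<in> X" and r: "0 < r k" for k using f(1) by (auto simp: P_def y_def r_def)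
    have yS: "N (\<lambda>t. y (Suc k) t - y k t) \<le> r k / 2" and rS: "r (Suc k) \<le> r k / 2"
      and away: "x \<in> X \<Longrightarrow> N x \<le> real k \<Longrightarrow> 2 * r (Suc k) \<le> N (\<lambda>t. y (Suc k) t - T x t)" for k x
      using f(2)[of k] by (auto simp: Q_def y_def r_def)
    have r_le: "r k \<le> r 0 * (1 / 2) ^ k" for k
    proof (induction k)
      case (Suc k)
      then show ?case using rS[of k] by simp
    qed simp
    obtain s where s: "s \<in> X"
      "\<And>m. N (\<lambda>t. s t - (\<Sum>k<m. y (Suc k) t - y k t)) \<le> 2 * (r 0 / 2) * (1 / 2) ^ m"
    proof -
      have "N (\<lambda>t. y (Suc k) t - y k t) \<le> r 0 / 2 * (1 / 2) ^ k" for k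
        using yS[of k] r_le[of k] by simp
      from complete[OF diff[OF y y] this] show ?thesis using that by blast
    qed
    define w where "w = (\<lambda>t. s t + y 0 t)"
    have w: "w \<in> X" unfolding w_def by (intro add s y)
    have w_lim: "N (\<lambda>t. w t - y m t) \<le> r 0 * (1 / 2) ^ m" for m
    proof -
      have "(\<Sum>k<m. y (Suc k) t - y k t) = y m t - y 0 t" for t by (rule sum_lessThan_telescope)
      then have "(\<lambda>t. w t - y m t) = (\<lambda>t. s t - (\<Sum>k<m. y (Suc k) t - y k t))"
        by (simp add: w_def fun_eq_iff)
      then show ?thesis using s(2)[of m] by simp
    qed
    \<comment> \<open>Each step of the centres is at most \<open>r k / 2\<close> and hence at most
      \<open>r k - r (Suc k)\<close>, so the distances telescope.\<close>
    have fin: "N (\<lambda>t. y (m + i) t - y m t) \<le> r m - r (m + i)" for m i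
    proof (induction i)
      case 0
      then show ?case using norm_zero by simp
    next
      case (Suc i)
      then show ?case
        using norm_triangle[OF y[of "m + Suc i"] y[of "m + i"] y[of m]] yS[of "m + i"] rS[of "m + i"] by simp
    qed
    have w_close: "N (\<lambda>t. w t - y m t) \<le> r m" for m
    proof (rule LIMSEQ_le_const)
      have "(\<lambda>i. r 0 * (1 / 2) ^ (m + i) + r m) \<longlonglongrightarrow> r 0 * ((1 / 2) ^ m * 0) + r m"
        unfolding power_add by (intro tendsto_intros LIMSEQ_power_zero) simp
      then show "(\<lambda>i. r 0 * (1 / 2) ^ (m + i) + r m) \<longlonglongrightarrow> r m" by simp
      have "N (\<lambda>t. w t - y m t) \<le> r 0 * (1 / 2) ^ (m + i) + r m" for i
        using norm_triangle[OF w y[of "m + i"] y[of m]] w_lim[of "m + i"] fin[of m i] r[of "m + i"] by linarith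
      then show "\<exists>n. \<forall>i\<ge>n. N (\<lambda>t. w t - y m t) \<le> r 0 * (1 / 2) ^ (m + i) + r m" by blast
    qed
    obtain x where x: "x \<in> X" "N (\<lambda>t. w t - T x t) = 0" using onto[OF w] by blast
    obtain k :: nat where "N x \<le> real k" using real_arch_simple by blast
    \<comment> \<open>The limit \<open>w\<close> is within \<open>r (Suc k)\<close> of the centre,
      yet it agrees with \<open>T x\<close> up to seminorm 0, and \<open>T x\<close> is at distance
      at least \<open>2 * r (Suc k)\<close>.\<close>
    from away[OF x(1) this] norm_triangle[OF y[of "Suc k"] w maps[OF x(1)]] x(2)
      w_close[of "Suc k"] r[of "Suc k"] norm_minus_commute[of w "y (Suc k)"]
    show False by linarith
  qed
  then obtain k :: nat and y0 r where y0: "y0 \<in> X" "0 < r"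
    and ball: "\<And>y e. y \<in> X \<Longrightarrow> N (\<lambda>t. y t - y0 t) < r \<Longrightarrow> 0 < e \<Longrightarrow> \<exists>x\<in>X. N x \<le> real k \<and> N (\<lambda>t. y t - T x t) < e"
    by blast
  have centered: "\<exists>x\<in>X. N x \<le> 2 * real k \<and> N (\<lambda>t. y t - T x t) < 2 * e"
    if y: "y \<in> X" "N y < r" and e: "0 < e" for y e
  proof -
    obtain x1 where x1: "x1 \<in> X" "N x1 \<le> real k" "N (\<lambda>t. (y t + y0 t) - T x1 t) < e"
      using ball[of "\<lambda>t. y t + y0 t" e] y y0 e add by auto
    obtain x2 where x2: "x2 \<in> X" "N x2 \<le> real k" "N (\<lambda>t. y0 t - T x2 t) < e"
      using ball[of y0 e] y0 e norm_zero by auto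
    have d: "(\<lambda>t. x1 t - x2 t) \<in> X" using x1 x2 by (intro diff)
    let ?a = "\<lambda>t. (y t + y0 t) - T x1 t" and ?b = "\<lambda>t. y0 t - T x2 t"
    let ?c = "\<lambda>t. (T x1 t - T x2 t) - T (\<lambda>t. x1 t - x2 t) t"
    have mem: "?a \<in> X" "?b \<in> X" "?c \<in> X" using x1 x2 y y0 d by (auto intro!: diff add maps)
    have "N ?c = 0" using T_diff[OF x1(1) x2(1)] norm_minus_commute by metis
    then have "N (\<lambda>t. (?a t - ?b t) + ?c t) < 2 * e"
      using norm_add[OF diff[OF mem(1,2)] mem(3)] norm_diff[OF mem(1,2)] x1(3) x2(3) by linarith
    then have "N (\<lambda>t. y t - T (\<lambda>t. x1 t - x2 t) t) < 2 * e" by (simp add: algebra_simps)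
    then show ?thesis using norm_diff[OF x1(1) x2(1)] x1(2) x2(2) d by (intro bexI[OF _ d]) auto
  qed
  \<comment> \<open>Scaling by \<open>a = r / (2 * N y)\<close> puts \<open>y\<close> inside the
    ball; undoing it turns the bound \<open>2 * real k\<close> into \<open>2 * real k / a\<close>,
    which is \<open>C * N y\<close>.\<close>
  define C where "C = 4 * real k / r"
  have C: "0 \<le> C" using y0 by (simp add: C_def)
  have approx: "\<exists>x\<in>X. N x \<le> C * N y \<and> N (\<lambda>t. y t - T x t) \<le> N y / 2" if y: "y \<in> X" for y
  proof (cases "N y = 0")
    case True
    have "N (T (\<lambda>s. 0)) \<le> 0" using T_bounded[OF zero] norm_zero by simp
    then show ?thesis
      using norm_diff[OF y maps[OF zero]] True norm_zero by (intro bexI[OF _ zero]) auto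
  next
    case False
    then have pos: "0 < N y" using norm_nonneg[OF y] by simp
    define a where "a = r / (2 * N y)"
    have a: "0 < a" using pos y0 by (simp add: a_def)
    have ay: "a * N y = r / 2" using pos by (simp add: a_def)
    have "N (\<lambda>t. of_real a * y t) < r" using a ay y0 by (subst norm_scale) simp
    then obtain x where x: "x \<in> X" "N x \<le> 2 * real k" "N (\<lambda>t. of_real a * y t - T x t) < r / 4"
      using centered[OF scale[OF y, of "of_real a"], of "r / 8"] y0 by auto
    define v where "v = (\<lambda>t. of_real (1 / a) * x t)"
    have v: "v \<in> X" unfolding v_def by (rule scale[OF x(1)])
    have ia: "1 / a = 2 * N y / r" using pos y0 by (simp add: a_def)
    have "N v = 1 / a * N x" using a unfolding v_def by (simp only: norm_scale norm_of_real) simp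
    also have "\<dots> \<le> 1 / a * (2 * real k)" using a x by (intro mult_left_mono) auto
    also have "\<dots> = C * N y" by (simp add: ia C_def)
    finally have 1: "N v \<le> C * N y" .
    let ?b = "\<lambda>t. of_real (1 / a) * (of_real a * y t - T x t)" and ?c = "\<lambda>t. of_real (1 / a) * T x t - T v t"
    have "N ?c = 0"
      using T_scale[OF x(1), of "of_real (1 / a)"] unfolding v_def by (subst norm_minus_commute)
    moreover have "N ?b \<le> N y / 2"
    proof -
      have "N ?b = 1 / a * N (\<lambda>t. of_real a * y t - T x t)"
        using a by (simp only: norm_scale norm_of_real) simp
      also have "\<dots> \<le> 1 / a * (r / 4)" using a x by (intro mult_left_mono) auto
      also have "\<dots> = N y / 2" using y0 by (simp add: ia)
      finally show ?thesis .
    qed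
    moreover have "?b \<in> X" "?c \<in> X" by (intro diff scale maps x(1) y v)+
    ultimately have "N (\<lambda>t. ?b t + ?c t) \<le> N y / 2" using norm_add[of ?b ?c] by linarith
    also have "(\<lambda>t. ?b t + ?c t) = (\<lambda>t. y t - T v t)" using a by (auto simp: right_diff_distrib)
    finally show ?thesis using 1 v by blast
  qed
  show ?thesis
    using successive_approximation[OF approx C K] C by (intro exI[of _ "2 * C"]) auto
qed

end

section \<open>Hardy spaces\<close>

lemma HpD:
  "f \<in> Hp p \<Longrightarrow> f \<in> Lp p" "f \<in> Hp p \<Longrightarrow> n < 0 \<Longrightarrow> fourier_coeff f n = 0"
  by (simp_all add: Hp_def)

lemma HpI: "f \<in> Lp p \<Longrightarrow> (\<And>n. n < 0 \<Longrightarrow> fourier_coeff f n = 0) \<Longrightarrow> f \<in> Hp p"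
  by (simp add: Hp_def)

lemma Hp_measurable: "f \<in> Hp p \<Longrightarrow> f \<in> borel_measurable \<mu>"
  by (rule LpD(1)[OF HpD(1)])

lemma Hp_integrable: "1 \<le> p \<Longrightarrow> f \<in> Hp p \<Longrightarrow> integrable \<mu> f"
  by (rule Lp_integrable(1)[OF _ HpD(1)])

lemma Hp_add: "1 \<le> p \<Longrightarrow> f \<in> Hp p \<Longrightarrow> g \<in> Hp p \<Longrightarrow> (\<lambda>t. f t + g t) \<in> Hp p"
  by (rule HpI) (simp_all add: Lp_add(1) HpD fourier_coeff_add Hp_integrable)

lemma Hp_scale: "f \<in> Hp p \<Longrightarrow> (\<lambda>t. c * f t) \<in> Hp p"
  by (rule HpI) (simp_all add: Lp_scale HpD fourier_coeff_scale)

lemma Hp_diff: "1 \<le> p \<Longrightarrow> f \<in> Hp p \<Longrightarrow> g \<in> Hp p \<Longrightarrow> (\<lambda>t. f t - g t) \<in> Hp p"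
  by (rule HpI) (simp_all add: Lp_diff(1) HpD fourier_coeff_diff Hp_integrable)

lemma Hp_zero: "(\<lambda>t. 0) \<in> Hp p"
  by (rule HpI) simp_all

lemma Hp_sum: "1 \<le> p \<Longrightarrow> (\<And>i. i \<in> I \<Longrightarrow> f i \<in> Hp p) \<Longrightarrow> (\<lambda>t. \<Sum>i\<in>I. f i t) \<in> Hp p"
  by (induction I rule: infinite_finite_induct) (auto intro: Hp_zero Hp_add)

lemma poly_in_Hp: "0 < p \<Longrightarrow> poly a \<in> Hp p"
  by (rule HpI) (simp_all add: poly_in_Lp fourier_coeff_poly)

lemma Lp_powi_mult:
  assumes "0 < p" "f \<in> Lp p"
  shows "(\<lambda>t. t powi k * f t) \<in> Lp p"
proof (rule Lp_dominated(1)[OF assms])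
  show "(\<lambda>t. t powi k * f t) \<in> borel_measurable \<mu>" using LpD(1)[OF assms(2)] by measurable
  show "AE t in \<mu>. norm (t powi k * f t) \<le> 1 * norm (f t)"
    by (rule AE_circle) (simp add: norm_mult norm_power_int)
qed simp

lemma Hp_powi_mult: "0 < p \<Longrightarrow> f \<in> Hp p \<Longrightarrow> 0 \<le> k \<Longrightarrow> (\<lambda>t. t powi k * f t) \<in> Hp p"
  by (rule HpI) (simp_all add: Lp_powi_mult HpD fourier_coeff_powi_mult)

lemma Hp_powi_div:
  assumes "0 < p" "f \<in> Hp p" "\<And>n. n < k \<Longrightarrow> fourier_coeff f n = 0"
  shows "(\<lambda>t. t powi (- k) * f t) \<in> Hp p"
  using assms by (intro HpI) (simp_all add: Lp_powi_mult HpD fourier_coeff_powi_mult)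

lemma Hp_unique:
  assumes "1 \<le> p" "1 \<le> q" "f \<in> Hp p" "g \<in> Hp q" "\<And>n. 0 \<le> n \<Longrightarrow> fourier_coeff f n = fourier_coeff g n"
  shows "AE t in \<mu>. f t = g t"
proof (rule fourier_coeff_unique)
  show "fourier_coeff f n = fourier_coeff g n" for n
    using assms(5)[of n] HpD(2)[OF assms(3), of n] HpD(2)[OF assms(4), of n] by (cases "0 \<le> n") auto
qed (use assms Hp_integrable in auto)

section \<open>The Riesz projection\<close>

lemma riesz_projection_exists:
  assumes p: "1 < p"
  shows "\<exists>K\<ge>0. \<forall>f\<in>Lp p. \<exists>h\<in>Hp p. (\<forall>n\<ge>0. fourier_coeff h n = fourier_coeff f n) \<and>
    Lp_norm p h \<le> K * Lp_norm p f \<and> (\<forall>e>0. \<exists>a. Lp_norm p (\<lambda>t. h t - poly a t) < e)"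
proof -
  have p1: "1 \<le> p" "0 < p" using p by auto
  obtain K where K: "0 \<le> K" "\<And>a b. Lp_norm p (poly a) \<le> K * Lp_norm p (\<lambda>t. poly a t + poly b (1 / t) / t)"
    using riesz_bound_exists[OF p] by (auto simp: riesz_bound_def)
  have "\<exists>h\<in>Hp p. (\<forall>n\<ge>0. fourier_coeff h n = fourier_coeff f n) \<and>
    Lp_norm p h \<le> K * Lp_norm p f \<and> (\<forall>e>0. \<exists>a. Lp_norm p (\<lambda>t. h t - poly a t) < e)"
    if f: "f \<in> Lp p" for f
  proof -
    define L where "L = (\<lambda>a b t. poly a t + poly b (1 / t) / t :: complex)"
    have L: "L a b \<in> Lp p" for a b unfolding L_def by (rule trig_in_Lp[OF p1(2) laurent_trig])
    have "\<exists>a b. Lp_norm p (\<lambda>t. f t - L a b t) < (1 / 2) ^ k" for k :: nat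
    proof -
      obtain u where u: "trig u" "Lp_norm p (\<lambda>t. f t - u t) < (1 / 2) ^ k"
        using Lp_trig_approx[OF p1(1) f, of "(1 / 2) ^ k"] by auto
      obtain a b where ab: "\<And>t. t \<in> circle \<Longrightarrow> u t = L a b t"
        using trig_laurent[OF u(1)] unfolding L_def by metis
      have "Lp_norm p (\<lambda>t. f t - L a b t) = Lp_norm p (\<lambda>t. f t - u t)"
        using ab LpD(1)[OF f] LpD(1)[OF L] LpD(1)[OF trig_in_Lp[OF p1(2) u(1)]]
        by (intro Lp_cong_AE(2) AE_circle) auto
      then show ?thesis using u(2) by metis
    qed
    then obtain a b where ab: "\<And>k. Lp_norm p (\<lambda>t. f t - L (a k) (b k) t) < (1 / 2) ^ k" by metis
    \<comment> \<open>Increments of the analytic parts of approximations to \<open>f\<close>. The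
      bound for trigonometric polynomials makes them geometrically small; the limit is the
      projection, and polynomials approximate it by construction.\<close>
    define x where "x = (\<lambda>k. poly (a (Suc k) - a k))"
    have x: "x k \<in> Lp p" for k unfolding x_def by (rule poly_in_Lp[OF p1(2)])
    have xn: "Lp_norm p (x k) \<le> (2 * K) * (1 / 2) ^ k" for k
    proof -
      have "Lp_norm p (x k) \<le> K * Lp_norm p (L (a (Suc k) - a k) (b (Suc k) - b k))"
        unfolding x_def L_def by (rule K(2))
      also have "L (a (Suc k) - a k) (b (Suc k) - b k) = (\<lambda>t. L (a (Suc k)) (b (Suc k)) t - L (a k) (b k) t)"
        by (simp add: L_def fun_eq_iff diff_divide_distrib)
      also have "Lp_norm p \<dots> \<le> Lp_norm p (\<lambda>t. L (a (Suc k)) (b (Suc k)) t - f t) + Lp_norm p (\<lambda>t. f t - L (a k) (b k) t)"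
        by (rule Lp_norm_triangle_diff[OF p1(1) L f L])
      also have "\<dots> \<le> (1 / 2) ^ Suc k + (1 / 2) ^ k"
        using ab[of k] ab[of "Suc k"] Lp_norm_minus_commute[of p f "L (a (Suc k)) (b (Suc k))"] by linarith
      also have "\<dots> \<le> 2 * (1 / 2) ^ k" by simp
      finally show ?thesis using K(1) by (simp add: mult_left_mono mult.assoc)
    qed
    obtain s where s: "s \<in> Lp p" "\<And>m. Lp_norm p (\<lambda>t. s t - (\<Sum>k<m. x k t)) \<le> 2 * (2 * K) * (1 / 2) ^ m"
      using Lp_complete[of p x "2 * K", OF p1(1) x xn] by metis
    define h where "h = (\<lambda>t. s t + poly (a 0) t)"
    have h: "h \<in> Lp p" unfolding h_def by (intro Lp_add(1) p1 s poly_in_Lp)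
    have hm: "Lp_norm p (\<lambda>t. h t - poly (a m) t) \<le> 4 * K * (1 / 2) ^ m" for m
    proof -
      have "(\<Sum>k<m. x k t) = poly (a m) t - poly (a 0) t" for t
        using sum_lessThan_telescope[of "\<lambda>k. poly (a k) t" m] by (simp add: x_def)
      then have "(\<lambda>t. h t - poly (a m) t) = (\<lambda>t. s t - (\<Sum>k<m. x k t))" by (simp add: h_def fun_eq_iff)
      then show ?thesis using s(2)[of m] by simp
    qed
    have lim0: "(\<lambda>m. c * (1 / 2) ^ m) \<longlonglongrightarrow> 0" for c :: real
      using tendsto_mult[OF tendsto_const LIMSEQ_power_zero[of "1 / 2 :: real"], of c] by simp
    have lim_h: "(\<lambda>m. Lp_norm p (\<lambda>t. poly (a m) t - h t)) \<longlonglongrightarrow> 0"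
      using hm by (intro Lim_null_comparison[OF always_eventually lim0[of "4 * K"]])
        (simp add: Lp_norm_minus_commute[of p _ h])
    have lim_f: "(\<lambda>m. Lp_norm p (\<lambda>t. L (a m) (b m) t - f t)) \<longlonglongrightarrow> 0"
      using ab by (intro Lim_null_comparison[OF always_eventually lim0[of 1]])
        (simp add: Lp_norm_minus_commute[of p _ f] less_imp_le)
    have ch: "(\<lambda>m. fourier_coeff (poly (a m)) n) \<longlonglongrightarrow> fourier_coeff h n" for n
      by (rule fourier_coeff_Lp_tendsto[OF p1(1) h poly_in_Lp[OF p1(2)] lim_h])
    have neg: "fourier_coeff h n = 0" if "n < 0" for n
      using ch[of n] that by (simp add: fourier_coeff_poly LIMSEQ_const_iff)
    have pos: "fourier_coeff h n = fourier_coeff f n" if n: "0 \<le> n" for n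
    proof (rule LIMSEQ_unique[OF ch])
      have "fourier_coeff (L (a m) (b m)) n = fourier_coeff (poly (a m)) n" for m
        using n unfolding L_def by (simp add: fourier_coeff_laurent fourier_coeff_poly)
      then show "(\<lambda>m. fourier_coeff (poly (a m)) n) \<longlonglongrightarrow> fourier_coeff f n"
        using fourier_coeff_Lp_tendsto[OF p1(1) f L lim_f, of n] by simp
    qed
    have "Lp_norm p h \<le> K * Lp_norm p f + 5 * K * (1 / 2) ^ m" for m
    proof -
      have "Lp_norm p (poly (a m)) \<le> K * Lp_norm p (L (a m) (b m))" unfolding L_def by (rule K(2))
      also have "Lp_norm p (L (a m) (b m)) \<le> Lp_norm p f + (1 / 2) ^ m"
      proof -
        have "Lp_norm p (\<lambda>t. f t - (f t - L (a m) (b m) t)) \<le> Lp_norm p f + Lp_norm p (\<lambda>t. f t - L (a m) (b m) t)"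
          by (intro Lp_diff p1 f L)
        then show ?thesis using ab[of m] by simp
      qed
      finally have "Lp_norm p (poly (a m)) \<le> K * (Lp_norm p f + (1 / 2) ^ m)"
        using K(1) by (simp add: mult_left_mono)
      moreover have "Lp_norm p (\<lambda>t. (h t - poly (a m) t) + poly (a m) t) \<le> Lp_norm p (\<lambda>t. h t - poly (a m) t) + Lp_norm p (poly (a m))"
        by (intro Lp_add(2) Lp_diff(1) p1 h poly_in_Lp)
      ultimately show ?thesis using hm[of m] by (simp add: distrib_left)
    qed
    moreover have "(\<lambda>m. K * Lp_norm p f + 5 * K * (1 / 2) ^ m) \<longlonglongrightarrow> K * Lp_norm p f + 0"
      by (intro tendsto_intros lim0)
    ultimately have "Lp_norm p h \<le> K * Lp_norm p f"
      using LIMSEQ_le_const[of _ "K * Lp_norm p f" "Lp_norm p h"] by simp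
    moreover have "\<exists>a. Lp_norm p (\<lambda>t. h t - poly a t) < e" if "0 < e" for e
    proof -
      have "\<forall>\<^sub>F m in sequentially. Lp_norm p (\<lambda>t. poly (a m) t - h t) < e"
        by (rule order_tendstoD(2)[OF lim_h that])
      then show ?thesis by (auto simp: eventually_sequentially Lp_norm_minus_commute[of p _ h])
    qed
    ultimately show ?thesis using HpI[OF h neg] pos by (intro bexI[of _ h]) auto
  qed
  then show ?thesis using K(1) by blast
qed

lemma riesz_proj:
  assumes "1 < p" "f \<in> Lp p"
  shows "riesz_proj p f \<in> Hp p" "0 \<le> n \<Longrightarrow> fourier_coeff (riesz_proj p f) n = fourier_coeff f n"
proof -
  have "\<exists>h. h \<in> Hp p \<and> (\<forall>n\<ge>0. fourier_coeff h n = fourier_coeff f n)"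
    using riesz_projection_exists[OF assms(1)] assms(2) by blast
  from someI_ex[OF this]
  show "riesz_proj p f \<in> Hp p" "0 \<le> n \<Longrightarrow> fourier_coeff (riesz_proj p f) n = fourier_coeff f n"
    by (auto simp: riesz_proj_def)
qed

lemma riesz_proj_bounded:
  assumes p: "1 < p"
  shows "\<exists>K\<ge>0. \<forall>f\<in>Lp p. Lp_norm p (riesz_proj p f) \<le> K * Lp_norm p f"
proof -
  obtain K where K: "0 \<le> K" "\<And>f. f \<in> Lp p \<Longrightarrow> \<exists>h\<in>Hp p. (\<forall>n\<ge>0. fourier_coeff h n = fourier_coeff f n) \<and>
    Lp_norm p h \<le> K * Lp_norm p f"
    using riesz_projection_exists[OF p] by meson
  have "Lp_norm p (riesz_proj p f) \<le> K * Lp_norm p f" if f: "f \<in> Lp p" for f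
  proof -
    obtain h where h: "h \<in> Hp p" "\<forall>n\<ge>0. fourier_coeff h n = fourier_coeff f n"
      "Lp_norm p h \<le> K * Lp_norm p f"
      using K(2)[OF f] by blast
    have "AE t in \<mu>. riesz_proj p f t = h t"
      using h riesz_proj[OF p f] p by (intro Hp_unique[of p p]) auto
    then have "Lp_norm p (riesz_proj p f) = Lp_norm p h"
      by (intro Lp_cong_AE(2) Hp_measurable[OF riesz_proj(1)[OF p f]] Hp_measurable[OF h(1)])
    then show ?thesis using h(3) by simp
  qed
  then show ?thesis using K(1) by blast
qed

text \<open>A function of H^p is its own Riesz projection, and projections were built as limits of
  polynomials.\<close>

lemma Hp_poly_dense:
  assumes p: "1 < p" and f: "f \<in> Hp p" and e: "0 < e"
  shows "\<exists>a. Lp_norm p (\<lambda>t. f t - poly a t) < e"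
proof -
  obtain h where h: "h \<in> Hp p" "\<forall>n\<ge>0. fourier_coeff h n = fourier_coeff f n"
    "\<forall>e>0. \<exists>a. Lp_norm p (\<lambda>t. h t - poly a t) < e"
    using riesz_projection_exists[OF p] HpD(1)[OF f] by meson
  have AE: "AE t in \<mu>. f t = h t" using h f p by (intro Hp_unique[of p p]) auto
  obtain a where a: "Lp_norm p (\<lambda>t. h t - poly a t) < e" using h(3) e by blast
  have [measurable]: "poly a \<in> borel_measurable \<mu>" using borel_measurable_integrable[OF poly_integrable] .
  note [measurable] = Hp_measurable[OF f] Hp_measurable[OF h(1)]
  have "Lp_norm p (\<lambda>t. f t - poly a t) = Lp_norm p (\<lambda>t. h t - poly a t)"
    by (rule Lp_cong_AE(2)) (use AE in auto)
  then show ?thesis using a by metis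
qed

lemma fourier_coeff_poly_mult:
  assumes h: "integrable \<mu> h" "\<And>n. n < 0 \<Longrightarrow> fourier_coeff h n = 0" and n: "n \<le> 0"
  shows "fourier_coeff (\<lambda>t. poly a t * h t) n = (if n = 0 then coeff a 0 * fourier_coeff h 0 else 0)"
proof -
  have "fourier_coeff (\<lambda>t. poly a t * h t) n = fourier_coeff (\<lambda>t. \<Sum>i\<le>degree a. coeff a i * (t powi int i * h t)) n"
    unfolding poly_as_powi_sum by (simp add: sum_distrib_right mult.assoc del: power_int_of_nat)
  also have "\<dots> = (\<Sum>i\<le>degree a. coeff a i * fourier_coeff h (n - int i))"
  proof (subst fourier_coeff_sum)
    show "integrable \<mu> (\<lambda>t. coeff a i * (t powi int i * h t))" for i
      using integrable_powi[OF h(1), of "int i"] by (simp add: mult.commute del: power_int_of_nat)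
  qed (simp only: fourier_coeff_scale fourier_coeff_powi_mult)
  also have "\<dots> = (\<Sum>i\<le>degree a. if i = 0 then coeff a 0 * fourier_coeff h n else 0)"
    using n h(2) by (intro sum.cong) auto
  also have "\<dots> = (if n = 0 then coeff a 0 * fourier_coeff h 0 else 0)"
    using n h(2)[of n] by auto
  finally show ?thesis .
qed

text \<open>With a polynomial as first factor both claims are finite computations with coefficients,
  and Hoelder's inequality allows the passage to the limit as polynomials tend to \<open>f\<close>.
  The second claim is multiplicativity of the value at 0.\<close>

lemma Hp_mult:
  assumes p: "1 < p" "1 < q" "1 / p + 1 / q = 1" and f: "f \<in> Hp p" and h: "h \<in> Hp q"
  shows "n < 0 \<Longrightarrow> fourier_coeff (\<lambda>t. f t * h t) n = 0"
    and "fourier_coeff (\<lambda>t. f t * h t) 0 = fourier_coeff f 0 * fourier_coeff h 0"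
proof -
  have p1: "1 \<le> p" "0 < p" using p by auto
  have "\<exists>a. Lp_norm p (\<lambda>t. f t - poly a t) < (1 / 2) ^ k" for k :: nat
    by (rule Hp_poly_dense[OF p(1) f]) simp
  then obtain a where a: "\<And>k. Lp_norm p (\<lambda>t. f t - poly (a k) t) < (1 / 2) ^ k" by metis
  have lim: "(\<lambda>k. c * (1 / 2) ^ k) \<longlonglongrightarrow> 0" for c :: real
    using tendsto_mult[OF tendsto_const LIMSEQ_power_zero[of "1 / 2 :: real"], of c] by simp
  have lim_f: "(\<lambda>m. Lp_norm p (\<lambda>t. poly (a m) t - f t)) \<longlonglongrightarrow> 0"
    using a by (intro Lim_null_comparison[OF always_eventually lim[of 1]])
      (simp add: Lp_norm_minus_commute[of p _ f] less_imp_le)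
  have coeffs: "(\<lambda>k. fourier_coeff (\<lambda>t. poly (a k) t * h t) n) \<longlonglongrightarrow> fourier_coeff (\<lambda>t. f t * h t) n" for n
  proof -
    have "norm (fourier_coeff (\<lambda>t. poly (a k) t * h t) n - fourier_coeff (\<lambda>t. f t * h t) n)
        \<le> Lp_norm q h * (1 / 2) ^ k" for k
    proof -
      have d: "(\<lambda>t. f t - poly (a k) t) \<in> Lp p" by (intro Lp_diff(1) p1 HpD(1)[OF f] poly_in_Lp)
      have i: "integrable \<mu> (\<lambda>t. f t * h t)" "integrable \<mu> (\<lambda>t. poly (a k) t * h t)"
        using p1 by (auto intro!: Lp_Hoelder(1)[OF p] HpD(1)[OF f] HpD(1)[OF h] poly_in_Lp)
      have "norm (fourier_coeff (\<lambda>t. f t * h t) n - fourier_coeff (\<lambda>t. poly (a k) t * h t) n)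
          = norm (fourier_coeff (\<lambda>t. (f t - poly (a k) t) * h t) n)"
        using i by (simp add: fourier_coeff_diff left_diff_distrib)
      also have "\<dots> \<le> (LINT t|\<mu>. norm ((f t - poly (a k) t) * h t))"
        by (intro norm_fourier_coeff_le Lp_Hoelder(1)[OF p d HpD(1)[OF h]])
      also have "\<dots> \<le> Lp_norm p (\<lambda>t. f t - poly (a k) t) * Lp_norm q h"
        by (rule Lp_Hoelder(2)[OF p d HpD(1)[OF h]])
      also have "\<dots> \<le> (1 / 2) ^ k * Lp_norm q h"
        using a[of k] by (intro mult_right_mono) auto
      finally show ?thesis by (simp add: norm_minus_commute mult.commute)
    qed
    from Lim_null_comparison[OF always_eventually[OF allI[OF this]] lim] show ?thesis
      by (rule LIM_zero_cancel)
  qed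
  have hc: "integrable \<mu> h" "\<And>n. n < 0 \<Longrightarrow> fourier_coeff h n = 0"
    using Hp_integrable[OF _ h] HpD(2)[OF h] p by auto
  show "fourier_coeff (\<lambda>t. f t * h t) n = 0" if "n < 0"
    using coeffs[of n] that by (simp add: fourier_coeff_poly_mult[OF hc] LIMSEQ_const_iff)
  have "(\<lambda>k. fourier_coeff (poly (a k)) 0 * fourier_coeff h 0) \<longlonglongrightarrow> fourier_coeff f 0 * fourier_coeff h 0"
    by (intro tendsto_intros fourier_coeff_Lp_tendsto[OF p1(1) HpD(1)[OF f] poly_in_Lp[OF p1(2)] lim_f])
  then show "fourier_coeff (\<lambda>t. f t * h t) 0 = fourier_coeff f 0 * fourier_coeff h 0"
    using coeffs[of 0] by (intro LIMSEQ_unique[OF coeffs]) (simp add: fourier_coeff_poly_mult[OF hc] fourier_coeff_poly)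
qed

lemma Hp_bar_reflect:
  "f \<in> Hp_bar p \<Longrightarrow> reflect f \<in> Hp p" "f \<in> Hp p \<Longrightarrow> reflect f \<in> Hp_bar p"
proof -
  show "reflect f \<in> Hp p" if "f \<in> Hp_bar p"
  proof (rule HpI)
    have f: "f \<in> Lp p" and c: "\<And>n. 0 < n \<Longrightarrow> fourier_coeff f n = 0" using that by (auto simp: Hp_bar_def)
    show "reflect f \<in> Lp p" by (rule Lp_norm_reflect(1)[OF f])
    show "fourier_coeff (reflect f) n = 0" if "n < 0" for n
      using c[of "- n"] that fourier_coeff_reflect[OF LpD(1)[OF f], of n] by simp
  qed
  show "reflect f \<in> Hp_bar p" if f: "f \<in> Hp p"
    using Lp_norm_reflect(1)[OF HpD(1)[OF f]] HpD(2)[OF f] fourier_coeff_reflect[OF Hp_measurable[OF f]]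
    by (simp add: Hp_bar_def)
qed

lemma Hp_complete:
  assumes p: "1 \<le> p" and x: "\<And>k. x k \<in> Hp p" "\<And>k. Lp_norm p (x k) \<le> C * (1 / 2) ^ k"
  shows "\<exists>s\<in>Hp p. \<forall>m. Lp_norm p (\<lambda>t. s t - (\<Sum>k<m. x k t)) \<le> 2 * C * (1 / 2) ^ m"
proof -
  obtain s where s: "s \<in> Lp p" "\<And>m. Lp_norm p (\<lambda>t. s t - (\<Sum>k<m. x k t)) \<le> 2 * C * (1 / 2) ^ m"
    using Lp_complete[of p x C, OF p HpD(1)[OF x(1)] x(2)] by metis
  have S: "(\<lambda>t. \<Sum>k<m. x k t) \<in> Hp p" for m by (rule Hp_sum[OF p x(1)])
  have lim: "(\<lambda>m. 2 * C * (1 / 2) ^ m) \<longlonglongrightarrow> 0"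
    using tendsto_mult[OF tendsto_const LIMSEQ_power_zero[of "1 / 2 :: real"], of "2 * C"] by simp
  have le: "norm (Lp_norm p (\<lambda>t. (\<Sum>k<m. x k t) - s t)) \<le> 2 * C * (1 / 2) ^ m" for m
    using s(2)[of m] by (subst Lp_norm_minus_commute) simp
  have "(\<lambda>m. Lp_norm p (\<lambda>t. (\<Sum>k<m. x k t) - s t)) \<longlonglongrightarrow> 0"
    by (rule Lim_null_comparison[OF always_eventually[OF allI[OF le]] lim])
  from fourier_coeff_Lp_tendsto[OF p s(1) HpD(1)[OF S] this]
  have coeffs: "(\<lambda>m. fourier_coeff (\<lambda>t. \<Sum>k<m. x k t) n) \<longlonglongrightarrow> fourier_coeff s n" for n .
  have "fourier_coeff s n = 0" if "n < 0" for n
    using coeffs[of n] HpD(2)[OF S that] by (simp add: LIMSEQ_const_iff)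
  then show ?thesis using s by (intro bexI[of _ s] HpI) auto
qed

lemma Hp_seminormed: "1 \<le> p \<Longrightarrow> seminormed_functions (Hp p) (Lp_norm p)"
  by unfold_locales
     (auto intro: Hp_add Hp_scale Hp_zero Lp_add(2) HpD(1) Hp_complete simp: Lp_norm_scale)

section \<open>Dimensions of quotient spaces\<close>

text \<open>Gaussian elimination: an unknown \<open>j0\<close> that occurs in equation
  \<open>b\<close> is expressed through the others and eliminated from the remaining
  equations.\<close>

lemma homogeneous_system_nontrivial:
  fixes C :: "'j \<Rightarrow> 'b \<Rightarrow> complex"
  assumes "finite B" "finite J" "card B < card J"
  shows "\<exists>d. (\<exists>j\<in>J. d j \<noteq> 0) \<and> (\<forall>b\<in>B. (\<Sum>j\<in>J. d j * C j b) = 0)"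
  using assms
proof (induction B arbitrary: J C rule: finite_induct)
  case empty
  then have "J \<noteq> {}" by auto
  then show ?case by (intro exI[of _ "\<lambda>_. 1"]) auto
next
  case (insert b B)
  show ?case
  proof (cases "\<forall>j\<in>J. C j b = 0")
    case True
    obtain d where "\<exists>j\<in>J. d j \<noteq> 0" "\<forall>b\<in>B. (\<Sum>j\<in>J. d j * C j b) = 0"
      using insert.IH[of J C] insert.prems insert.hyps by auto
    then show ?thesis using True by (intro exI[of _ d]) auto
  next
    case False
    then obtain j0 where j0: "j0 \<in> J" "C j0 b \<noteq> 0" by blast
    define J' where "J' = J - {j0}"
    have J': "finite J'" "J = insert j0 J'" "j0 \<notin> J'" using insert.prems j0 by (auto simp: J'_def)
    define C' where "C' = (\<lambda>j x. C j x - C j b / C j0 b * C j0 x)"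
    obtain d where d: "\<exists>j\<in>J'. d j \<noteq> 0" "\<And>x. x \<in> B \<Longrightarrow> (\<Sum>j\<in>J'. d j * C' j x) = 0"
      using insert.IH[of J' C'] insert.prems insert.hyps J' by auto
    define d0 where "d0 = - (\<Sum>j\<in>J'. d j * (C j b / C j0 b))"
    define e where "e = d(j0 := d0)"
    have sum: "(\<Sum>j\<in>J. e j * C j x) = d0 * C j0 x + (\<Sum>j\<in>J'. d j * C j x)" for x
      using J' by (auto simp: e_def intro!: sum.cong)
    have split: "d0 * C j0 x + (\<Sum>j\<in>J'. d j * C j x) = (\<Sum>j\<in>J'. d j * C' j x)" for x
      by (simp add: C'_def d0_def sum_distrib_right right_diff_distrib sum_subtractf mult.assoc)
    have "(\<Sum>j\<in>J. e j * C j x) = 0" if "x \<in> insert b B" for x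
    proof (cases "x = b")
      case True
      then show ?thesis unfolding sum split using j0 by (simp add: C'_def)
    next
      case False
      then show ?thesis unfolding sum split using d(2) that by simp
    qed
    moreover have "\<exists>j\<in>J. e j \<noteq> 0" using d(1) J' by (auto simp: e_def)
    ultimately show ?thesis by blast
  qed
qed

definition lin_subspace :: "(complex \<Rightarrow> complex) set \<Rightarrow> bool" where
  "lin_subspace W \<longleftrightarrow> (\<lambda>t. 0) \<in> W \<and> (\<forall>f\<in>W. \<forall>g\<in>W. (\<lambda>t. f t + g t) \<in> W) \<and>
     (\<forall>c. \<forall>f\<in>W. (\<lambda>t. c * f t) \<in> W)"

lemma lin_subspace_sum:
  assumes "lin_subspace W" "\<And>i. i \<in> I \<Longrightarrow> f i \<in> W"
  shows "(\<lambda>t. \<Sum>i\<in>I. c i * f i t) \<in> W"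
  using assms(2)
proof (induction I rule: infinite_finite_induct)
  case (insert i I)
  then have "(\<lambda>t. c i * f i t) \<in> W" "(\<lambda>t. \<Sum>i\<in>I. c i * f i t) \<in> W"
    using assms(1) by (auto simp: lin_subspace_def)
  then show ?case using insert.hyps assms(1) by (simp add: lin_subspace_def)
qed (use assms(1) in \<open>auto simp: lin_subspace_def\<close>)

lemma quot_basis_dependent:
  assumes W: "lin_subspace W" and B: "quot_basis V W B" and J: "finite J" "card B < card J"
    and v: "\<And>j. j \<in> J \<Longrightarrow> v j \<in> V"
  shows "\<exists>d. (\<exists>j\<in>J. d j \<noteq> 0) \<and> (\<lambda>t. \<Sum>j\<in>J. d j * v j t) \<in> W"
proof -
  have "\<forall>j\<in>J. \<exists>c. (\<lambda>t. v j t - (\<Sum>b\<in>B. c b * b t)) \<in> W"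
    using B v by (simp add: quot_basis_def)
  from bchoice[OF this] obtain C where C: "\<And>j. j \<in> J \<Longrightarrow> (\<lambda>t. v j t - (\<Sum>b\<in>B. C j b * b t)) \<in> W"
    by blast
  obtain d where d: "\<exists>j\<in>J. d j \<noteq> 0" "\<And>b. b \<in> B \<Longrightarrow> (\<Sum>j\<in>J. d j * C j b) = 0"
    using homogeneous_system_nontrivial[of B J C] B J by (auto simp: quot_basis_def)
  have "(\<Sum>j\<in>J. d j * (v j t - (\<Sum>b\<in>B. C j b * b t))) = (\<Sum>j\<in>J. d j * v j t)" for t
  proof -
    have "(\<Sum>j\<in>J. d j * (\<Sum>b\<in>B. C j b * b t)) = (\<Sum>j\<in>J. \<Sum>b\<in>B. d j * C j b * b t)"
      by (simp add: sum_distrib_left mult.assoc)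
    also have "\<dots> = (\<Sum>b\<in>B. (\<Sum>j\<in>J. d j * C j b) * b t)"
      by (subst sum.swap) (simp add: sum_distrib_right)
    also have "\<dots> = 0" using d(2) by simp
    finally show ?thesis by (simp add: right_diff_distrib sum_subtractf)
  qed
  then have "(\<lambda>t. \<Sum>j\<in>J. d j * v j t) \<in> W"
    using lin_subspace_sum[where I = J and c = d and f = "\<lambda>j t. v j t - (\<Sum>b\<in>B. C j b * b t)", OF W C]
    by simp
  then show ?thesis using d(1) by blast
qed

text \<open>Two bases have the same size by the dependence lemma, so the definite description in
  \<open>dim_quot\<close> denotes.\<close>

lemma dim_quot_eq:
  assumes W: "lin_subspace W" and B: "quot_basis V W B"
  shows "dim_quot V W = card B"
proof -
  have le: "card B2 \<le> card B1" if B1: "quot_basis V W B1" and B2: "quot_basis V W B2" for B1 B2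
  proof (rule ccontr)
    assume "\<not> ?thesis"
    then obtain d where "\<exists>b\<in>B2. d b \<noteq> 0" "(\<lambda>t. \<Sum>b\<in>B2. d b * b t) \<in> W"
      using quot_basis_dependent[OF W B1, of B2 "\<lambda>b. b"] B2 by (auto simp: quot_basis_def)
    then show False using B2 by (auto simp: quot_basis_def)
  qed
  show ?thesis
    unfolding dim_quot_def using B by (intro the_equality) (auto intro!: antisym le)
qed

text \<open>\<open>quot_basis\<close> speaks of sets of functions, whereas the bases constructed
  later are indexed families; independence already makes such a family injective.\<close>

lemma dim_quot_eqI:
  assumes W: "lin_subspace W" and b: "\<And>j. j < m \<Longrightarrow> b j \<in> V"
    and span: "\<And>v. v \<in> V \<Longrightarrow> \<exists>c. (\<lambda>t. v t - (\<Sum>j<m. c j * b j t)) \<in> W"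
    and indep: "\<And>c j. (\<lambda>t. \<Sum>j<m. c j * b j t) \<in> W \<Longrightarrow> j < m \<Longrightarrow> c j = 0"
  shows "dim_quot V W = m"
proof -
  have inj: "inj_on b {..<m}"
  proof (rule inj_onI, rule ccontr)
    fix i j assume ij: "i \<in> {..<m}" "j \<in> {..<m}" "b i = b j" "i \<noteq> j"
    define c :: "nat \<Rightarrow> complex" where "c = (\<lambda>k. if k = i then 1 else if k = j then -1 else 0)"
    have "(\<Sum>k<m. c k * b k t) = (\<Sum>k\<in>{i, j}. c k * b k t)" for t
      using ij by (intro sum.mono_neutral_right) (auto simp: c_def)
    also have "(\<Sum>k\<in>{i, j}. c k * b k t) = 0" for t using ij by (simp add: c_def)
    finally have "(\<lambda>t. \<Sum>k<m. c k * b k t) \<in> W" using W by (simp add: lin_subspace_def)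
    from indep[OF this, of i] show False using ij by (simp add: c_def)
  qed
  have sum: "(\<Sum>x\<in>b ` {..<m}. c x * x t) = (\<Sum>j<m. c (b j) * b j t)" for c t
    by (simp add: sum.reindex[OF inj])
  have "quot_basis V W (b ` {..<m})"
    unfolding quot_basis_def sum
  proof (intro conjI ballI allI impI)
    fix v assume "v \<in> V"
    then obtain c where c: "(\<lambda>t. v t - (\<Sum>j<m. c j * b j t)) \<in> W" using span by blast
    have "(\<Sum>j<m. c (the_inv_into {..<m} b (b j)) * b j t) = (\<Sum>j<m. c j * b j t)" for t
      by (intro sum.cong) (auto simp: the_inv_into_f_f[OF inj])
    with c show "\<exists>c. (\<lambda>t. v t - (\<Sum>j<m. c (b j) * b j t)) \<in> W"
      by (intro exI[of _ "\<lambda>x. c (the_inv_into {..<m} b x)"]) simp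
  next
    fix c x assume "(\<lambda>t. \<Sum>j<m. c (b j) * b j t) \<in> W" "x \<in> b ` {..<m}"
    then show "c x = 0" using indep[of "\<lambda>j. c (b j)"] by auto
  qed (use b in auto)
  then show ?thesis using dim_quot_eq[OF W] card_image[OF inj] by fastforce
qed

section \<open>Toeplitz operators\<close>

lemma Linf_mult_Hp: "1 < p \<Longrightarrow> a \<in> Linf \<Longrightarrow> f \<in> Hp p \<Longrightarrow> (\<lambda>t. a t * f t) \<in> Lp p"
  by (rule Linf_mult) (auto intro: HpD(1))

lemma Linf_mult_integrable: "1 < p \<Longrightarrow> a \<in> Linf \<Longrightarrow> f \<in> Hp p \<Longrightarrow> integrable \<mu> (\<lambda>t. a t * f t)"
  by (rule Lp_integrable(1)[OF _ Linf_mult_Hp]) auto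

lemma toeplitz_in_Hp: "1 < p \<Longrightarrow> a \<in> Linf \<Longrightarrow> f \<in> Hp p \<Longrightarrow> toeplitz p a f \<in> Hp p"
  unfolding toeplitz_def by (intro riesz_proj(1) Linf_mult_Hp)

lemma fourier_coeff_toeplitz:
  "1 < p \<Longrightarrow> a \<in> Linf \<Longrightarrow> f \<in> Hp p \<Longrightarrow> 0 \<le> n \<Longrightarrow>
    fourier_coeff (toeplitz p a f) n = fourier_coeff (\<lambda>t. a t * f t) n"
  unfolding toeplitz_def by (intro riesz_proj(2) Linf_mult_Hp)

text \<open>Translates equations for T(a) into equations for the coefficients of
  \<open>a * f\<close>, which are independent of the representative that \<open>riesz_proj\<close>
  chooses.\<close>

lemma toeplitz_AE_eq_iff:
  assumes p: "1 < p" and a: "a \<in> Linf" and f: "f \<in> Hp p" and h: "h \<in> Hp p"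
  shows "(AE t in \<mu>. toeplitz p a f t = h t) \<longleftrightarrow> (\<forall>n\<ge>0. fourier_coeff (\<lambda>t. a t * f t) n = fourier_coeff h n)"
proof
  note T = toeplitz_in_Hp[OF p a f] fourier_coeff_toeplitz[OF p a f]
  show "\<forall>n\<ge>0. fourier_coeff (\<lambda>t. a t * f t) n = fourier_coeff h n" if "AE t in \<mu>. toeplitz p a f t = h t"
    using fourier_coeff_cong_AE[OF Hp_measurable[OF T(1)] Hp_measurable[OF h] that] T(2) by simp
  show "AE t in \<mu>. toeplitz p a f t = h t" if "\<forall>n\<ge>0. fourier_coeff (\<lambda>t. a t * f t) n = fourier_coeff h n"
    using p that T h by (intro Hp_unique[of p p]) auto
qed

lemma toeplitz_norm_le:
  assumes p: "1 < p"
  shows "\<exists>K\<ge>0. \<forall>a \<delta> f. 0 \<le> \<delta> \<longrightarrow> a \<in> Linf \<longrightarrow> (AE t in \<mu>. norm (a t) \<le> \<delta>) \<longrightarrow> f \<in> Hp p \<longrightarrow>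
    Lp_norm p (toeplitz p a f) \<le> K * \<delta> * Lp_norm p f"
proof -
  obtain K where K: "0 \<le> K" "\<And>f. f \<in> Lp p \<Longrightarrow> Lp_norm p (riesz_proj p f) \<le> K * Lp_norm p f"
    using riesz_proj_bounded[OF p] by blast
  have "Lp_norm p (toeplitz p a f) \<le> K * \<delta> * Lp_norm p f"
    if d: "0 \<le> \<delta>" and a: "a \<in> Linf" "AE t in \<mu>. norm (a t) \<le> \<delta>" and f: "f \<in> Hp p" for a \<delta> f
  proof -
    note af = Linf_mult_Hp[OF p a(1) f]
    have "Lp_norm p (toeplitz p a f) \<le> K * Lp_norm p (\<lambda>t. a t * f t)"
      unfolding toeplitz_def by (rule K(2)[OF af])
    also have "Lp_norm p (\<lambda>t. a t * f t) \<le> \<delta> * Lp_norm p f"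
    proof (rule Lp_dominated(2)[OF _ HpD(1)[OF f] LpD(1)[OF af] d])
      show "AE t in \<mu>. norm (a t * f t) \<le> \<delta> * norm (f t)"
        using a(2) by eventually_elim (auto simp: norm_mult intro: mult_right_mono)
    qed (use p in simp)
    finally show ?thesis using K(1) by (simp add: mult_left_mono mult.assoc)
  qed
  then show ?thesis using K(1) by blast
qed

lemma LinfD: "a \<in> Linf \<Longrightarrow> a \<in> borel_measurable \<mu>"
  "a \<in> Linf \<Longrightarrow> \<exists>C\<ge>0. AE t in \<mu>. norm (a t) \<le> C"
proof -
  assume a: "a \<in> Linf"
  then show "a \<in> borel_measurable \<mu>" by (simp add: Linf_def)
  obtain C where C: "AE t in \<mu>. norm (a t) \<le> C" using a by (auto simp: Linf_def)
  then have "AE t in \<mu>. norm (a t) \<le> max C 0" by eventually_elim auto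
  then show "\<exists>C\<ge>0. AE t in \<mu>. norm (a t) \<le> C" by (intro exI[of _ "max C 0"]) auto
qed

lemma toeplitz_bounded_operator:
  assumes p: "1 < p" and a: "a \<in> Linf"
  shows "\<exists>K\<ge>0. bounded_operator (Hp p) (Lp_norm p) (toeplitz p a) K"
proof -
  have p1: "1 \<le> p" "0 < p" using p by auto
  obtain C where C: "0 \<le> C" "AE t in \<mu>. norm (a t) \<le> C" using LinfD(2)[OF a] by blast
  obtain K where K: "0 \<le> K" "\<And>f. f \<in> Hp p \<Longrightarrow> Lp_norm p (toeplitz p a f) \<le> K * C * Lp_norm p f"
    using toeplitz_norm_le[OF p] C a by meson
  have null: "Lp_norm p (\<lambda>t. f t - g t) = 0" if "f \<in> Hp p" "g \<in> Hp p" "AE t in \<mu>. f t = g t" for f g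
    using that Lp_norm_eq_0_iff[OF p1(2) HpD(1)[OF Hp_diff[OF p1(1) that(1,2)]]] by simp
  interpret seminormed_functions "Hp p" "Lp_norm p" by (rule Hp_seminormed[OF p1(1)])
  have "bounded_operator (Hp p) (Lp_norm p) (toeplitz p a) (K * C)"
  proof
    show "toeplitz p a f \<in> Hp p" if "f \<in> Hp p" for f by (rule toeplitz_in_Hp[OF p a that])
    show "Lp_norm p (\<lambda>t. toeplitz p a (\<lambda>s. f s + g s) t - (toeplitz p a f t + toeplitz p a g t)) = 0"
      if f: "f \<in> Hp p" and g: "g \<in> Hp p" for f g
    proof (rule null[of "toeplitz p a (\<lambda>s. f s + g s)" "\<lambda>t. toeplitz p a f t + toeplitz p a g t"])
      show S: "(\<lambda>t. toeplitz p a f t + toeplitz p a g t) \<in> Hp p" by (intro Hp_add p1 toeplitz_in_Hp p a f g)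
      show "AE t in \<mu>. toeplitz p a (\<lambda>s. f s + g s) t = toeplitz p a f t + toeplitz p a g t"
        using Linf_mult_integrable[OF p a f] Linf_mult_integrable[OF p a g]
          Hp_integrable[OF p1(1) toeplitz_in_Hp[OF p a f]] Hp_integrable[OF p1(1) toeplitz_in_Hp[OF p a g]]
        by (subst toeplitz_AE_eq_iff[OF p a Hp_add[OF p1(1) f g] S])
           (simp add: distrib_left fourier_coeff_add fourier_coeff_toeplitz[OF p a f] fourier_coeff_toeplitz[OF p a g])
    qed (intro toeplitz_in_Hp p a Hp_add p1 f g)
    show "Lp_norm p (\<lambda>t. toeplitz p a (\<lambda>s. c * f s) t - c * toeplitz p a f t) = 0" if f: "f \<in> Hp p" for c f
    proof (rule null[of "toeplitz p a (\<lambda>s. c * f s)" "\<lambda>t. c * toeplitz p a f t"])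
      show S: "(\<lambda>t. c * toeplitz p a f t) \<in> Hp p" by (intro Hp_scale toeplitz_in_Hp p a f)
      show "AE t in \<mu>. toeplitz p a (\<lambda>s. c * f s) t = c * toeplitz p a f t"
        by (subst toeplitz_AE_eq_iff[OF p a Hp_scale[OF f] S])
           (simp add: fourier_coeff_scale fourier_coeff_toeplitz[OF p a f] mult.left_commute[of _ c])
    qed (intro toeplitz_in_Hp p a Hp_scale f)
    show "Lp_norm p (toeplitz p a f) \<le> K * C * Lp_norm p f" if "f \<in> Hp p" for f by (rule K(2)[OF that])
  qed
  then show ?thesis using K(1) C(1) by (intro exI[of _ "K * C"]) auto
qed

definition toeplitz_injective :: "real \<Rightarrow> (complex \<Rightarrow> complex) \<Rightarrow> bool" where
  "toeplitz_injective p a \<longleftrightarrow>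
    (\<forall>f\<in>Hp p. (\<forall>n\<ge>0. fourier_coeff (\<lambda>t. a t * f t) n = 0) \<longrightarrow> (AE t in \<mu>. f t = 0))"

definition toeplitz_surjective :: "real \<Rightarrow> (complex \<Rightarrow> complex) \<Rightarrow> bool" where
  "toeplitz_surjective p a \<longleftrightarrow>
    (\<forall>h\<in>Hp p. \<exists>f\<in>Hp p. \<forall>n\<ge>0. fourier_coeff (\<lambda>t. a t * f t) n = fourier_coeff h n)"

lemma toeplitz_injectiveD:
  assumes p: "1 < p" and a: "a \<in> Linf" and inj: "toeplitz_injective p a" and f: "f \<in> Hp p" and g: "g \<in> Hp p"
    and eq: "\<And>n. 0 \<le> n \<Longrightarrow> fourier_coeff (\<lambda>t. a t * f t) n = fourier_coeff (\<lambda>t. a t * g t) n"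
  shows "AE t in \<mu>. f t = g t"
proof -
  have "(\<lambda>t. f t - g t) \<in> Hp p" using p f g by (intro Hp_diff) auto
  moreover have "fourier_coeff (\<lambda>t. a t * (f t - g t)) n = 0" if "0 \<le> n" for n
    using eq[OF that] Linf_mult_integrable[OF p a f] Linf_mult_integrable[OF p a g]
    by (simp add: right_diff_distrib fourier_coeff_diff)
  ultimately have "AE t in \<mu>. f t - g t = 0" 
    using inj[unfolded toeplitz_injective_def, rule_format, of "\<lambda>t. f t - g t"] by simp
  then show ?thesis by simp
qed

text \<open>The open mapping theorem gives some preimage of \<open>toeplitz p a f\<close> of
  controlled norm; by injectivity it is \<open>f\<close> up to a null function.\<close>

lemma toeplitz_bounded_below:
  assumes p: "1 < p" and a: "a \<in> Linf" and inj: "toeplitz_injective p a" and surj: "toeplitz_surjective p a"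
  shows "\<exists>C\<ge>0. \<forall>f\<in>Hp p. Lp_norm p f \<le> C * Lp_norm p (toeplitz p a f)"
proof -
  have p1: "1 \<le> p" "0 < p" using p by auto
  obtain K where K: "0 \<le> K" "bounded_operator (Hp p) (Lp_norm p) (toeplitz p a) K"
    using toeplitz_bounded_operator[OF p a] by blast
  interpret bounded_operator "Hp p" "Lp_norm p" "toeplitz p a" K by fact
  have null: "Lp_norm p (\<lambda>t. f t - g t) = 0 \<longleftrightarrow> (AE t in \<mu>. f t = g t)" if "f \<in> Hp p" "g \<in> Hp p" for f g
    using that Lp_norm_eq_0_iff[OF p1(2) HpD(1)[OF Hp_diff[OF p1(1) that(1,2)]]] by simp
  have onto: "\<exists>x\<in>Hp p. Lp_norm p (\<lambda>t. y t - toeplitz p a x t) = 0" if y: "y \<in> Hp p" for y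
  proof -
    obtain x where x: "x \<in> Hp p" "\<forall>n\<ge>0. fourier_coeff (\<lambda>t. a t * x t) n = fourier_coeff y n"
      using surj y by (auto simp: toeplitz_surjective_def)
    then have "AE t in \<mu>. toeplitz p a x t = y t" using toeplitz_AE_eq_iff[OF p a x(1) y] by simp
    then have "Lp_norm p (\<lambda>t. toeplitz p a x t - y t) = 0" using null x(1) y maps by simp
    then show ?thesis using x(1) by (intro bexI[OF _ x(1)]) (simp only: norm_minus_commute[of y])
  qed
  obtain C where C: "0 \<le> C" "\<And>y. y \<in> Hp p \<Longrightarrow> \<exists>x\<in>Hp p. Lp_norm p x \<le> C * Lp_norm p y \<and> Lp_norm p (\<lambda>t. y t - toeplitz p a x t) = 0"
    using open_mapping[OF onto K(1)] by blast
  have "Lp_norm p f \<le> C * Lp_norm p (toeplitz p a f)" if f: "f \<in> Hp p" for f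
  proof -
    obtain x where x: "x \<in> Hp p" "Lp_norm p x \<le> C * Lp_norm p (toeplitz p a f)"
      "Lp_norm p (\<lambda>t. toeplitz p a f t - toeplitz p a x t) = 0"
      using C(2)[OF maps[OF f]] by blast
    have "AE t in \<mu>. toeplitz p a f t = toeplitz p a x t" using x f null maps by simp
    then have "AE t in \<mu>. f t = x t"
      using toeplitz_AE_eq_iff[OF p a f maps[OF x(1)]] fourier_coeff_toeplitz[OF p a x(1)]
      by (intro toeplitz_injectiveD[OF p a inj f x(1)]) simp
    then have "Lp_norm p f = Lp_norm p x" by (intro Lp_cong_AE(2) Hp_measurable[OF f] Hp_measurable[OF x(1)])
    then show ?thesis using x(2) by simp
  qed
  then show ?thesis using C(1) by blast
qed

text \<open>\<open>h = a * f\<close> has no coefficient of positive index, so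
  \<open>reflect h\<close> is in H^p. Matching gives \<open>a * reflect h = reflect f\<close>, whose
  only possible coefficient of index at least 0 is \<open>c\<close> at 0, just as for
  \<open>a * (c * f)\<close>. Injectivity yields \<open>reflect h = c * f\<close>; reflecting and
  comparing the coefficients of index 0 gives \<open>1 = c * c\<close>.\<close>

lemma matching_normalized_solution:
  assumes p: "1 < p" and a: "a \<in> Linf" "matching a" and inj: "toeplitz_injective p a" and f: "f \<in> Hp p"
    and one: "\<And>n. 0 \<le> n \<Longrightarrow> fourier_coeff (\<lambda>t. a t * f t) n = (if n = 0 then 1 else 0)"
  shows "(fourier_coeff f 0)\<^sup>2 = 1" "AE t in \<mu>. a t * f t = fourier_coeff f 0 * reflect f t"
proof -
  have p1: "1 \<le> p" "0 < p" using p by auto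
  define c h where "c = fourier_coeff f 0" and "h = (\<lambda>t. a t * f t)"
  have h: "h \<in> Lp p" unfolding h_def by (rule Linf_mult_Hp[OF p a(1) f])
  note [measurable] = LinfD(1)[OF a(1)] Hp_measurable[OF f] LpD(1)[OF h]
  have "h \<in> Hp_bar p" using h one by (simp add: Hp_bar_def h_def)
  then have rh: "reflect h \<in> Hp p" by (rule Hp_bar_reflect)
  have AE: "AE t in \<mu>. a t * reflect h t = reflect f t"
    using a(2) unfolding matching_def
    by eventually_elim (simp add: h_def reflect_def mult.assoc[symmetric])
  have "AE t in \<mu>. reflect h t = c * f t"
  proof (rule toeplitz_injectiveD[OF p a(1) inj rh Hp_scale[OF f]])
    fix n :: int assume n: "0 \<le> n"
    have "fourier_coeff (\<lambda>t. a t * reflect h t) n = fourier_coeff (reflect f) n"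
      by (rule fourier_coeff_cong_AE[OF _ _ AE]) measurable
    also have "\<dots> = fourier_coeff f (- n)" by (rule fourier_coeff_reflect) measurable
    also have "\<dots> = (if n = 0 then c else 0)" using n HpD(2)[OF f, of "- n"] by (simp add: c_def)
    also have "\<dots> = fourier_coeff (\<lambda>t. a t * (c * f t)) n"
      using one[OF n] fourier_coeff_scale[of c "\<lambda>t. a t * f t" n] by (simp add: mult.left_commute)
    finally show "fourier_coeff (\<lambda>t. a t * reflect h t) n = fourier_coeff (\<lambda>t. a t * (c * f t)) n" .
  qed
  then have "AE t in \<mu>. reflect (reflect h) t = reflect (\<lambda>t. c * f t) t" by (rule AE_reflect)
  then have eq: "AE t in \<mu>. h t = c * reflect f t" by (simp add: reflect_def)
  then show "AE t in \<mu>. a t * f t = fourier_coeff f 0 * reflect f t" by (simp add: h_def c_def)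
  have "fourier_coeff h 0 = fourier_coeff (\<lambda>t. c * reflect f t) 0"
    by (rule fourier_coeff_cong_AE[OF _ _ eq]) measurable
  also have "\<dots> = c * c" by (simp add: fourier_coeff_scale fourier_coeff_reflect c_def)
  finally show "(fourier_coeff f 0)\<^sup>2 = 1" using one[of 0] by (simp add: h_def c_def power2_eq_square)
qed

text \<open>Test with \<open>\<phi> = cnj h * norm h powr (q - 2)\<close>, for which
  \<open>\<phi> * h\<close> and \<open>norm \<phi> powr p\<close> are both
  \<open>norm h powr q\<close>. Boundedness of \<open>h\<close> makes the integral \<open>I\<close>
  of this power finite in advance, so the resulting inequality can be divided by
  \<open>I powr (1 / p)\<close>.\<close>

lemma converse_Hoelder:
  assumes p: "1 < p" "1 < q" "1 / p + 1 / q = 1" and D: "0 \<le> D"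
    and h: "h \<in> borel_measurable \<mu>" "\<And>t. norm (h t) \<le> C"
    and le: "\<And>\<phi> B. \<phi> \<in> borel_measurable \<mu> \<Longrightarrow> (\<And>t. norm (\<phi> t) \<le> B) \<Longrightarrow>
      norm (LINT t|\<mu>. \<phi> t * h t) \<le> D * Lp_norm p \<phi>"
  shows "h \<in> Lp q" "Lp_norm q h \<le> D"
proof -
  note [measurable] = h(1)
  have C: "0 \<le> C" using h(2)[of 0] norm_ge_zero order_trans by blast
  show hq: "h \<in> Lp q" using p h C by (intro bounded_in_Lp(1)[where C = C]) auto
  define \<phi> where "\<phi> = (\<lambda>t. cnj (h t) * of_real (norm (h t) powr (q - 2)))"
  have [measurable]: "\<phi> \<in> borel_measurable \<mu>" unfolding \<phi>_def by measurable
  have n\<phi>: "norm (\<phi> t) = norm (h t) powr (q - 1)" for t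
  proof (cases "h t = 0")
    case False
    then have "norm (h t) powr (q - 1) = norm (h t) powr 1 * norm (h t) powr (q - 2)"
      by (simp only: powr_add[symmetric]) simp
    then show ?thesis using False by (simp add: \<phi>_def norm_mult)
  qed (use p in \<open>simp add: \<phi>_def\<close>)
  have \<phi>h: "\<phi> t * h t = of_real (norm (h t) powr q)" for t
  proof (cases "h t = 0")
    case False
    have "\<phi> t * h t = of_real ((norm (h t))\<^sup>2 * norm (h t) powr (q - 2))"
      by (simp only: \<phi>_def of_real_mult complex_norm_square mult_ac)
    also have "(norm (h t))\<^sup>2 * norm (h t) powr (q - 2) = norm (h t) powr (2 + (q - 2))"
      using False powr_add[of "norm (h t)" 2 "q - 2"] by simp
    finally show ?thesis by simp
  qed (use p in \<open>simp add: \<phi>_def\<close>)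
  define I where "I = (LINT t|\<mu>. norm (h t) powr q)"
  have I: "0 \<le> I" by (simp add: I_def)
  have pq: "(q - 1) * p = q" using p by (simp add: field_simps)
  have "norm (LINT t|\<mu>. \<phi> t * h t) \<le> D * Lp_norm p \<phi>"
  proof (rule le)
    show "norm (\<phi> t) \<le> C powr (q - 1)" for t
      unfolding n\<phi> using h(2) p by (intro powr_mono2) auto
  qed measurable
  also have "(LINT t|\<mu>. \<phi> t * h t) = of_real I" unfolding \<phi>h I_def by simp
  also have "Lp_norm p \<phi> = I powr (1 / p)"
    unfolding Lp_norm_def n\<phi> I_def by (simp add: powr_powr pq)
  finally have le_I: "I \<le> D * I powr (1 / p)" using I by simp
  have "I powr (1 / q) \<le> D"
  proof (cases "I = 0")
    case False
    then have I0: "0 < I" using I by simp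
    have "I powr (1 / q) * I powr (1 / p) = I powr 1"
      using p(3) by (simp add: powr_add[symmetric] add.commute)
    then have "I powr (1 / q) * I powr (1 / p) \<le> D * I powr (1 / p)" using le_I I0 by simp
    then show ?thesis using I0 by simp
  qed (use D in simp)
  then show "Lp_norm q h \<le> D" by (simp add: Lp_norm_def I_def)
qed

section \<open>Wiener--Hopf factorization of matching functions\<close>

lemma conj_exponentD:
  assumes "1 < p"
  shows "1 < conj_exponent p" "1 / p + 1 / conj_exponent p = 1" "1 / conj_exponent p + 1 / p = 1"
  using conj_exponent[OF assms] assms by (simp_all add: conj_exponent_def)

locale invertible_matching =
  fixes p q :: real and a f :: "complex \<Rightarrow> complex"
  assumes p: "1 < p" and q_def: "q = conj_exponent p"
    and a: "a \<in> Linf" "matching a"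
    and inj: "toeplitz_injective p a" and surj: "toeplitz_surjective p a"
    and f: "f \<in> Hp p"
    and one: "\<And>n. 0 \<le> n \<Longrightarrow> fourier_coeff (\<lambda>t. a t * f t) n = (if n = 0 then 1 else 0)"
begin

lemma exponents: "1 \<le> p" "0 < p" "1 < q" "0 < q" "1 / p + 1 / q = 1" "1 / q + 1 / p = 1"
  using p conj_exponentD[OF p] by (simp_all add: q_def)

definition c where "c = fourier_coeff f 0"

lemma c_square: "c * c = 1" and AE_matching: "AE t in \<mu>. a t * f t = c * reflect f t"
  using matching_normalized_solution[OF p a inj f one] by (simp_all add: c_def power2_eq_square)

lemma c_cases: "c = 1 \<or> c = -1"
  using c_square by (simp add: square_eq_1_iff)

lemma f_measurable [measurable]: "f \<in> borel_measurable \<mu>"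
  by (rule Hp_measurable[OF f])

text \<open>
  The functional \<open>\<psi> \<mapsto> x(0)\<close>, where \<open>T(a) x = P (reflect \<psi>)\<close>, is bounded on \<open>L\<^sup>p\<close>. It maps \<open>f u\<close> to
  the integral of \<open>u\<close>, so it is represented by \<open>1 / f\<close>.
\<close>

lemma functional_bounded:
  "\<exists>D\<ge>0. \<forall>\<psi>\<in>Lp p. \<forall>x\<in>Hp p. (\<forall>n\<ge>0. fourier_coeff (\<lambda>t. a t * x t) n = fourier_coeff \<psi> (- n)) \<longrightarrow>
    norm (fourier_coeff x 0) \<le> D * Lp_norm p \<psi>"
proof -
  obtain C where C: "0 \<le> C" "\<And>x. x \<in> Hp p \<Longrightarrow> Lp_norm p x \<le> C * Lp_norm p (toeplitz p a x)"
    using toeplitz_bounded_below[OF p a(1) inj surj] by blast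
  obtain K where K: "0 \<le> K" "\<And>f. f \<in> Lp p \<Longrightarrow> Lp_norm p (riesz_proj p f) \<le> K * Lp_norm p f"
    using riesz_proj_bounded[OF p] by blast
  have "norm (fourier_coeff x 0) \<le> C * K * Lp_norm p \<psi>"
    if \<psi>: "\<psi> \<in> Lp p" and x: "x \<in> Hp p"
      and eq: "\<And>n. 0 \<le> n \<Longrightarrow> fourier_coeff (\<lambda>t. a t * x t) n = fourier_coeff \<psi> (- n)" for \<psi> x
  proof -
    note r\<psi> = Lp_norm_reflect[OF \<psi>]
    have "AE t in \<mu>. toeplitz p a x t = riesz_proj p (reflect \<psi>) t"
      using eq fourier_coeff_reflect[OF LpD(1)[OF \<psi>]] riesz_proj(2)[OF p r\<psi>(1)]
      by (subst toeplitz_AE_eq_iff[OF p a(1) x riesz_proj(1)[OF p r\<psi>(1)]]) simp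
    then have "Lp_norm p (toeplitz p a x) = Lp_norm p (riesz_proj p (reflect \<psi>))"
      by (intro Lp_cong_AE(2) Hp_measurable[OF toeplitz_in_Hp[OF p a(1) x]] Hp_measurable[OF riesz_proj(1)[OF p r\<psi>(1)]])
    also have "\<dots> \<le> K * Lp_norm p \<psi>" using K(2)[OF r\<psi>(1)] r\<psi>(2) by simp
    finally have "Lp_norm p x \<le> C * (K * Lp_norm p \<psi>)"
      using C(2)[OF x] C(1) by (meson mult_left_mono order_trans)
    then show ?thesis
      using norm_fourier_coeff_le_Lp[OF exponents(1) HpD(1)[OF x], of 0] by (simp add: mult.assoc)
  qed
  then show ?thesis using C(1) K(1) by (intro exI[of _ "C * K"]) auto
qed

text \<open>Linearity reduces the equation to monomials, where the solution is explicit; bounded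
  functions in place of \<open>u\<close> are reached later by approximation.\<close>

lemma functional_trig:
  assumes "trig u"
  shows "\<exists>x\<in>Hp p. (\<forall>n\<ge>0. fourier_coeff (\<lambda>t. a t * x t) n = fourier_coeff (\<lambda>t. f t * u t) (- n)) \<and>
    fourier_coeff x 0 = (LINT t|\<mu>. u t)"
  using assms
proof (induction rule: trig.induct)
  case (trig_monom d k)
  have rhs: "fourier_coeff (\<lambda>t. f t * (d * t powi k)) (- n) = d * fourier_coeff f (- n - k)" for n
    using fourier_coeff_powi_mult[of k "\<lambda>t. d * f t" "- n"]
    by (simp add: fourier_coeff_scale mult_ac)
  have int: "(LINT t|\<mu>. d * t powi k) = (if k = 0 then d else 0)"
    by (simp add: integral_powi_circle)
  show ?case
  proof (cases "k \<le> 0")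
    case True
    \<comment> \<open>\<open>a * f = c * reflect f\<close> and \<open>c * c = 1\<close> turn
      \<open>a * x\<close> into the reflection of \<open>f t * (d * t powi k)\<close>, so this
      \<open>x\<close> is the solution.\<close>
    define x where "x = (\<lambda>t. (d * c) * (t powi (- k) * f t))"
    have x: "x \<in> Hp p" unfolding x_def using True exponents by (intro Hp_scale Hp_powi_mult f) auto
    have "fourier_coeff (\<lambda>t. a t * x t) n = d * fourier_coeff f (- n - k)" if "0 \<le> n" for n
    proof -
      have "fourier_coeff (\<lambda>t. a t * x t) n = fourier_coeff (\<lambda>t. d * (t powi (- k) * reflect f t)) n"
      proof (rule fourier_coeff_cong_AE)
        show "AE t in \<mu>. a t * x t = d * (t powi (- k) * reflect f t)"
          using AE_matching
        proof eventually_elim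
          case (elim t)
          have "a t * x t = d * c * (t powi (- k)) * (a t * f t)" by (simp add: x_def mult_ac)
          also have "\<dots> = d * (c * c) * (t powi (- k) * reflect f t)" by (simp only: elim mult_ac)
          finally show ?case by (simp only: c_square mult_1_right)
        qed
        show "(\<lambda>t. a t * x t) \<in> borel_measurable \<mu>" using LpD(1)[OF Linf_mult_Hp[OF p a(1) x]] .
      qed measurable
      also have "\<dots> = d * fourier_coeff (reflect f) (n + k)"
        using fourier_coeff_powi_mult[of "- k" "reflect f" n] by (simp only: fourier_coeff_scale) simp
      also have "fourier_coeff (reflect f) (n + k) = fourier_coeff f (- n - k)"
        using fourier_coeff_reflect[OF f_measurable, of "n + k"] by simp
      finally show ?thesis .
    qed
    moreover have "fourier_coeff x 0 = (if k = 0 then d else 0)"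
      using True c_square HpD(2)[OF f, of k] fourier_coeff_powi_mult[of "- k" f 0]
      by (cases "k = 0") (auto simp: x_def fourier_coeff_scale c_def[symmetric] mult.assoc)
    ultimately show ?thesis using x unfolding rhs int by blast
  next
    \<comment> \<open>For \<open>k > 0\<close> the coefficients of \<open>f t * t powi k\<close> of
      index at most 0 all vanish, and so does the mean of the monomial: the zero function
      serves.\<close>
    case False
    then show ?thesis
      unfolding rhs int using HpD(2)[OF f] by (intro bexI[OF _ Hp_zero]) auto
  qed
next
  case (trig_add u v)
  then obtain x y where x: "x \<in> Hp p" "\<forall>n\<ge>0. fourier_coeff (\<lambda>t. a t * x t) n = fourier_coeff (\<lambda>t. f t * u t) (- n)"
      "fourier_coeff x 0 = (LINT t|\<mu>. u t)"
    and y: "y \<in> Hp p" "\<forall>n\<ge>0. fourier_coeff (\<lambda>t. a t * y t) n = fourier_coeff (\<lambda>t. f t * v t) (- n)"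
      "fourier_coeff y 0 = (LINT t|\<mu>. v t)"
    by blast
  have fi: "integrable \<mu> (\<lambda>t. f t * w t)" if w: "trig w" for w
  proof -
    obtain B where "\<And>t. t \<in> circle \<Longrightarrow> norm (w t) \<le> B"
      using continuous_on_circle_bounded[OF trig_continuous[OF w]] by metis
    then show ?thesis by (rule integrable_mult_bounded[OF Hp_integrable[OF exponents(1) f] trig_measurable[OF w]])
  qed
  have ui: "integrable \<mu> w" if w: "trig w" for w
    by (rule Lp_integrable(1)[OF exponents(1) trig_in_Lp[OF exponents(2) w]])
  have 1: "(\<lambda>t. x t + y t) \<in> Hp p" by (intro Hp_add exponents x y)
  have 2: "fourier_coeff (\<lambda>t. a t * (x t + y t)) n = fourier_coeff (\<lambda>t. f t * (u t + v t)) (- n)" if "0 \<le> n" for n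
    using x(2) y(2) that Linf_mult_integrable[OF p a(1) x(1)] Linf_mult_integrable[OF p a(1) y(1)]
      fi[OF trig_add(1)] fi[OF trig_add(2)]
    by (simp add: distrib_left fourier_coeff_add)
  have 3: "fourier_coeff (\<lambda>t. x t + y t) 0 = (LINT t|\<mu>. u t + v t)"
    using x(3) y(3) ui[OF trig_add(1)] ui[OF trig_add(2)] Hp_integrable[OF exponents(1)] x(1) y(1)
    by (simp add: fourier_coeff_add)
  show ?case using 2 3 by (intro bexI[OF _ 1] conjI allI impI)
next
  case (trig_cong u v)
  have "fourier_coeff (\<lambda>t. f t * v t) n = fourier_coeff (\<lambda>t. f t * u t) n" for n
    using trig_cong(2) by (intro fourier_coeff_cong_circle) simp
  moreover have "(LINT t|\<mu>. v t) = (LINT t|\<mu>. u t)"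
    using trig_cong(2) by (intro Bochner_Integration.integral_cong) auto
  ultimately show ?case using trig_cong(3) by simp
qed

text \<open>Nonzero \<open>\<theta>\<close> are needed only to see that the coefficients of \<open>1 / f\<close> of negative index vanish.\<close>

lemma integral_bound:
  "\<exists>D\<ge>0. \<forall>\<theta>\<in>Lp p. \<forall>\<psi>\<in>borel_measurable \<mu>. \<forall>B. (\<forall>n\<ge>0. fourier_coeff \<theta> (- n) = 0) \<longrightarrow>
    (\<forall>t. norm (\<psi> t) \<le> B) \<longrightarrow> norm (LINT t|\<mu>. \<psi> t) \<le> D * Lp_norm p (\<lambda>t. f t * \<psi> t - \<theta> t)"
proof -
  obtain D where D: "0 \<le> D" "\<And>\<psi> x. \<psi> \<in> Lp p \<Longrightarrow> x \<in> Hp p \<Longrightarrow>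
    \<forall>n\<ge>0. fourier_coeff (\<lambda>t. a t * x t) n = fourier_coeff \<psi> (- n) \<Longrightarrow>
    norm (fourier_coeff x 0) \<le> D * Lp_norm p \<psi>"
    using functional_bounded by blast
  have "norm (LINT t|\<mu>. \<psi> t) \<le> D * Lp_norm p (\<lambda>t. f t * \<psi> t - \<theta> t)"
    if \<theta>: "\<theta> \<in> Lp p" "\<And>n. 0 \<le> n \<Longrightarrow> fourier_coeff \<theta> (- n) = 0"
      and \<psi>: "\<psi> \<in> borel_measurable \<mu>" "\<And>t. norm (\<psi> t) \<le> B" for \<theta> \<psi> B
  proof -
    \<comment> \<open>\<open>E\<close> is positive even if \<open>B\<close> is not, and division by
      it brings \<open>\<psi>\<close> into the unit disc.\<close>
    define E where "E = max B 1"
    have E: "0 < E" by (simp add: E_def)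
    define \<phi> where "\<phi> = (\<lambda>t. \<psi> t / of_real E)"
    note [measurable] = \<psi>(1) LpD(1)[OF \<theta>(1)]
    have \<phi>: "\<phi> \<in> borel_measurable \<mu>" unfolding \<phi>_def by measurable
    have "norm (\<phi> t) \<le> 1" for t
      using \<psi>(2)[of t] E by (simp add: \<phi>_def norm_divide E_def)
    from trig_AE_approx[OF \<phi> this] obtain u where u: "\<And>k. trig (u k)"
      "\<And>k t. t \<in> circle \<Longrightarrow> norm (u k t) \<le> 2" "AE t in \<mu>. (\<lambda>k. u k t) \<longlonglongrightarrow> \<phi> t"
      by blast
    define v where "v = (\<lambda>k t. of_real E * u k t)"
    have v: "trig (v k)" for k unfolding v_def by (intro trig_mult trig_const u)
    have vb: "norm (v k t) \<le> 2 * E" if "t \<in> circle" for k t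
      using u(2)[OF that, of k] E by (simp add: v_def norm_mult mult.commute)
    have v_lim: "AE t in \<mu>. (\<lambda>k. v k t) \<longlonglongrightarrow> \<psi> t"
      using u(3)
    proof eventually_elim
      case (elim t)
      have "(\<lambda>k. of_real E * u k t) \<longlonglongrightarrow> of_real E * \<phi> t" by (intro tendsto_intros elim)
      then show ?case using E by (simp add: v_def \<phi>_def)
    qed
    note [measurable] = trig_measurable[OF v]
    have mult: "(\<lambda>t. f t * w t) \<in> Lp p" if w: "w \<in> borel_measurable \<mu>" "\<And>t. t \<in> circle \<Longrightarrow> norm (w t) \<le> 2 * E" for w
    proof (rule Lp_dominated(1)[OF exponents(2) HpD(1)[OF f]])
      show "AE t in \<mu>. norm (f t * w t) \<le> (2 * E) * norm (f t)"
      proof (rule AE_circle)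
        fix t :: complex assume "t \<in> circle"
        from mult_left_mono[OF w(2)[OF this] norm_ge_zero[of "f t"]]
        show "norm (f t * w t) \<le> (2 * E) * norm (f t)" by (simp add: norm_mult mult_ac)
      qed
    qed (use w E in auto)
    have \<psi>b: "norm (\<psi> t) \<le> 2 * E" for t using \<psi>(2)[of t] E by (simp add: E_def)
    have fv: "(\<lambda>t. f t * v k t) \<in> Lp p" for k by (rule mult[OF trig_measurable[OF v] vb])
    have f\<psi>: "(\<lambda>t. f t * \<psi> t) \<in> Lp p" by (rule mult[OF \<psi>(1) \<psi>b])
    have bound: "norm (LINT t|\<mu>. v k t) \<le> D * Lp_norm p (\<lambda>t. f t * v k t - f t * \<psi> t) + D * Lp_norm p (\<lambda>t. f t * \<psi> t - \<theta> t)" for k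
    proof -
      obtain x where x: "x \<in> Hp p" "\<forall>n\<ge>0. fourier_coeff (\<lambda>t. a t * x t) n = fourier_coeff (\<lambda>t. f t * v k t) (- n)"
        "fourier_coeff x 0 = (LINT t|\<mu>. v k t)"
        using functional_trig[OF v[of k]] by blast
      \<comment> \<open>\<open>\<theta>\<close> has coefficients of positive index only, while the
        equation for \<open>x\<close> involves those of index at most 0; subtracting
        \<open>\<theta>\<close> therefore leaves the equation intact.\<close>
      have "\<forall>n\<ge>0. fourier_coeff (\<lambda>t. a t * x t) n = fourier_coeff (\<lambda>t. f t * v k t - \<theta> t) (- n)"
        using x(2) \<theta>(2) Lp_integrable(1)[OF exponents(1) fv] Lp_integrable(1)[OF exponents(1) \<theta>(1)]
        by (simp add: fourier_coeff_diff)
      from D(2)[OF Lp_diff(1)[OF exponents(1) fv \<theta>(1)] x(1) this]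
      have "norm (LINT t|\<mu>. v k t) \<le> D * Lp_norm p (\<lambda>t. f t * v k t - \<theta> t)" by (simp add: x(3))
      also have "\<dots> \<le> D * (Lp_norm p (\<lambda>t. f t * v k t - f t * \<psi> t) + Lp_norm p (\<lambda>t. f t * \<psi> t - \<theta> t))"
        by (intro mult_left_mono[OF _ D(1)] Lp_norm_triangle_diff exponents(1) fv f\<psi> \<theta>(1))
      finally show ?thesis by (simp add: distrib_left)
    qed
    have "(\<lambda>k. Lp_norm p (\<lambda>t. f t * v k t - f t * \<psi> t)) \<longlonglongrightarrow> 0"
    proof (rule Lp_dominated_convergence[OF exponents(2) HpD(1)[OF f]])
      show "AE t in \<mu>. norm (f t * v k t - f t * \<psi> t) \<le> (4 * E) * norm (f t)" for k
      proof (rule AE_circle)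
        fix t :: complex assume "t \<in> circle"
        then have "norm (v k t - \<psi> t) \<le> 4 * E"
          using norm_triangle_ineq4[of "v k t" "\<psi> t"] vb[of t k] \<psi>b[of t] by linarith
        from mult_left_mono[OF this norm_ge_zero[of "f t"]]
        moreover have "norm (f t * v k t - f t * \<psi> t) = norm (f t) * norm (v k t - \<psi> t)"
          by (simp only: right_diff_distrib[symmetric] norm_mult)
        ultimately show "norm (f t * v k t - f t * \<psi> t) \<le> (4 * E) * norm (f t)"
          by (simp add: mult.commute)
      qed
      show "AE t in \<mu>. (\<lambda>k. f t * v k t - f t * \<psi> t) \<longlonglongrightarrow> 0"
        using v_lim
      proof eventually_elim
        case (elim t)
        have "(\<lambda>k. f t * v k t - f t * \<psi> t) \<longlonglongrightarrow> f t * \<psi> t - f t * \<psi> t" by (intro tendsto_intros elim)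
        then show ?case by simp
      qed
    qed measurable
    then have rhs: "(\<lambda>k. D * Lp_norm p (\<lambda>t. f t * v k t - f t * \<psi> t) + D * Lp_norm p (\<lambda>t. f t * \<psi> t - \<theta> t))
        \<longlonglongrightarrow> D * 0 + D * Lp_norm p (\<lambda>t. f t * \<psi> t - \<theta> t)"
      by (intro tendsto_intros)
    have "(\<lambda>k. LINT t|\<mu>. v k t) \<longlonglongrightarrow> (LINT t|\<mu>. \<psi> t)"
    proof (rule integral_dominated_convergence[where w = "\<lambda>_. 2 * E"])
      show "AE t in \<mu>. norm (v k t) \<le> 2 * E" for k by (rule AE_circle) (rule vb)
    qed (use v_lim in auto)
    then have lhs: "(\<lambda>k. norm (LINT t|\<mu>. v k t)) \<longlonglongrightarrow> norm (LINT t|\<mu>. \<psi> t)" by (rule tendsto_norm)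
    show ?thesis using LIMSEQ_le[OF lhs rhs] bound by auto
  qed
  then show ?thesis using D(1) by blast
qed

text \<open>The integral bound is tested three times: with the indicator of the zero set of
  \<open>f\<close>, for which the right side is 0; with truncations \<open>h k\<close> of
  \<open>1 / f\<close> times an arbitrary \<open>\<phi>\<close>, where
  \<open>norm (f * h k) \<le> 1\<close> gives by duality a bound independent of \<open>k\<close>;
  and with \<open>\<theta> = t powi (- n)\<close>, where
  \<open>f * \<theta> * h k - \<theta>\<close> tends to 0.\<close>

lemma AE_nonzero: "AE t in \<mu>. f t \<noteq> 0"
  and inverse_in_Hq: "(\<lambda>t. inverse (f t)) \<in> Hp q"
proof -
  obtain D where D: "0 \<le> D" "\<And>\<theta> \<psi> B. \<theta> \<in> Lp p \<Longrightarrow> \<psi> \<in> borel_measurable \<mu> \<Longrightarrow>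
    \<forall>n\<ge>0. fourier_coeff \<theta> (- n) = 0 \<Longrightarrow> \<forall>t. norm (\<psi> t) \<le> B \<Longrightarrow>
    norm (LINT t|\<mu>. \<psi> t) \<le> D * Lp_norm p (\<lambda>t. f t * \<psi> t - \<theta> t)"
    using integral_bound by blast
  define \<zeta> where "\<zeta> = (\<lambda>t. if f t = 0 then 1 else 0 :: complex)"
  have [measurable]: "\<zeta> \<in> borel_measurable \<mu>" unfolding \<zeta>_def by measurable
  have "norm (LINT t|\<mu>. \<zeta> t) \<le> D * Lp_norm p (\<lambda>t. f t * \<zeta> t - 0)"
    by (rule D(2)[where B = 1]) (auto simp: \<zeta>_def)
  also have "(\<lambda>t. f t * \<zeta> t - 0) = (\<lambda>t. 0)" by (auto simp: \<zeta>_def)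
  finally have \<zeta>0: "(LINT t|\<mu>. \<zeta> t) = 0" using exponents by simp
  have "\<zeta> = (\<lambda>t. complex_of_real (if f t = 0 then 1 else 0))" by (auto simp: \<zeta>_def)
  with \<zeta>0 have "(LINT t|\<mu>. (if f t = 0 then 1 else 0 :: real)) = 0"
    by (metis (no_types) integral_complex_of_real of_real_eq_0_iff)
  moreover have "integrable \<mu> (\<lambda>t. if f t = 0 then 1 else 0 :: real)"
    by (rule circle.integrable_const_bound[where B = 1]) auto
  ultimately have "AE t in \<mu>. (if f t = 0 then 1 else 0 :: real) = 0"
    by (subst (asm) integral_nonneg_eq_0_iff_AE) auto
  then show nz: "AE t in \<mu>. f t \<noteq> 0" by eventually_elim (auto split: if_splits)

  define h where "h = (\<lambda>k::nat. \<lambda>t. if norm (f t) \<ge> inverse (real (Suc k)) then inverse (f t) else 0)"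
  have h_meas [measurable]: "h k \<in> borel_measurable \<mu>" for k unfolding h_def by measurable
  have hb: "norm (h k t) \<le> real (Suc k)" for k t
  proof (cases "norm (f t) \<ge> inverse (real (Suc k))")
    case True
    then have "inverse (norm (f t)) \<le> inverse (inverse (real (Suc k)))"
      by (intro le_imp_inverse_le) auto
    then show ?thesis using True by (simp add: h_def norm_inverse)
  qed (simp add: h_def)
  have fh: "norm (f t * h k t) \<le> 1" for k t
    by (cases "f t = 0") (auto simp: h_def norm_mult norm_inverse)
  have hL: "h k \<in> Lp q \<and> Lp_norm q (h k) \<le> D" for k
  proof -
    have "norm (LINT t|\<mu>. \<phi> t * h k t) \<le> D * Lp_norm p \<phi>"
      if \<phi>: "\<phi> \<in> borel_measurable \<mu>" "\<And>t. norm (\<phi> t) \<le> B" for \<phi> B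
    proof -
      note [measurable] = \<phi>(1)
      have B: "0 \<le> B" using norm_ge_zero \<phi>(2)[of 0] by (rule order_trans)
      have "norm (LINT t|\<mu>. \<phi> t * h k t) \<le> D * Lp_norm p (\<lambda>t. f t * (\<phi> t * h k t) - 0)"
      proof (rule D(2)[where B = "B * real (Suc k)"])
        show "\<forall>t. norm (\<phi> t * h k t) \<le> B * real (Suc k)"
          using mult_mono[OF \<phi>(2) hb B] by (simp add: norm_mult del: of_nat_Suc)
      qed auto
      also have "\<dots> \<le> D * (1 * Lp_norm p \<phi>)"
      proof (rule mult_left_mono[OF Lp_dominated(2)[OF exponents(2)] D(1)])
        show "\<phi> \<in> Lp p" using \<phi> B exponents by (intro bounded_in_Lp(1)[where C = B]) auto
        show "AE t in \<mu>. norm (f t * (\<phi> t * h k t) - 0) \<le> 1 * norm (\<phi> t)"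
        proof (rule AE_I2)
          fix t
          have "norm (f t * (\<phi> t * h k t)) = norm (f t * h k t) * norm (\<phi> t)" by (simp add: norm_mult)
          also have "\<dots> \<le> 1 * norm (\<phi> t)" using fh by (intro mult_right_mono) auto
          finally show "norm (f t * (\<phi> t * h k t) - 0) \<le> 1 * norm (\<phi> t)" by simp
        qed
      qed auto
      finally show ?thesis by simp
    qed
    note * = converse_Hoelder[where h = "h k" and C = "real (Suc k)", OF p exponents(3,5) D(1) _ hb this]
    show ?thesis by (intro conjI * h_meas)
  qed
  have h_lim: "AE t in \<mu>. (\<lambda>k. h k t) \<longlonglongrightarrow> inverse (f t)"
    using nz
  proof eventually_elim
    case (elim t)
    then have "0 < norm (f t)" by simp
    then obtain N where N: "inverse (real (Suc N)) < norm (f t)" using reals_Archimedean by blast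
    have "\<forall>\<^sub>F k in sequentially. h k t = inverse (f t)"
    proof (rule eventually_sequentiallyI)
      fix k assume "N \<le> k"
      then have "inverse (real (Suc k)) \<le> inverse (real (Suc N))" by (intro le_imp_inverse_le) auto
      with N have "inverse (real (Suc k)) \<le> norm (f t)" by linarith
      then show "h k t = inverse (f t)" by (simp only: h_def if_True)
    qed
    then show ?case by (rule tendsto_eventually)
  qed
  have inv: "(\<lambda>t. inverse (f t)) \<in> Lp q"
    by (rule Lp_limit(1)[OF exponents(4) D(1) conjunct1[OF hL] conjunct2[OF hL] _ h_lim]) measurable
  show "(\<lambda>t. inverse (f t)) \<in> Hp q"
  proof (rule HpI[OF inv])
    fix n :: int assume n: "n < 0"
    define \<theta> where "\<theta> = (\<lambda>t::complex. t powi (- n))"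
    have \<theta>: "trig \<theta>" unfolding \<theta>_def using trig_monom[of 1 "- n"] by simp
    have \<theta>L: "\<theta> \<in> Lp p" by (rule trig_in_Lp[OF exponents(2) \<theta>])
    have \<theta>1: "norm (\<theta> t) = 1" if "t \<in> circle" for t using that unfolding \<theta>_def by (rule norm_powi_circle)
    note [measurable] = trig_measurable[OF \<theta>]
    \<comment> \<open>The test functions must be bounded at every point of the plane, so the
      monomial is set to 0 outside the circle.\<close>
    define \<theta>' where "\<theta>' = (\<lambda>t. if t \<in> circle then \<theta> t else 0)"
    have eq\<theta>: "AE t in \<mu>. \<theta>' t = \<theta> t" by (rule AE_circle) (simp add: \<theta>'_def)
    have [measurable]: "\<theta>' \<in> borel_measurable \<mu>"
      using measurable_cong[of \<mu> \<theta>' \<theta>] trig_measurable[OF \<theta>] by (simp add: \<theta>'_def)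
    have le: "norm (LINT t|\<mu>. \<theta>' t * h k t) \<le> D * Lp_norm p (\<lambda>t. f t * (\<theta>' t * h k t) - \<theta>' t)" for k
    proof (rule D(2)[where B = "real (Suc k)"])
      show "\<theta>' \<in> Lp p" using Lp_cong_AE(1)[OF _ _ eq\<theta>] \<theta>L by simp
      have "fourier_coeff \<theta>' m = fourier_coeff \<theta> m" for m by (rule fourier_coeff_cong_AE[OF _ _ eq\<theta>]) measurable
      then show "\<forall>m\<ge>0. fourier_coeff \<theta>' (- m) = 0"
        using n by (simp add: \<theta>_def fourier_coeff_powi)
      show "\<forall>t. norm (\<theta>' t * h k t) \<le> real (Suc k)"
        using hb \<theta>1 by (simp add: \<theta>'_def norm_mult del: of_nat_Suc mem_sphere_0)
    qed measurable
    have lim: "(\<lambda>k. D * Lp_norm p (\<lambda>t. f t * (\<theta>' t * h k t) - \<theta>' t)) \<longlonglongrightarrow> D * 0"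
    proof (intro tendsto_intros Lp_dominated_convergence[OF exponents(2) const_in_Lp[of 1]])
      show "AE t in \<mu>. norm (f t * (\<theta>' t * h k t) - \<theta>' t) \<le> 2 * norm (1 :: complex)" for k
      proof (rule AE_circle)
        fix t :: complex assume t: "t \<in> circle"
        have "norm (f t * (\<theta>' t * h k t) - \<theta>' t) \<le> norm (f t * h k t) * norm (\<theta>' t) + norm (\<theta>' t)"
          using norm_triangle_ineq4[of "f t * (\<theta>' t * h k t)" "\<theta>' t"] by (simp add: norm_mult mult_ac)
        then show "norm (f t * (\<theta>' t * h k t) - \<theta>' t) \<le> 2 * norm (1 :: complex)"
          using \<theta>1[OF t] t fh[of t k] by (simp add: \<theta>'_def)
      qed
      show "AE t in \<mu>. (\<lambda>k. f t * (\<theta>' t * h k t) - \<theta>' t) \<longlonglongrightarrow> 0"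
        using h_lim nz
      proof eventually_elim
        case (elim t)
        have "(\<lambda>k. f t * (\<theta>' t * h k t) - \<theta>' t) \<longlonglongrightarrow> f t * (\<theta>' t * inverse (f t)) - \<theta>' t"
          by (intro tendsto_intros elim(1))
        then show ?case using elim(2) by (simp add: field_simps)
      qed
    qed measurable
    have lim0: "(\<lambda>k. LINT t|\<mu>. \<theta>' t * h k t) \<longlonglongrightarrow> 0"
      by (rule Lim_null_comparison[OF always_eventually[OF allI[OF le]]]) (use lim in simp)
    have eq: "(LINT t|\<mu>. \<theta>' t * h k t) = fourier_coeff (h k) n" for k
      unfolding fourier_coeff_def by (intro Bochner_Integration.integral_cong) (auto simp: \<theta>'_def \<theta>_def mult.commute)
    have "(\<lambda>k. fourier_coeff (h k) n) \<longlonglongrightarrow> fourier_coeff (\<lambda>t. inverse (f t)) n"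
    proof (rule fourier_coeff_Lp_tendsto[OF _ inv conjunct1[OF hL]])
      show "(\<lambda>k. Lp_norm q (\<lambda>t. h k t - inverse (f t))) \<longlonglongrightarrow> 0"
      proof (rule Lp_dominated_convergence[OF exponents(4) inv])
        show "AE t in \<mu>. norm (h k t - inverse (f t)) \<le> 1 * norm (inverse (f t))" for k
          by (rule AE_I2) (simp add: h_def)
        show "AE t in \<mu>. (\<lambda>k. h k t - inverse (f t)) \<longlonglongrightarrow> 0"
          using h_lim by eventually_elim (auto intro!: tendsto_eq_intros)
      qed measurable
    qed (use exponents in simp)
    then show "fourier_coeff (\<lambda>t. inverse (f t)) n = 0"
      by (rule LIMSEQ_unique) (rule lim0[unfolded eq])
  qed
qed

end

section \<open>Uniqueness of the plus factor's value at 0\<close>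

lemma AE_circle_nonzero: "AE t in \<mu>. t \<noteq> 0"
  by (rule AE_circle) (rule circle_nonzero)

lemma fourier_coeff_const: "fourier_coeff (\<lambda>t. k) n = (if n = 0 then k else 0)"
  using fourier_coeff_scale[of k "\<lambda>t. t powi 0"] fourier_coeff_powi[of 0 n] by simp

text \<open>Liouville's argument: \<open>u\<close>, built from the plus factors, has no coefficients
  of negative index, and \<open>v\<close>, built from the minus factors, none of positive index;
  they agree and so are constant. A nonzero constant rules out \<open>\<kappa> < \<nu>\<close>, and
  the normalisation of the minus factors makes it 1.\<close>

lemma wiener_hopf_unique_aux:
  assumes p: "1 < p" and G: "wiener_hopf_factorization p a gm \<nu> gp" and H: "wiener_hopf_factorization p a hm \<kappa> hp"
    and le: "\<kappa> \<le> \<nu>"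
  shows "value_at_0 gp = value_at_0 hp"
proof -
  define q where "q = conj_exponent p"
  have q: "1 < q" "1 / p + 1 / q = 1" "1 / q + 1 / p = 1"
    using conj_exponentD[OF p] by (simp_all add: q_def)
  have G': "AE t in \<mu>. a t = gm t * t powi \<nu> * gp t" "AE t in \<mu>. gp t \<noteq> 0" "AE t in \<mu>. gm t \<noteq> 0"
    "gp \<in> Hp q" "gm \<in> Hp_bar p" "(\<lambda>t. inverse (gm t)) \<in> Hp_bar q" "fourier_coeff gm 0 = 1"
    using G by (auto simp: wiener_hopf_factorization_def q_def Let_def value_at_infinity_def)
  have H': "AE t in \<mu>. a t = hm t * t powi \<kappa> * hp t" "AE t in \<mu>. hp t \<noteq> 0" "AE t in \<mu>. hm t \<noteq> 0"
    "hp \<in> Hp q" "(\<lambda>t. inverse (hp t)) \<in> Hp p" "hm \<in> Hp_bar p" "fourier_coeff hm 0 = 1"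
    using H by (auto simp: wiener_hopf_factorization_def q_def Let_def value_at_infinity_def)
  have gm: "gm \<in> Lp p" and hm: "hm \<in> Lp p" and igm: "(\<lambda>t. inverse (gm t)) \<in> Lp q"
    using G'(5,6) H'(6) by (auto simp: Hp_bar_def)
  note [measurable] = Hp_measurable[OF G'(4)] Hp_measurable[OF H'(4)] LpD(1)[OF gm] LpD(1)[OF hm]
  define w where "w = (\<lambda>t. gp t * inverse (hp t))"
  have w: "integrable \<mu> w" and wc: "\<And>n. n < 0 \<Longrightarrow> fourier_coeff w n = 0"
    unfolding w_def using Lp_Hoelder(1)[OF q(1) p q(3) HpD(1)[OF G'(4)] HpD(1)[OF H'(5)]]
      Hp_mult(1)[OF q(1) p q(3) G'(4) H'(5)] by auto
  define u where "u = (\<lambda>t. t powi (\<nu> - \<kappa>) * w t)"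
  have u: "integrable \<mu> u" using integrable_powi[OF w, of "\<nu> - \<kappa>"] by (simp add: u_def mult.commute)
  have uc: "fourier_coeff u n = 0" if "n < \<nu> - \<kappa>" for n
    using wc that by (simp add: u_def fourier_coeff_powi_mult)
  define v where "v = (\<lambda>t. inverse (gm t) * hm t)"
  have v: "integrable \<mu> v" unfolding v_def by (rule Lp_Hoelder(1)[OF q(1) p q(3) igm hm])
  have vc: "fourier_coeff v n = 0" if n: "0 < n" for n
  proof -
    have "fourier_coeff (reflect v) (- n) = 0"
      using Hp_mult(1)[OF q(1) p q(3) Hp_bar_reflect(1)[OF G'(6)] Hp_bar_reflect(1)[OF H'(6)], of "- n"] n
      by (simp add: reflect_def v_def)
    then show ?thesis using fourier_coeff_reflect[OF borel_measurable_integrable[OF v], of "- n"] by simp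
  qed
  have uv: "AE t in \<mu>. u t = v t"
    using G'(1-3) H'(1-3) AE_circle_nonzero
  proof eventually_elim
    case (elim t)
    have "gm t * t powi \<nu> * gp t = hm t * t powi \<kappa> * hp t" using elim by simp
    moreover have "t powi \<nu> = t powi (\<nu> - \<kappa>) * t powi \<kappa>" using elim by (simp flip: power_int_add)
    ultimately have "(gm t * (t powi (\<nu> - \<kappa>) * gp t)) * t powi \<kappa> = (hm t * hp t) * t powi \<kappa>"
      by (simp only: mult_ac)
    then have "gm t * (t powi (\<nu> - \<kappa>) * gp t) = hm t * hp t" using elim by simp
    then show ?case using elim by (simp add: u_def v_def w_def field_simps)
  qed
  have uv_c: "fourier_coeff u n = fourier_coeff v n" for n
    by (rule fourier_coeff_cong_AE[OF borel_measurable_integrable[OF u] borel_measurable_integrable[OF v] uv])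
  define k where "k = fourier_coeff u 0"
  have "AE t in \<mu>. u t = k"
  proof (rule fourier_coeff_unique[OF u])
    show "fourier_coeff u n = fourier_coeff (\<lambda>t. k) n" for n
    proof -
      show ?thesis using fourier_coeff_const[of k n] uc[of n] vc[of n] uv_c[of n] le by (cases n "0::int" rule: linorder_cases) (auto simp: k_def)
    qed
  qed simp
  have nz: "AE t in \<mu>. u t \<noteq> 0"
    using G'(2) H'(2) AE_circle_nonzero
    by eventually_elim (simp add: u_def w_def)
  have "k \<noteq> 0"
  proof
    assume k0: "k = 0"
    have "AE t in \<mu>. False"
      using \<open>AE t in \<mu>. u t = k\<close> nz by eventually_elim (use k0 in simp)
    then show False by simp
  qed
  then have eq: "\<kappa> = \<nu>" using uc[of 0] le by (cases "\<kappa> = \<nu>") (auto simp: k_def)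
  have "AE t in \<mu>. hm t = k * gm t"
    using uv \<open>AE t in \<mu>. u t = k\<close> G'(3) by eventually_elim (simp add: v_def field_simps)
  then have "fourier_coeff hm 0 = fourier_coeff (\<lambda>t. k * gm t) 0" by (intro fourier_coeff_cong_AE) auto
  then have k: "k = 1" using G'(7) H'(7) by (simp add: fourier_coeff_scale)
  have "AE t in \<mu>. gp t = hp t"
    using \<open>AE t in \<mu>. u t = k\<close> H'(2) by eventually_elim (simp add: u_def w_def k eq field_simps)
  then show ?thesis unfolding value_at_0_def by (intro fourier_coeff_cong_AE) auto
qed

lemma factorization_signature_eq:
  assumes p: "1 < p" and G: "wiener_hopf_factorization p a gm \<nu> gp"
  shows "factorization_signature p a = value_at_0 gp"
  unfolding factorization_signature_def
proof (rule the_equality)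
  show "\<exists>gm \<nu> gp'. wiener_hopf_factorization p a gm \<nu> gp' \<and> value_at_0 gp = value_at_0 gp'"
    using G by blast
  fix s assume "\<exists>gm \<nu> gp. wiener_hopf_factorization p a gm \<nu> gp \<and> s = value_at_0 gp"
  then obtain hm \<kappa> hp where H: "wiener_hopf_factorization p a hm \<kappa> hp" "s = value_at_0 hp" by blast
  then show "s = value_at_0 gp"
    using wiener_hopf_unique_aux[OF p G H(1)] wiener_hopf_unique_aux[OF p H(1) G] by (cases "\<kappa> \<le> \<nu>") auto
qed

section \<open>Existence of the factorization\<close>

context invertible_matching
begin

text \<open>The value of \<open>1 / f\<close> at 0 is \<open>1 / c\<close> by multiplicativity, and
  \<open>c\<close> is its own inverse.\<close>

lemma fourier_coeff_inverse_0: "fourier_coeff (\<lambda>t. inverse (f t)) 0 = c"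
proof -
  have "fourier_coeff (\<lambda>t. f t * inverse (f t)) 0 = c * fourier_coeff (\<lambda>t. inverse (f t)) 0"
    using Hp_mult(2)[OF p exponents(3,5) f inverse_in_Hq] by (simp add: c_def)
  moreover have "fourier_coeff (\<lambda>t. f t * inverse (f t)) 0 = fourier_coeff (\<lambda>t. 1) 0"
    using AE_nonzero by (intro fourier_coeff_cong_AE) auto
  moreover have "fourier_coeff (\<lambda>t. 1) 0 = 1" by (simp add: fourier_coeff_def)
  ultimately have "c * fourier_coeff (\<lambda>t. inverse (f t)) 0 = c * c" by (simp add: c_square)
  then show ?thesis using c_cases by auto
qed

text \<open>The inverse of T(a), which will be the bounded extension that the factorization asks
  for.\<close>

definition T_inv :: "(complex \<Rightarrow> complex) \<Rightarrow> complex \<Rightarrow> complex" where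
  "T_inv y = (SOME x. x \<in> Hp p \<and> (\<forall>n\<ge>0. fourier_coeff (\<lambda>t. a t * x t) n = fourier_coeff y n))"

lemma T_inv:
  assumes "y \<in> Hp p"
  shows "T_inv y \<in> Hp p" "0 \<le> n \<Longrightarrow> fourier_coeff (\<lambda>t. a t * T_inv y t) n = fourier_coeff y n"
proof -
  have "\<exists>x. x \<in> Hp p \<and> (\<forall>n\<ge>0. fourier_coeff (\<lambda>t. a t * x t) n = fourier_coeff y n)"
    using surj assms by (auto simp: toeplitz_surjective_def)
  from someI_ex[OF this]
  show "T_inv y \<in> Hp p" "0 \<le> n \<Longrightarrow> fourier_coeff (\<lambda>t. a t * T_inv y t) n = fourier_coeff y n"
    unfolding T_inv_def by auto
qed

lemma T_inv_eqI:
  assumes y: "y \<in> Hp p" and x: "x \<in> Hp p"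
    and "\<And>n. 0 \<le> n \<Longrightarrow> fourier_coeff (\<lambda>t. a t * x t) n = fourier_coeff y n"
  shows "AE t in \<mu>. T_inv y t = x t"
  using assms(3) T_inv(2)[OF y] by (intro toeplitz_injectiveD[OF p a(1) inj T_inv(1)[OF y] x]) simp

lemma T_inv_bounded_linear: "bounded_linear_on_Hp p T_inv"
  unfolding bounded_linear_on_Hp_def
proof (intro conjI ballI allI)
  show "T_inv y \<in> Hp p" if "y \<in> Hp p" for y by (rule T_inv(1)[OF that])
  show "AE t in \<mu>. T_inv (\<lambda>s. y s + z s) t = T_inv y t + T_inv z t" if y: "y \<in> Hp p" and z: "z \<in> Hp p" for y z
  proof (rule T_inv_eqI)
    show "(\<lambda>s. y s + z s) \<in> Hp p" by (intro Hp_add exponents y z)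
    show "(\<lambda>t. T_inv y t + T_inv z t) \<in> Hp p" by (intro Hp_add exponents T_inv(1) y z)
    show "fourier_coeff (\<lambda>t. a t * (T_inv y t + T_inv z t)) n = fourier_coeff (\<lambda>s. y s + z s) n" if "0 \<le> n" for n
      using T_inv(2)[OF y that] T_inv(2)[OF z that] Linf_mult_integrable[OF p a(1) T_inv(1)[OF y]]
        Linf_mult_integrable[OF p a(1) T_inv(1)[OF z]] Hp_integrable[OF exponents(1) y] Hp_integrable[OF exponents(1) z]
      by (simp add: distrib_left fourier_coeff_add)
  qed
  show "AE t in \<mu>. T_inv (\<lambda>s. d * y s) t = d * T_inv y t" if y: "y \<in> Hp p" for d y
  proof (rule T_inv_eqI[OF Hp_scale[OF y] Hp_scale[OF T_inv(1)[OF y]]])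
    show "fourier_coeff (\<lambda>t. a t * (d * T_inv y t)) n = fourier_coeff (\<lambda>s. d * y s) n" if "0 \<le> n" for n
      using T_inv(2)[OF y that] by (simp add: mult.left_commute[of _ d] fourier_coeff_scale)
  qed
  obtain C where C: "0 \<le> C" "\<And>x. x \<in> Hp p \<Longrightarrow> Lp_norm p x \<le> C * Lp_norm p (toeplitz p a x)"
    using toeplitz_bounded_below[OF p a(1) inj surj] by blast
  have "Lp_norm p (T_inv y) \<le> C * Lp_norm p y" if y: "y \<in> Hp p" for y
  proof -
    note x = T_inv(1)[OF y]
    have "AE t in \<mu>. toeplitz p a (T_inv y) t = y t"
      using T_inv(2)[OF y] by (subst toeplitz_AE_eq_iff[OF p a(1) x y]) simp
    then have "Lp_norm p (toeplitz p a (T_inv y)) = Lp_norm p y"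
      by (intro Lp_cong_AE(2) Hp_measurable[OF toeplitz_in_Hp[OF p a(1) x]] Hp_measurable[OF y])
    then show ?thesis using C(2)[OF x] by simp
  qed
  then show "\<exists>C. \<forall>y\<in>Hp p. Lp_norm p (T_inv y) \<le> C * Lp_norm p y" by blast
qed

text \<open>Only finitely many Fourier coefficients of \<open>c * reflect (1 / f) * \<phi>\<close> of index \<open>\<ge> 0\<close> are nonzero.\<close>

lemma T_inv_poly:
  "AE t in \<mu>. T_inv (poly \<phi>) t = f t * riesz_proj q (\<lambda>s. c * reflect (\<lambda>s. inverse (f s)) s * poly \<phi> s) t"
proof -
  define b where "b = reflect (\<lambda>s. inverse (f s))"
  have b: "b \<in> Hp_bar q" unfolding b_def by (rule Hp_bar_reflect(2)[OF inverse_in_Hq])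
  then have bL: "b \<in> Lp q" and bc: "\<And>n. 0 < n \<Longrightarrow> fourier_coeff b n = 0" by (auto simp: Hp_bar_def)
  define y where "y = (\<lambda>s. c * b s * poly \<phi> s)"
  obtain B where B: "\<And>t. t \<in> circle \<Longrightarrow> norm (poly \<phi> t) \<le> B" "0 \<le> B"
    using continuous_on_circle_bounded[of "poly \<phi>"] continuous_on_poly[OF continuous_on_id] by metis
  have [measurable]: "b \<in> borel_measurable \<mu>" by (rule LpD(1)[OF bL])
  have [measurable]: "poly \<phi> \<in> borel_measurable \<mu>" by (rule borel_measurable_integrable[OF poly_integrable])
  have y: "y \<in> Lp q"
  proof (rule Lp_dominated(1)[OF exponents(4) Lp_scale[OF bL, of c] _ B(2)])
    show "AE t in \<mu>. norm (y t) \<le> B * norm (c * b t)"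
    proof (rule AE_circle)
      fix t :: complex assume "t \<in> circle"
      from mult_right_mono[OF B(1)[OF this] norm_ge_zero[of "c * b t"]]
      show "norm (y t) \<le> B * norm (c * b t)" by (simp add: y_def norm_mult mult_ac)
    qed
  qed (simp add: y_def)
  have yc: "fourier_coeff y n = (\<Sum>i\<le>degree \<phi>. coeff \<phi> i * (c * fourier_coeff b (n - int i)))" for n
  proof -
    have "fourier_coeff y n = fourier_coeff (\<lambda>t. \<Sum>i\<le>degree \<phi>. coeff \<phi> i * (t powi int i * (c * b t))) n"
      unfolding y_def poly_as_powi_sum by (simp add: sum_distrib_right sum_distrib_left mult_ac del: power_int_of_nat)
    also have "\<dots> = (\<Sum>i\<le>degree \<phi>. coeff \<phi> i * (c * fourier_coeff b (n - int i)))"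
    proof (subst fourier_coeff_sum)
      show "integrable \<mu> (\<lambda>t. coeff \<phi> i * (t powi int i * (c * b t)))" for i
        using integrable_powi[OF Lp_integrable(1)[OF _ Lp_scale[OF bL, of c]], of "int i"] exponents
        by (simp add: mult.commute del: power_int_of_nat)
    qed (simp only: fourier_coeff_scale fourier_coeff_powi_mult)
    finally show ?thesis .
  qed
  have yc0: "fourier_coeff y n = 0" if "int (degree \<phi>) < n" for n
    unfolding yc using that bc by (intro sum.neutral) auto
  \<comment> \<open>Beyond the degree of \<open>\<phi>\<close> the coefficients of \<open>y\<close>
    vanish, so this polynomial is its projection, and the product with \<open>f\<close> stays in
    H^p.\<close>
  define u where "u = (\<Sum>i\<le>degree \<phi>. monom (fourier_coeff y (int i)) i)"
  have uc: "fourier_coeff (poly u) n = fourier_coeff y n" if n: "0 \<le> n" for n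
  proof -
    have "coeff u (nat n) = (\<Sum>i\<le>degree \<phi>. if i = nat n then fourier_coeff y (int i) else 0)"
      by (simp add: u_def coeff_sum)
    also have "\<dots> = fourier_coeff y n"
      using n yc0[of n] by auto
    finally show ?thesis using n by (simp add: fourier_coeff_poly)
  qed
  have "AE t in \<mu>. riesz_proj q y t = poly u t"
  proof (rule Hp_unique[of q q])
    have "\<exists>h. h \<in> Hp q \<and> (\<forall>n\<ge>0. fourier_coeff h n = fourier_coeff y n)"
      using uc poly_in_Hp[OF exponents(4)] by (intro exI[of _ "poly u"]) auto
    from someI_ex[OF this] have R: "riesz_proj q y \<in> Hp q" "\<And>n. 0 \<le> n \<Longrightarrow> fourier_coeff (riesz_proj q y) n = fourier_coeff y n"
      unfolding riesz_proj_def by auto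
    then show "riesz_proj q y \<in> Hp q" "\<And>n. 0 \<le> n \<Longrightarrow> fourier_coeff (riesz_proj q y) n = fourier_coeff (poly u) n"
      using uc by auto
  qed (use exponents poly_in_Hp[OF exponents(4)] in auto)
  moreover have "AE t in \<mu>. T_inv (poly \<phi>) t = f t * poly u t"
  proof (rule T_inv_eqI[OF poly_in_Hp[OF exponents(2)]])
    have uq: "poly u \<in> Lp q" by (rule poly_in_Lp[OF exponents(4)])
    obtain B' where B': "\<And>t. t \<in> circle \<Longrightarrow> norm (poly u t) \<le> B'" "0 \<le> B'"
      using continuous_on_circle_bounded[of "poly u"] continuous_on_poly[OF continuous_on_id] by metis
    have [measurable]: "poly u \<in> borel_measurable \<mu>" by (rule borel_measurable_integrable[OF poly_integrable])
    have fu: "(\<lambda>t. f t * poly u t) \<in> Lp p"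
    proof (rule Lp_dominated(1)[OF exponents(2) HpD(1)[OF f] _ B'(2)])
      show "AE t in \<mu>. norm (f t * poly u t) \<le> B' * norm (f t)"
      proof (rule AE_circle)
        fix t :: complex assume "t \<in> circle"
        from mult_right_mono[OF B'(1)[OF this] norm_ge_zero[of "f t"]]
        show "norm (f t * poly u t) \<le> B' * norm (f t)" by (simp add: norm_mult mult_ac)
      qed
    qed simp
    show fuH: "(\<lambda>t. f t * poly u t) \<in> Hp p"
      using Hp_mult(1)[OF p exponents(3,5) f poly_in_Hp[OF exponents(4)]] by (intro HpI[OF fu])
    fix n :: int assume n: "0 \<le> n"
    \<comment> \<open>The discarded part \<open>z\<close> has coefficients of negative index only,
      and \<open>reflect f\<close> none of positive index; their product contributes nothing at
      \<open>n \<ge> 0\<close>.\<close>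
    define z where "z = (\<lambda>t. y t - poly u t)"
    have zL: "z \<in> Lp q" unfolding z_def using exponents by (intro Lp_diff(1) y uq) auto
    have zc: "fourier_coeff z m = 0" if "0 \<le> m" for m
      using uc[OF that] Lp_integrable(1)[OF _ y] Lp_integrable(1)[OF _ uq] exponents
      by (simp add: z_def fourier_coeff_diff)
    have [measurable]: "z \<in> borel_measurable \<mu>" by (rule LpD(1)[OF zL])
    have rz: "reflect z \<in> Hp q"
      using zc zL by (intro Hp_bar_reflect(1)) (auto simp: Hp_bar_def)
    have fz: "integrable \<mu> (\<lambda>t. f t * reflect z t)"
      by (rule Lp_Hoelder(1)[OF p exponents(3,5) HpD(1)[OF f] HpD(1)[OF rz]])
    have rfz: "fourier_coeff (\<lambda>t. reflect f t * z t) n = 0"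
    proof -
      have "fourier_coeff (\<lambda>t. reflect f t * z t) n = fourier_coeff (reflect (\<lambda>t. f t * reflect z t)) n"
        by (simp add: reflect_def)
      also have "\<dots> = fourier_coeff (\<lambda>t. f t * reflect z t) (- n)"
        by (rule fourier_coeff_reflect[OF borel_measurable_integrable[OF fz]])
      also have "\<dots> = 0"
      proof (cases "n = 0")
        case True
        have "fourier_coeff (reflect z) 0 = 0" using zc[of 0] by (simp add: fourier_coeff_reflect)
        then show ?thesis using Hp_mult(2)[OF p exponents(3,5) f rz] True by simp
      next
        case False
        then show ?thesis using Hp_mult(1)[OF p exponents(3,5) f rz, of "- n"] n by simp
      qed
      finally show ?thesis .
    qed
    have rfz_int: "integrable \<mu> (\<lambda>t. reflect f t * z t)"
      using integrable_inversion[OF fz] by (simp add: reflect_def)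
    have "AE t in \<mu>. a t * (f t * poly u t) = poly \<phi> t - c * (reflect f t * z t)"
      using AE_matching AE_inversion[OF AE_nonzero]
    proof eventually_elim
      case (elim t)
      have "reflect f t * b t = 1" using elim(2) by (simp add: b_def reflect_def)
      then have "c * (reflect f t * y t) = c * c * poly \<phi> t" by (simp add: y_def)
      then have *: "c * (reflect f t * y t) = poly \<phi> t" by (simp add: c_square)
      have "a t * (f t * poly u t) = c * reflect f t * poly u t" by (simp only: mult.assoc[symmetric] elim(1))
      also have "\<dots> = c * (reflect f t * y t) - c * (reflect f t * z t)" by (simp add: z_def algebra_simps)
      finally show ?case by (simp only: *)
    qed
    then have "fourier_coeff (\<lambda>t. a t * (f t * poly u t)) n = fourier_coeff (\<lambda>t. poly \<phi> t - c * (reflect f t * z t)) n"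
      using LpD(1)[OF Linf_mult_Hp[OF p a(1) fuH]] by (intro fourier_coeff_cong_AE) auto
    also have "\<dots> = fourier_coeff (poly \<phi>) n"
      using rfz rfz_int by (simp add: fourier_coeff_diff poly_integrable fourier_coeff_scale)
    finally show "fourier_coeff (\<lambda>t. a t * (f t * poly u t)) n = fourier_coeff (poly \<phi>) n" .
  qed
  ultimately have "AE t in \<mu>. T_inv (poly \<phi>) t = f t * riesz_proj q y t" by eventually_elim simp
  then show ?thesis by (simp add: y_def b_def)
qed

text \<open>The boundedness condition holds because on polynomials the prescribed operator is the
  inverse of T(a). The minus factor is normalised at infinity since its value there is
  \<open>c * c = 1\<close>.\<close>

lemma wiener_hopf:
  assumes g: "AE t in \<mu>. a t = t powi n * g t"
  shows "wiener_hopf_factorization p g (\<lambda>t. c * reflect f t) (- n) (\<lambda>t. inverse (f t))"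
  unfolding wiener_hopf_factorization_def Let_def q_def[symmetric]
proof (intro conjI)
  have c0: "c \<noteq> 0" "inverse c = c" using c_cases by auto
  show "AE t in \<mu>. g t = c * reflect f t * t powi - n * inverse (f t)"
    using g AE_matching AE_nonzero AE_circle_nonzero
    by eventually_elim (simp add: power_int_minus field_simps)
  show "AE t in \<mu>. inverse (f t) \<noteq> 0" using AE_nonzero by simp
  show "AE t in \<mu>. c * reflect f t \<noteq> 0" using AE_inversion[OF AE_nonzero] c0 by (simp add: reflect_def)
  show "(\<lambda>t. inverse (f t)) \<in> Hp q" by (rule inverse_in_Hq)
  show "(\<lambda>t. inverse (inverse (f t))) \<in> Hp p" using f by simp
  have scale_bar: "(\<lambda>t. d * h t) \<in> Hp_bar r" if "h \<in> Hp_bar r" for d h r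
    using that by (auto simp: Hp_bar_def Lp_scale fourier_coeff_scale)
  show "(\<lambda>t. c * reflect f t) \<in> Hp_bar p" by (intro scale_bar Hp_bar_reflect(2) f)
  show "(\<lambda>t. inverse (c * reflect f t)) \<in> Hp_bar q"
    using scale_bar[OF Hp_bar_reflect(2)[OF inverse_in_Hq], of c] c0 by (simp add: reflect_def)
  show "value_at_infinity (\<lambda>t. c * reflect f t) = 1"
    using c_square by (simp add: value_at_infinity_def fourier_coeff_scale fourier_coeff_reflect c_def[symmetric])
  have "(\<lambda>s. inverse (c * reflect f s) * poly \<phi> s) = (\<lambda>s. c * reflect (\<lambda>s. inverse (f s)) s * poly \<phi> s)" for \<phi>
    using c0 by (simp add: reflect_def fun_eq_iff)
  then show "\<exists>S. bounded_linear_on_Hp p S \<and> (\<forall>\<phi>. AE t in \<mu>. S (poly \<phi>) t = inverse (inverse (f t)) *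
      riesz_proj q (\<lambda>s. inverse (c * reflect f s) * poly \<phi> s) t)"
    using T_inv_bounded_linear T_inv_poly by (intro exI[of _ T_inv]) simp
qed

lemma signature: "AE t in \<mu>. a t = t powi n * g t \<Longrightarrow> factorization_signature p g = c"
  using factorization_signature_eq[OF p wiener_hopf] fourier_coeff_inverse_0 by (simp add: value_at_0_def)

end

section \<open>Fredholm Toeplitz operators with matching symbol\<close>

declare power_int_of_nat [simp del]

lemma lin_subspaceD:
  assumes "lin_subspace W"
  shows "(\<lambda>t. 0) \<in> W" "f \<in> W \<Longrightarrow> h \<in> W \<Longrightarrow> (\<lambda>t. f t + h t) \<in> W" "f \<in> W \<Longrightarrow> (\<lambda>t. c * f t) \<in> W"
  using assms by (simp_all add: lin_subspace_def)

section \<open>Closed subspaces enlarged by finitely many dimensions\<close>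

lemma Lp_closedD:
  assumes "Lp_closed_in_Hp p R" "h \<in> Hp p" "\<And>k. r k \<in> R" "(\<lambda>k. Lp_norm p (\<lambda>t. r k t - h t)) \<longlonglongrightarrow> 0"
  shows "h \<in> R"
  using assms unfolding Lp_closed_in_Hp_def by blast

text \<open>If \<open>v\<close> is not in \<open>W\<close>, closedness keeps it at a positive
  distance \<open>d\<close> from \<open>W\<close>, so the coefficient of \<open>v\<close> depends
  boundedly on the function and converges along with it. For negative index the range has to be
  supplemented by powers of \<open>t\<close> without losing closedness.\<close>

lemma Lp_closed_add_span:
  assumes p: "1 \<le> p" and W: "lin_subspace W" "W \<subseteq> Hp p" "Lp_closed_in_Hp p W" and v: "v \<in> Hp p"
  shows "Lp_closed_in_Hp p {h \<in> Hp p. \<exists>c. (\<lambda>t. h t - c * v t) \<in> W}"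
proof (cases "v \<in> W")
  case True
  have "{h \<in> Hp p. \<exists>c. (\<lambda>t. h t - c * v t) \<in> W} = W"
  proof (intro equalityI subsetI)
    fix h assume "h \<in> {h \<in> Hp p. \<exists>c. (\<lambda>t. h t - c * v t) \<in> W}"
    then obtain c where c: "(\<lambda>t. h t - c * v t) \<in> W" by blast
    have "(\<lambda>t. (h t - c * v t) + c * v t) \<in> W"
      by (intro lin_subspaceD[OF W(1)] c True)
    then show "h \<in> W" by simp
  next
    fix h assume h: "h \<in> W"
    then show "h \<in> {h \<in> Hp p. \<exists>c. (\<lambda>t. h t - c * v t) \<in> W}"
      using W(2) by (auto intro!: exI[of _ 0])
  qed
  then show ?thesis using W(3) by simp
next
  case False
  have "\<exists>d>0. \<forall>w\<in>W. d \<le> Lp_norm p (\<lambda>t. w t - v t)"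
  proof (rule ccontr)
    assume "\<not> ?thesis"
    then have "\<exists>w\<in>W. Lp_norm p (\<lambda>t. w t - v t) < inverse (real (Suc k))" for k
      by (metis not_le inverse_positive_iff_positive of_nat_0_less_iff zero_less_Suc)
    then obtain w where w: "\<And>k. w k \<in> W" "\<And>k. Lp_norm p (\<lambda>t. w k t - v t) < inverse (real (Suc k))" by metis
    have "norm (Lp_norm p (\<lambda>t. w k t - v t)) \<le> inverse (real (Suc k))" for k
      using w(2)[of k] by simp
    then have "(\<lambda>k. Lp_norm p (\<lambda>t. w k t - v t)) \<longlonglongrightarrow> 0"
      by (intro Lim_null_comparison[OF always_eventually[OF allI] LIMSEQ_inverse_real_of_nat])
    from Lp_closedD[OF W(3) v w(1) this] False show False by contradiction
  qed
  then obtain d where d: "0 < d" "\<And>w. w \<in> W \<Longrightarrow> d \<le> Lp_norm p (\<lambda>t. w t - v t)" by blast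
  have p0: "0 < p" using p by simp
  have far: "norm e * d \<le> Lp_norm p (\<lambda>t. w t + e * v t)" if w: "w \<in> W" for w e
  proof (cases "e = 0")
    case False
    have "(\<lambda>t. (- 1 / e) * w t) \<in> W" by (rule lin_subspaceD(3)[OF W(1) w])
    then have "norm e * d \<le> norm (- e) * Lp_norm p (\<lambda>t. (- 1 / e) * w t - v t)"
      using d(2) by (simp add: mult_left_mono)
    also have "\<dots> = Lp_norm p (\<lambda>t. - e * ((- 1 / e) * w t - v t))" by (rule Lp_norm_scale[OF p0, symmetric])
    also have "(\<lambda>t. - e * ((- 1 / e) * w t - v t)) = (\<lambda>t. w t + e * v t)" using False by (simp add: algebra_simps)
    finally show ?thesis .
  qed simp
  show ?thesis
    unfolding Lp_closed_in_Hp_def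
  proof (intro ballI impI)
    fix h assume h: "h \<in> Hp p"
      and "\<exists>r. (\<forall>k. r k \<in> {h \<in> Hp p. \<exists>c. (\<lambda>t. h t - c * v t) \<in> W}) \<and> (\<lambda>k. Lp_norm p (\<lambda>t. r k t - h t)) \<longlonglongrightarrow> 0"
    then obtain r where r: "\<And>k. r k \<in> Hp p" "\<And>k. \<exists>c. (\<lambda>t. r k t - c * v t) \<in> W"
      and lim: "(\<lambda>k. Lp_norm p (\<lambda>t. r k t - h t)) \<longlonglongrightarrow> 0" by blast
    have "\<forall>k. \<exists>c. (\<lambda>t. r k t - c * v t) \<in> W" using r(2) by (rule allI)
    from choice[OF this] obtain c where c: "\<And>k. (\<lambda>t. r k t - c k * v t) \<in> W" by blast
    have close: "norm (c k - c l) * d \<le> Lp_norm p (\<lambda>t. r k t - h t) + Lp_norm p (\<lambda>t. r l t - h t)" for k l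
    proof -
      have "(\<lambda>t. (r k t - c k * v t) + (-1) * (r l t - c l * v t)) \<in> W"
        by (rule lin_subspaceD(2)[OF W(1) c lin_subspaceD(3)[OF W(1) c]])
      from far[OF this, of "c k - c l"]
      have "norm (c k - c l) * d \<le> Lp_norm p (\<lambda>t. (r k t - h t) - (r l t - h t))" by (simp add: algebra_simps)
      also have "\<dots> \<le> Lp_norm p (\<lambda>t. r k t - h t) + Lp_norm p (\<lambda>t. r l t - h t)"
        using r h by (intro Lp_diff p HpD(1)[OF r(1)] HpD(1)[OF h])
      finally show ?thesis .
    qed
    have "Cauchy c"
    proof (rule metric_CauchyI)
      fix e :: real assume e: "0 < e"
      have "\<forall>\<^sub>F k in sequentially. Lp_norm p (\<lambda>t. r k t - h t) < e * d / 2"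
        by (rule order_tendstoD(2)[OF lim]) (use e d in simp)
      then obtain N where N: "\<And>k. N \<le> k \<Longrightarrow> Lp_norm p (\<lambda>t. r k t - h t) < e * d / 2"
        by (auto simp: eventually_sequentially)
      have "dist (c k) (c l) < e" if "N \<le> k" "N \<le> l" for k l
      proof -
        have "norm (c k - c l) * d < e * d" using close[of k l] N[OF that(1)] N[OF that(2)] by linarith
        then show ?thesis using d(1) by (simp add: dist_norm)
      qed
      then show "\<exists>N. \<forall>k\<ge>N. \<forall>l\<ge>N. dist (c k) (c l) < e" by blast
    qed
    then obtain c0 where c0: "c \<longlonglongrightarrow> c0" by (metis Cauchy_convergent convergent_def)
    have le: "norm (Lp_norm p (\<lambda>t. (r k t - c k * v t) - (h t - c0 * v t)))
        \<le> Lp_norm p (\<lambda>t. r k t - h t) + norm (c0 - c k) * Lp_norm p v" for k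
    proof -
      have "(\<lambda>t. (r k t - c k * v t) - (h t - c0 * v t)) = (\<lambda>t. (r k t - h t) + (c0 - c k) * v t)"
        by (simp add: algebra_simps)
      moreover have "Lp_norm p (\<lambda>t. (r k t - h t) + (c0 - c k) * v t)
          \<le> Lp_norm p (\<lambda>t. r k t - h t) + Lp_norm p (\<lambda>t. (c0 - c k) * v t)"
        by (intro Lp_add(2) Lp_diff(1) Lp_scale p HpD(1)[OF r(1)] HpD(1)[OF h] HpD(1)[OF v])
      ultimately show ?thesis by (simp add: Lp_norm_scale[OF p0])
    qed
    have "(\<lambda>k. Lp_norm p (\<lambda>t. r k t - h t) + norm (c0 - c k) * Lp_norm p v) \<longlonglongrightarrow> 0 + norm (c0 - c0) * Lp_norm p v"
      by (intro tendsto_intros lim c0)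
    then have "(\<lambda>k. Lp_norm p (\<lambda>t. (r k t - c k * v t) - (h t - c0 * v t))) \<longlonglongrightarrow> 0"
      by (intro Lim_null_comparison[OF always_eventually[OF allI[OF le]]]) simp
    moreover have "(\<lambda>t. h t - c0 * v t) \<in> Hp p" by (intro Hp_diff p h Hp_scale v)
    ultimately have "(\<lambda>t. h t - c0 * v t) \<in> W"
      using Lp_closedD[where r = "\<lambda>k t. r k t - c k * v t", OF W(3) _ c] by blast
    then show "h \<in> {h \<in> Hp p. \<exists>c. (\<lambda>t. h t - c * v t) \<in> W}" using h by blast
  qed
qed

lemma lin_subspace_add_span:
  assumes p: "1 \<le> p" and W: "lin_subspace W"
  shows "lin_subspace {h \<in> Hp p. \<exists>c. (\<lambda>t. h t - c * v t) \<in> W}"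
  unfolding lin_subspace_def
proof (intro conjI ballI allI)
  show "(\<lambda>t. 0) \<in> {h \<in> Hp p. \<exists>c. (\<lambda>t. h t - c * v t) \<in> W}"
    using W Hp_zero by (auto simp: lin_subspace_def intro!: exI[of _ 0])
  fix h assume "h \<in> {h \<in> Hp p. \<exists>c. (\<lambda>t. h t - c * v t) \<in> W}"
  then obtain c where h: "h \<in> Hp p" and c: "(\<lambda>t. h t - c * v t) \<in> W" by blast
  show "(\<lambda>t. b * h t) \<in> {h \<in> Hp p. \<exists>c. (\<lambda>t. h t - c * v t) \<in> W}" for b
  proof -
    have "(\<lambda>t. b * (h t - c * v t)) \<in> W" by (rule lin_subspaceD(3)[OF W c])
    then have "(\<lambda>t. b * h t - (b * c) * v t) \<in> W" by (simp add: right_diff_distrib mult.assoc)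
    then show ?thesis using Hp_scale[OF h] by blast
  qed
  fix k assume "k \<in> {h \<in> Hp p. \<exists>c. (\<lambda>t. h t - c * v t) \<in> W}"
  then obtain e where k: "k \<in> Hp p" and e: "(\<lambda>t. k t - e * v t) \<in> W" by blast
  have "(\<lambda>t. (h t - c * v t) + (k t - e * v t)) \<in> W" by (rule lin_subspaceD(2)[OF W c e])
  then have "(\<lambda>t. (h t + k t) - (c + e) * v t) \<in> W" by (simp add: algebra_simps)
  then show "(\<lambda>t. h t + k t) \<in> {h \<in> Hp p. \<exists>c. (\<lambda>t. h t - c * v t) \<in> W}"
    using Hp_add[OF p h k] by blast
qed

lemma Lp_closed_add_powers:
  assumes p: "1 \<le> p" and W: "lin_subspace W" "W \<subseteq> Hp p" "Lp_closed_in_Hp p W"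
  defines "S \<equiv> \<lambda>m::nat. {h \<in> Hp p. \<exists>c. (\<lambda>t. h t - (\<Sum>i<m. c i * t powi int i)) \<in> W}"
  shows "lin_subspace (S m) \<and> Lp_closed_in_Hp p (S m)"
proof (induction m)
  case 0
  have "S 0 = W" using W(2) by (auto simp: S_def)
  then show ?case using W by simp
next
  case (Suc m)
  define v where "v = (\<lambda>t::complex. t powi int m)"
  have v: "v \<in> Hp p" using poly_in_Hp[of p "monom 1 m"] p by (simp add: v_def poly_monom[abs_def] power_int_of_nat)
  have "S (Suc m) = {h \<in> Hp p. \<exists>c. (\<lambda>t. h t - c * v t) \<in> S m}"
  proof (intro equalityI subsetI)
    fix h assume "h \<in> S (Suc m)"
    then obtain c where h: "h \<in> Hp p" and c: "(\<lambda>t. h t - (\<Sum>i<Suc m. c i * t powi int i)) \<in> W"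
      unfolding S_def by blast
    have "(\<lambda>t. h t - (\<Sum>i<Suc m. c i * t powi int i)) = (\<lambda>t. (h t - c m * v t) - (\<Sum>i<m. c i * t powi int i))"
      by (simp add: v_def algebra_simps)
    then have "(\<lambda>t. (h t - c m * v t) - (\<Sum>i<m. c i * t powi int i)) \<in> W" using c by (simp only:)
    moreover have "(\<lambda>t. h t - c m * v t) \<in> Hp p" by (intro Hp_diff p h Hp_scale v)
    ultimately have "(\<lambda>t. h t - c m * v t) \<in> S m" unfolding S_def by blast
    then show "h \<in> {h \<in> Hp p. \<exists>c. (\<lambda>t. h t - c * v t) \<in> S m}" using h by blast
  next
    fix h assume "h \<in> {h \<in> Hp p. \<exists>c. (\<lambda>t. h t - c * v t) \<in> S m}"
    then obtain b c where h: "h \<in> Hp p" and c: "(\<lambda>t. (h t - b * v t) - (\<Sum>i<m. c i * t powi int i)) \<in> W"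
      unfolding S_def by blast
    have "(\<Sum>i<Suc m. (c(m := b)) i * t powi int i) = (\<Sum>i<m. c i * t powi int i) + b * v t" for t
      by (simp add: v_def)
    then have "(\<lambda>t. h t - (\<Sum>i<Suc m. (c(m := b)) i * t powi int i)) = (\<lambda>t. (h t - b * v t) - (\<Sum>i<m. c i * t powi int i))"
      by (simp add: algebra_simps del: sum.lessThan_Suc)
    then have "(\<lambda>t. h t - (\<Sum>i<Suc m. (c(m := b)) i * t powi int i)) \<in> W" using c by (simp only:)
    then show "h \<in> S (Suc m)" unfolding S_def using h by blast
  qed
  moreover have "S m \<subseteq> Hp p" by (auto simp: S_def)
  ultimately show ?case
    using Lp_closed_add_span[OF p _ _ _ v, of "S m"] lin_subspace_add_span[OF p, of "S m" v] Suc by simp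
qed

section \<open>Shifted symbols and the critical index\<close>

locale fredholm_matching =
  fixes p :: real and g :: "complex \<Rightarrow> complex"
  assumes p: "1 < p" and g: "g \<in> Linf" "matching g" and fredholm: "fredholm p (toeplitz p g)"
begin

lemma p1: "1 \<le> p" "0 < p"
  using p by auto

definition A :: "int \<Rightarrow> complex \<Rightarrow> complex" where
  "A k t = t powi k * g t"

lemma A_Linf: "A k \<in> Linf"
proof -
  obtain C where C: "AE t in \<mu>. norm (g t) \<le> C" using LinfD(2)[OF g(1)] by blast
  note [measurable] = LinfD(1)[OF g(1)]
  have "AE t in \<mu>. norm (t powi k) = 1" by (rule AE_circle) (rule norm_powi_circle)
  with C have "AE t in \<mu>. norm (A k t) \<le> C"
    by eventually_elim (simp add: A_def norm_mult)
  moreover have "A k \<in> borel_measurable \<mu>" unfolding A_def by measurable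
  ultimately show ?thesis by (auto simp: Linf_def)
qed

lemma A_matching: "matching (A k)"
  using g(2) AE_circle_nonzero unfolding matching_def
proof eventually_elim
  case (elim t)
  have "A k t * reflect (A k) t = (t powi k * (1 / t) powi k) * (g t * reflect g t)"
    by (simp add: A_def reflect_def mult_ac)
  also have "t powi k * (1 / t) powi k = 1" using elim(2) by (simp flip: power_int_mult_distrib)
  finally show ?case using elim(1) by simp
qed

lemma coeff_A: "fourier_coeff (\<lambda>t. A k t * f t) n = fourier_coeff (\<lambda>t. g t * f t) (n - k)"
  using fourier_coeff_powi_mult[of k "\<lambda>t. g t * f t" n] by (simp add: A_def mult.assoc)

lemma coeff_shift: "fourier_coeff (\<lambda>t. g t * (t powi k * f t)) n = fourier_coeff (\<lambda>t. g t * f t) (n - k)"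
  using fourier_coeff_powi_mult[of k "\<lambda>t. g t * f t" n] by (simp add: mult.left_commute)

lemma coeff_g_sum:
  assumes "\<And>i. i \<in> I \<Longrightarrow> f i \<in> Hp p"
  shows "fourier_coeff (\<lambda>t. g t * (\<Sum>i\<in>I. c i * f i t)) n = (\<Sum>i\<in>I. c i * fourier_coeff (\<lambda>t. g t * f i t) n)"
proof -
  have "integrable \<mu> (\<lambda>t. c i * (g t * f i t))" if "i \<in> I" for i
    using Linf_mult_integrable[OF p g(1) assms[OF that]] by simp
  then show ?thesis
    by (simp add: sum_distrib_left mult.left_commute[of "g _"] fourier_coeff_sum fourier_coeff_scale)
qed

lemma powers_in_Hp: "f \<in> Hp p \<Longrightarrow> (\<lambda>t. t powi int i * f t) \<in> Hp p"
  by (rule Hp_powi_mult[OF p1(2)]) auto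

lemma power_in_Hp: "(\<lambda>t. t powi int i) \<in> Hp p"
  using poly_in_Hp[of p "monom 1 i"] p1 by (simp add: poly_monom[abs_def] power_int_of_nat)

lemma sum_in_Hp: "(\<And>i. i \<in> I \<Longrightarrow> f i \<in> Hp p) \<Longrightarrow> (\<lambda>t. \<Sum>i\<in>I. c i * f i t) \<in> Hp p"
  by (intro Hp_sum p1 Hp_scale) auto

lemma ker_toeplitz: "ker_op p (toeplitz p g) = {f \<in> Hp p. \<forall>n\<ge>0. fourier_coeff (\<lambda>t. g t * f t) n = 0}"
  using toeplitz_AE_eq_iff[OF p g(1) _ Hp_zero] by (auto simp: ker_op_def)

lemma range_toeplitz: "range_op p (toeplitz p g) =
    {h \<in> Hp p. \<exists>f\<in>Hp p. \<forall>n\<ge>0. fourier_coeff (\<lambda>t. g t * f t) n = fourier_coeff h n}"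
  using toeplitz_AE_eq_iff[OF p g(1)] by (auto simp: range_op_def)

lemma lin_range: "lin_subspace (range_op p (toeplitz p g))"
  unfolding lin_subspace_def range_toeplitz
proof (intro conjI ballI allI)
  let ?R = "{h \<in> Hp p. \<exists>f\<in>Hp p. \<forall>n\<ge>0. fourier_coeff (\<lambda>t. g t * f t) n = fourier_coeff h n}"
  show "(\<lambda>t. 0) \<in> ?R" using Hp_zero by (auto intro!: bexI[OF _ Hp_zero])
  fix h assume "h \<in> ?R"
  then obtain x where h: "h \<in> Hp p" and x: "x \<in> Hp p" "\<forall>n\<ge>0. fourier_coeff (\<lambda>t. g t * x t) n = fourier_coeff h n" by blast
  show "(\<lambda>t. b * h t) \<in> ?R" for b
    using x Hp_scale[OF h]
    by (auto intro!: bexI[OF _ Hp_scale[OF x(1), of b]] simp: mult.left_commute[of _ b] fourier_coeff_scale)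
  fix k assume "k \<in> ?R"
  then obtain y where k: "k \<in> Hp p" and y: "y \<in> Hp p" "\<forall>n\<ge>0. fourier_coeff (\<lambda>t. g t * y t) n = fourier_coeff k n" by blast
  have "fourier_coeff (\<lambda>t. g t * (x t + y t)) n = fourier_coeff (\<lambda>t. h t + k t) n" if "0 \<le> n" for n
    using x y that Linf_mult_integrable[OF p g(1) x(1)] Linf_mult_integrable[OF p g(1) y(1)]
      Hp_integrable[OF p1(1) h] Hp_integrable[OF p1(1) k]
    by (simp add: distrib_left fourier_coeff_add)
  then show "(\<lambda>t. h t + k t) \<in> ?R"
    by (intro CollectI conjI bexI[of _ "\<lambda>t. x t + y t"] allI impI Hp_add p1 h k x(1) y(1))
qed

lemma lin_null: "lin_subspace null_funs"
  unfolding lin_subspace_def null_funs_def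
proof (intro conjI ballI allI)
  fix f :: "complex \<Rightarrow> complex" assume f: "f \<in> {f \<in> borel_measurable \<mu>. AE t in \<mu>. f t = 0}"
  show "(\<lambda>t. c * f t) \<in> {f \<in> borel_measurable \<mu>. AE t in \<mu>. f t = 0}" for c
    using f by auto
  fix h :: "complex \<Rightarrow> complex" assume h: "h \<in> {f \<in> borel_measurable \<mu>. AE t in \<mu>. f t = 0}"
  have "AE t in \<mu>. f t + h t = 0" using f h by (auto elim: eventually_elim2)
  then show "(\<lambda>t. f t + h t) \<in> {f \<in> borel_measurable \<mu>. AE t in \<mu>. f t = 0}" using f h by auto
qed auto

text \<open>The kernel of T(t^k g), written with the coefficients of \<open>g * f\<close> alone, so
  that its monotonicity in \<open>k\<close> is immediate.\<close>

definition kernel :: "int \<Rightarrow> (complex \<Rightarrow> complex) set" where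
  "kernel k = {f \<in> Hp p. \<forall>m\<ge>-k. fourier_coeff (\<lambda>t. g t * f t) m = 0}"

lemma injective_iff: "toeplitz_injective p (A k) \<longleftrightarrow> (\<forall>f\<in>kernel k. AE t in \<mu>. f t = 0)"
proof -
  have "(\<forall>n\<ge>0. fourier_coeff (\<lambda>t. A k t * f t) n = 0) \<longleftrightarrow> (\<forall>m\<ge>-k. fourier_coeff (\<lambda>t. g t * f t) m = 0)" for f
    unfolding coeff_A
  proof (intro iffI allI impI)
    fix m assume "\<forall>n\<ge>0. fourier_coeff (\<lambda>t. g t * f t) (n - k) = 0" "- k \<le> m"
    then show "fourier_coeff (\<lambda>t. g t * f t) m = 0" by (metis add_diff_cancel_right' add.commute diff_ge_0_iff_ge diff_minus_eq_add)
  qed auto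
  then show ?thesis by (auto simp: toeplitz_injective_def kernel_def)
qed

lemma kernel_antimono: "k \<le> l \<Longrightarrow> kernel l \<subseteq> kernel k"
  by (auto simp: kernel_def)

lemma not_null_coeff:
  assumes "f \<in> Hp p" "\<not> (AE t in \<mu>. f t = 0)"
  shows "\<exists>m. fourier_coeff f (int m) \<noteq> 0 \<and> (\<forall>i<int m. fourier_coeff f i = 0)"
proof -
  have "\<exists>m. fourier_coeff f (int m) \<noteq> 0"
  proof (rule ccontr)
    assume "\<not> ?thesis"
    then have "fourier_coeff f n = 0" for n
      using HpD(2)[OF assms(1), of n] by (cases n rule: int_cases) auto
    then show False using fourier_coeff_unique_zero[OF Hp_integrable[OF p1(1) assms(1)]] assms(2) by blast
  qed
  then obtain m where m: "fourier_coeff f (int m) \<noteq> 0" "\<And>i. i < m \<Longrightarrow> fourier_coeff f (int i) = 0"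
    using exists_least_iff[of "\<lambda>m. fourier_coeff f (int m) \<noteq> 0"] by blast
  have "fourier_coeff f i = 0" if "i < int m" for i
    using HpD(2)[OF assms(1), of i] m(2)[of "nat i"] that by (cases "0 \<le> i") auto
  then show ?thesis using m(1) by blast
qed

lemma coeff_powers_sum:
  assumes f: "f \<in> Hp p" and low: "\<And>i. i < m \<Longrightarrow> fourier_coeff f i = 0"
    and j0: "j0 < N" "\<And>j. j < j0 \<Longrightarrow> d j = 0"
  shows "fourier_coeff (\<lambda>t. \<Sum>j<N. d j * (t powi int j * f t)) (m + int j0) = d j0 * fourier_coeff f m"
proof -
  have "integrable \<mu> (\<lambda>t. d j * (t powi int j * f t))" for j
    using Hp_integrable[OF p1(1) Hp_scale[OF powers_in_Hp[OF f]], of "d j" j] by simp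
  then have "fourier_coeff (\<lambda>t. \<Sum>j<N. d j * (t powi int j * f t)) (m + int j0)
      = (\<Sum>j<N. d j * fourier_coeff f (m + int j0 - int j))"
    by (subst fourier_coeff_sum) (simp_all only: fourier_coeff_scale fourier_coeff_powi_mult)
  also have "\<dots> = (\<Sum>j<N. if j = j0 then d j0 * fourier_coeff f m else 0)"
    using j0(2) low by (intro sum.cong refl) (auto simp: linorder_neq_iff)
  also have "\<dots> = d j0 * fourier_coeff f m" using j0(1) by simp
  finally show ?thesis .
qed

text \<open>Let \<open>m\<close> be the least index of a nonzero coefficient of \<open>f\<close> and
  \<open>j0\<close> the least index with \<open>d j0 \<noteq> 0\<close>. At index
  \<open>m + j0\<close> only the term for \<open>j0\<close> contributes, and it is nonzero.\<close>

lemma powers_independent: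
  assumes f: "f \<in> Hp p" "\<not> (AE t in \<mu>. f t = 0)"
    and null: "(\<lambda>t. \<Sum>j<N. d j * (t powi int j * f t)) \<in> null_funs" and j: "j < N"
  shows "d j = 0"
proof (rule ccontr)
  assume "d j \<noteq> 0"
  then have "\<exists>j. j < N \<and> d j \<noteq> 0" using j by blast
  then obtain j0 where j0: "j0 < N" "d j0 \<noteq> 0" "\<And>i. i < j0 \<Longrightarrow> \<not> (i < N \<and> d i \<noteq> 0)"
    using exists_least_iff[of "\<lambda>j. j < N \<and> d j \<noteq> 0"] by blast
  obtain m where m: "fourier_coeff f (int m) \<noteq> 0" "\<And>i. i < int m \<Longrightarrow> fourier_coeff f i = 0"
    using not_null_coeff[OF f] by blast
  have "fourier_coeff (\<lambda>t. \<Sum>j<N. d j * (t powi int j * f t)) (int m + int j0) = d j0 * fourier_coeff f (int m)"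
    using m(2) j0 by (intro coeff_powers_sum f) force+
  moreover have "fourier_coeff (\<lambda>t. \<Sum>j<N. d j * (t powi int j * f t)) n = fourier_coeff (\<lambda>t. 0) n" for n
    using null by (intro fourier_coeff_cong_AE) (auto simp: null_funs_def)
  ultimately show False using m(1) j0(2) by simp
qed

text \<open>A nonzero \<open>f\<close> in \<open>kernel (int N)\<close> would give \<open>N\<close>
  independent elements \<open>t powi int j * f t\<close> of the kernel of T(g), one more than its
  dimension.\<close>

lemma injective_large: "\<exists>k. toeplitz_injective p (A k)"
proof -
  obtain B where B: "quot_basis (ker_op p (toeplitz p g)) null_funs B"
    using fredholm by (auto simp: fredholm_def finite_dim_quot_def)
  define N where "N = Suc (card B)"
  have "AE t in \<mu>. f t = 0" if f: "f \<in> kernel (int N)" for f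
  proof (rule ccontr)
    assume nn: "\<not> (AE t in \<mu>. f t = 0)"
    have fH: "f \<in> Hp p" using f by (simp add: kernel_def)
    have ker: "(\<lambda>t. t powi int j * f t) \<in> ker_op p (toeplitz p g)" if "j \<in> {..<N}" for j
      using f that powers_in_Hp[OF fH] unfolding ker_toeplitz kernel_def by (auto simp: coeff_shift)
    obtain d where d: "\<exists>j\<in>{..<N}. d j \<noteq> 0" "(\<lambda>t. \<Sum>j<N. d j * (t powi int j * f t)) \<in> null_funs"
      using quot_basis_dependent[where v = "\<lambda>j t. t powi int j * f t" and J = "{..<N}", OF lin_null B _ _ ker]
      by (auto simp: N_def)
    then show False using powers_independent[OF fH nn d(2)] by blast
  qed
  then show ?thesis using injective_iff by blast
qed

text \<open>Of \<open>N\<close> powers of \<open>t\<close>, one more than the codimension, some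
  nontrivial combination lies in the range. Its preimage \<open>f\<close> is nonzero, and
  \<open>g * f\<close> has no coefficients from index \<open>N\<close> on.\<close>

lemma not_injective_small: "\<exists>k. \<not> toeplitz_injective p (A k)"
proof -
  obtain B where B: "quot_basis (Hp p) (range_op p (toeplitz p g)) B"
    using fredholm by (auto simp: fredholm_def finite_dim_quot_def)
  define N where "N = Suc (card B)"
  obtain d where d: "\<exists>j\<in>{..<N}. d j \<noteq> 0" "(\<lambda>t. \<Sum>j<N. d j * t powi int j) \<in> range_op p (toeplitz p g)"
    using quot_basis_dependent[where v = "\<lambda>j t. t powi int j" and J = "{..<N}", OF lin_range B _ _ power_in_Hp]
    by (auto simp: N_def)
  obtain f where f: "f \<in> Hp p" "\<And>n. 0 \<le> n \<Longrightarrow> fourier_coeff (\<lambda>t. g t * f t) n = fourier_coeff (\<lambda>t. \<Sum>j<N. d j * t powi int j) n"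
    using d(2) unfolding range_toeplitz by blast
  have coeff: "fourier_coeff (\<lambda>t. \<Sum>j<N. d j * t powi int j) n = (\<Sum>j<N. if n = int j then d j else 0)" for n
  proof -
    have "fourier_coeff (\<lambda>t. \<Sum>j<N. d j * t powi int j) n = (\<Sum>j<N. d j * fourier_coeff (\<lambda>t. t powi int j) n)"
      by (subst fourier_coeff_sum) (simp_all only: integrable_powi_const fourier_coeff_scale)
    also have "\<dots> = (\<Sum>j<N. if n = int j then d j else 0)" by (intro sum.cong refl) (simp only: fourier_coeff_powi split: if_splits, simp)
    finally show ?thesis .
  qed
  have "f \<in> kernel (- int N)"
  proof -
    have "fourier_coeff (\<lambda>t. g t * f t) m = 0" if "int N \<le> m" for m
      using f(2)[of m] that unfolding coeff by (auto intro!: sum.neutral)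
    then show ?thesis using f(1) by (simp add: kernel_def)
  qed
  moreover have "\<not> (AE t in \<mu>. f t = 0)"
  proof
    assume z: "AE t in \<mu>. f t = 0"
    obtain j where j: "j < N" "d j \<noteq> 0" using d(1) by blast
    have "fourier_coeff (\<lambda>t. g t * f t) (int j) = fourier_coeff (\<lambda>t. 0) (int j)"
      using z LpD(1)[OF Linf_mult_Hp[OF p g(1) f(1)]] by (intro fourier_coeff_cong_AE) auto
    then have "(\<Sum>i<N. if int j = int i then d i else 0) = 0" using f(2)[of "int j"] unfolding coeff by simp
    then show False using j by simp
  qed
  ultimately show ?thesis using injective_iff by blast
qed

lemma critical_shift: "\<exists>k. toeplitz_injective p (A k) \<and> \<not> toeplitz_injective p (A (k - 1))"
proof -
  obtain k1 where k1: "\<not> toeplitz_injective p (A k1)" using not_injective_small by blast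
  obtain k2 where k2: "toeplitz_injective p (A k2)" using injective_large by blast
  have "k1 < k2" using k1 k2 kernel_antimono[of k2 k1] by (fastforce simp: injective_iff)
  then have "\<exists>i. toeplitz_injective p (A (k1 + int i))"
    using k2 by (intro exI[of _ "nat (k2 - k1)"]) simp
  then obtain i where i: "toeplitz_injective p (A (k1 + int i))" "\<And>j. j < i \<Longrightarrow> \<not> toeplitz_injective p (A (k1 + int j))"
    using exists_least_iff[of "\<lambda>i. toeplitz_injective p (A (k1 + int i))"] by blast
  have "i \<noteq> 0" using i(1) k1 by (intro notI) simp
  then have eq: "k1 + int i - 1 = k1 + int (i - 1)" by simp
  have "\<not> toeplitz_injective p (A (k1 + int i - 1))"
    unfolding eq using \<open>i \<noteq> 0\<close> by (intro i(2)) simp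
  then show ?thesis using i(1) by blast
qed

lemma normalized_solution:
  assumes "toeplitz_injective p (A k)" "\<not> toeplitz_injective p (A (k - 1))"
  shows "\<exists>f\<in>Hp p. \<forall>n\<ge>0. fourier_coeff (\<lambda>t. A k t * f t) n = (if n = 0 then 1 else 0)"
proof -
  obtain f where f: "f \<in> kernel (k - 1)" "\<not> (AE t in \<mu>. f t = 0)" using assms(2) injective_iff by blast
  have fH: "f \<in> Hp p" using f(1) by (simp add: kernel_def)
  have zero: "fourier_coeff (\<lambda>t. g t * f t) m = 0" if "- k < m" for m
    using f(1) that by (simp add: kernel_def)
  \<comment> \<open>The one coefficient that separates \<open>kernel (k - 1)\<close> from
    \<open>kernel k\<close>; injectivity at \<open>k\<close> makes it nonzero.\<close>
  define b where "b = fourier_coeff (\<lambda>t. g t * f t) (- k)"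
  have "b \<noteq> 0"
  proof
    assume b: "b = 0"
    have "fourier_coeff (\<lambda>t. g t * f t) m = 0" if "- k \<le> m" for m
      using zero[of m] b that by (cases "m = - k") (auto simp: b_def)
    then have "f \<in> kernel k" using fH by (simp add: kernel_def)
    then show False using f(2) assms(1) injective_iff by blast
  qed
  have "fourier_coeff (\<lambda>t. A k t * (1 / b * f t)) n = (if n = 0 then 1 else 0)" if "0 \<le> n" for n
  proof -
    have "fourier_coeff (\<lambda>t. A k t * (1 / b * f t)) n = 1 / b * fourier_coeff (\<lambda>t. A k t * f t) n"
      using fourier_coeff_scale[of "1 / b" "\<lambda>t. A k t * f t" n] by (simp add: mult.left_commute)
    then show ?thesis using zero[of "n - k"] that \<open>b \<noteq> 0\<close> unfolding coeff_A by (cases "n = 0") (auto simp: b_def)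
  qed
  then show ?thesis by (intro bexI[OF _ Hp_scale[OF fH, of "1 / b"]]) simp
qed

end

section \<open>Range, kernel and index at the critical shift\<close>

locale critical_fredholm = fredholm_matching +
  fixes k :: int and f :: "complex \<Rightarrow> complex"
  assumes inj: "toeplitz_injective p (A k)" and f: "f \<in> Hp p"
    and one: "\<And>n. 0 \<le> n \<Longrightarrow> fourier_coeff (\<lambda>t. A k t * f t) n = (if n = 0 then 1 else 0)"
begin

text \<open>The number of powers of \<open>t\<close> that complement the range of T(g); it is 0
  unless \<open>k\<close> is negative.\<close>

definition M :: nat where "M = nat (- k)"

lemma f0: "fourier_coeff f 0 \<noteq> 0"
  using matching_normalized_solution(1)[OF p A_Linf A_matching inj f one] by auto

lemma f_not_null: "\<not> (AE t in \<mu>. f t = 0)"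
proof
  assume "AE t in \<mu>. f t = 0"
  then have "fourier_coeff f 0 = fourier_coeff (\<lambda>t. 0) 0"
    using Hp_measurable[OF f] by (intro fourier_coeff_cong_AE) auto
  then show False using f0 by simp
qed

text \<open>The highest coefficient of the product is 1 and sits at index \<open>j - k\<close>, so
  the images of the functions \<open>t powi j * f t\<close> form a triangular system.\<close>

lemma coeff_power_f: "- k \<le> n - j \<Longrightarrow> fourier_coeff (\<lambda>t. g t * (t powi j * f t)) n = (if n = j - k then 1 else 0)"
  using one[of "n - j + k"] unfolding coeff_shift coeff_A by (auto simp: algebra_simps)

text \<open>The top coefficient, at index \<open>N\<close>, is removed: for \<open>N < M\<close> by
  the power of \<open>t\<close> itself, otherwise by the image of a multiple of
  \<open>t powi (int N + k) * f t\<close>, whose exponent is nonnegative exactly then.\<close>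

lemma finite_coeffs_in_extended_range:
  "h \<in> Hp p \<Longrightarrow> (\<forall>n\<ge>int N. fourier_coeff h n = 0) \<Longrightarrow>
    \<exists>c. (\<lambda>t. h t - (\<Sum>i<M. c i * t powi int i)) \<in> range_op p (toeplitz p g)"
proof (induction N arbitrary: h)
  case 0
  then have "fourier_coeff h n = 0" for n by (cases "0 \<le> n") (auto simp: HpD(2))
  then show ?case
    using 0 unfolding range_toeplitz by (intro exI[of _ "\<lambda>_. 0"]) (auto intro!: bexI[OF _ Hp_zero])
next
  case (Suc N)
  define b where "b = fourier_coeff h (int N)"
  show ?case
  proof (cases "N < M")
    case True
    define h' where "h' = (\<lambda>t. h t - b * t powi int N)"
    have h': "h' \<in> Hp p" unfolding h'_def by (intro Hp_diff p1 Suc.prems Hp_scale power_in_Hp)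
    have "fourier_coeff h' n = 0" if "int N \<le> n" for n
      using Suc.prems(2)[rule_format, of n] that Hp_integrable[OF p1(1) Suc.prems(1)] integrable_powi_const[of b "int N"]
      by (cases "n = int N")
         (auto simp: h'_def fourier_coeff_diff fourier_coeff_scale fourier_coeff_powi b_def)
    then obtain c where c: "(\<lambda>t. h' t - (\<Sum>i<M. c i * t powi int i)) \<in> range_op p (toeplitz p g)"
      using Suc.IH[OF h'] by blast
    have "(\<Sum>i<M. (c(N := c N + b)) i * t powi int i) = (\<Sum>i<M. c i * t powi int i) + b * t powi int N" for t :: complex
    proof -
      have "(\<Sum>i<M. (c(N := c N + b)) i * t powi int i) = (\<Sum>i<M. c i * t powi int i + (if i = N then b * t powi int N else 0))"
        by (intro sum.cong) (auto simp: distrib_right)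
      then show ?thesis using True by (simp add: sum.distrib)
    qed
    then have "(\<lambda>t. h t - (\<Sum>i<M. (c(N := c N + b)) i * t powi int i)) = (\<lambda>t. h' t - (\<Sum>i<M. c i * t powi int i))"
      by (simp only: h'_def) (simp add: algebra_simps)
    then show ?thesis using c by (intro exI[of _ "c(N := c N + b)"]) (simp only:)
  next
    case False
    define s where "s = int N + k"
    have s: "0 \<le> s" using False by (auto simp: s_def M_def)
    define x where "x = (\<lambda>t. b * (t powi s * f t))"
    have x: "x \<in> Hp p" unfolding x_def by (intro Hp_scale Hp_powi_mult p1 f s)
    define r where "r = toeplitz p g x"
    have r: "r \<in> Hp p" unfolding r_def by (rule toeplitz_in_Hp[OF p g(1) x])
    have rc: "fourier_coeff r n = fourier_coeff (\<lambda>t. g t * x t) n" if "0 \<le> n" for n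
      unfolding r_def by (rule fourier_coeff_toeplitz[OF p g(1) x that])
    have rR: "r \<in> range_op p (toeplitz p g)" unfolding range_toeplitz using r x rc by auto
    have gx: "fourier_coeff (\<lambda>t. g t * x t) n = b * fourier_coeff (\<lambda>t. g t * (t powi s * f t)) n" for n
      using fourier_coeff_scale[of b "\<lambda>t. g t * (t powi s * f t)" n] by (simp add: x_def mult.left_commute)
    define h' where "h' = (\<lambda>t. h t - r t)"
    have h': "h' \<in> Hp p" unfolding h'_def by (intro Hp_diff p1 Suc.prems r)
    have "fourier_coeff h' n = 0" if n: "int N \<le> n" for n
    proof -
      have "fourier_coeff r n = (if n = int N then b else 0)"
        using rc[of n] gx[of n] coeff_power_f[of n s] n by (auto simp: s_def)
      then show ?thesis
        using Suc.prems(2)[rule_format, of n] n Hp_integrable[OF p1(1) Suc.prems(1)] Hp_integrable[OF p1(1) r]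
        by (cases "n = int N") (auto simp: h'_def fourier_coeff_diff b_def)
    qed
    then obtain c where c: "(\<lambda>t. h' t - (\<Sum>i<M. c i * t powi int i)) \<in> range_op p (toeplitz p g)"
      using Suc.IH[OF h'] by blast
    have "(\<lambda>t. (h' t - (\<Sum>i<M. c i * t powi int i)) + r t) \<in> range_op p (toeplitz p g)"
      by (rule lin_subspaceD(2)[OF lin_range c rR])
    then have "(\<lambda>t. h t - (\<Sum>i<M. c i * t powi int i)) \<in> range_op p (toeplitz p g)"
      by (simp add: h'_def algebra_simps)
    then show ?thesis by blast
  qed
qed

text \<open>The polynomials lie in the extended range and are dense, and the extended range is
  closed because the range is closed and only finitely many powers are added.\<close>

lemma extended_range:
  assumes h: "h \<in> Hp p"
  shows "\<exists>c. (\<lambda>t. h t - (\<Sum>i<M. c i * t powi int i)) \<in> range_op p (toeplitz p g)"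
proof -
  define S where "S = {h \<in> Hp p. \<exists>c. (\<lambda>t. h t - (\<Sum>i<M. c i * t powi int i)) \<in> range_op p (toeplitz p g)}"
  have closed: "Lp_closed_in_Hp p S"
    using Lp_closed_add_powers[OF p1(1) lin_range, of M] fredholm
    by (auto simp: S_def fredholm_def range_op_def)
  have poly: "poly a \<in> S" for a
    unfolding S_def using finite_coeffs_in_extended_range[OF poly_in_Hp[OF p1(2)], of "Suc (degree a)" a] poly_in_Hp[OF p1(2)]
    by (auto simp: fourier_coeff_poly coeff_eq_0)
  have "\<exists>a. Lp_norm p (\<lambda>t. h t - poly a t) < inverse (real (Suc k))" for k
    by (rule Hp_poly_dense[OF p h]) simp
  then obtain a where a: "\<And>k. Lp_norm p (\<lambda>t. h t - poly (a k) t) < inverse (real (Suc k))" by metis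
  have "norm (Lp_norm p (\<lambda>t. poly (a k) t - h t)) \<le> inverse (real (Suc k))" for k
    using a[of k] Lp_norm_minus_commute[of p h "poly (a k)"] by simp
  then have "(\<lambda>k. Lp_norm p (\<lambda>t. poly (a k) t - h t)) \<longlonglongrightarrow> 0"
    by (intro Lim_null_comparison[OF always_eventually[OF allI] LIMSEQ_inverse_real_of_nat])
  then have "h \<in> S" by (rule Lp_closedD[OF closed h poly])
  then show ?thesis by (simp add: S_def)
qed

text \<open>Since \<open>f\<close> has a nonzero value at 0, the functions
  \<open>t powi int j * f t\<close> begin with successive powers of \<open>t\<close> and remove the
  low coefficients one after another.\<close>

lemma eliminate_coeffs:
  assumes x: "x \<in> Hp p"
  shows "\<exists>e. \<forall>n<int N. fourier_coeff (\<lambda>t. x t - (\<Sum>j<N. e j * (t powi int j * f t))) n = 0"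
proof (induction N)
  case 0
  then show ?case using HpD(2)[OF x] by simp
next
  case (Suc N)
  then obtain e where e: "\<And>n. n < int N \<Longrightarrow> fourier_coeff (\<lambda>t. x t - (\<Sum>j<N. e j * (t powi int j * f t))) n = 0" by blast
  define y where "y = (\<lambda>t. x t - (\<Sum>j<N. e j * (t powi int j * f t)))"
  have y: "y \<in> Hp p" unfolding y_def by (intro Hp_diff p1 x sum_in_Hp powers_in_Hp f)
  define b where "b = fourier_coeff y (int N) / fourier_coeff f 0"
  have sum: "(\<Sum>j<Suc N. (e(N := b)) j * (t powi int j * f t)) = (\<Sum>j<N. e j * (t powi int j * f t)) + b * (t powi int N * f t)" for t
    by simp
  have eq: "(\<lambda>t. x t - (\<Sum>j<Suc N. (e(N := b)) j * (t powi int j * f t))) = (\<lambda>t. y t - b * (t powi int N * f t))"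
    unfolding sum by (simp add: y_def algebra_simps)
  have "fourier_coeff (\<lambda>t. y t - b * (t powi int N * f t)) n = fourier_coeff y n - b * fourier_coeff f (n - int N)" for n
    using Hp_integrable[OF p1(1) y] Hp_integrable[OF p1(1) Hp_scale[OF powers_in_Hp[OF f]], of b N]
    by (simp only: fourier_coeff_diff fourier_coeff_scale fourier_coeff_powi_mult)
  moreover have "fourier_coeff y n - b * fourier_coeff f (n - int N) = 0" if "n < int (Suc N)" for n
    using that e[of n] HpD(2)[OF f, of "n - int N"] f0 by (cases "n = int N") (auto simp: y_def[symmetric] b_def)
  ultimately show ?case unfolding eq[symmetric] by (intro exI[of _ "e(N := b)"]) simp
qed

lemma coeff_g_power_sum:
  "k = int N \<Longrightarrow> 0 \<le> n \<Longrightarrow> fourier_coeff (\<lambda>t. g t * (\<Sum>j<N. e j * (t powi int j * f t))) n = 0"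
  by (subst coeff_g_sum) (auto intro!: powers_in_Hp f sum.neutral simp: coeff_power_f)

text \<open>For \<open>k \<ge> 0\<close> the functions \<open>t powi int j * f t\<close> with
  \<open>j < k\<close> lie in the kernel of T(g). Subtracting them makes \<open>x\<close> divisible
  by \<open>t powi k\<close> without changing its image, so solutions for T(g) become solutions for
  the shifted symbol.\<close>

lemma divide_power:
  assumes k: "k = int N" and x: "x \<in> Hp p"
  shows "\<exists>e. \<exists>x'\<in>Hp p. (\<forall>n\<ge>0. fourier_coeff (\<lambda>t. A k t * x' t) n = fourier_coeff (\<lambda>t. g t * x t) n) \<and>
    (AE t in \<mu>. x t - (\<Sum>j<N. e j * (t powi int j * f t)) = t powi k * x' t)"
proof -
  obtain e where e: "\<And>n. n < int N \<Longrightarrow> fourier_coeff (\<lambda>t. x t - (\<Sum>j<N. e j * (t powi int j * f t))) n = 0"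
    using eliminate_coeffs[OF x] by blast
  define s where "s = (\<lambda>t. \<Sum>j<N. e j * (t powi int j * f t))"
  have s: "s \<in> Hp p" unfolding s_def by (intro sum_in_Hp powers_in_Hp f)
  have xs: "(\<lambda>t. x t - s t) \<in> Hp p" by (intro Hp_diff p1 x s)
  define x' where "x' = (\<lambda>t. t powi (- k) * (x t - s t))"
  have x': "x' \<in> Hp p" unfolding x'_def using e k by (intro Hp_powi_div p1 xs) (simp add: s_def)
  have AE: "AE t in \<mu>. x t - s t = t powi k * x' t"
    using AE_circle_nonzero by eventually_elim (simp add: x'_def power_int_minus)
  have "fourier_coeff (\<lambda>t. A k t * x' t) n = fourier_coeff (\<lambda>t. g t * x t) n" if n: "0 \<le> n" for n
  proof -
    have "fourier_coeff (\<lambda>t. A k t * x' t) n = fourier_coeff (\<lambda>t. g t * (x t - s t)) n"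
    proof (rule fourier_coeff_cong_AE)
      show "AE t in \<mu>. A k t * x' t = g t * (x t - s t)"
        using AE by eventually_elim (simp add: A_def)
    qed (rule LpD(1)[OF Linf_mult_Hp[OF p A_Linf x']] LpD(1)[OF Linf_mult_Hp[OF p g(1) xs]])+
    also have "\<dots> = fourier_coeff (\<lambda>t. g t * x t) n - fourier_coeff (\<lambda>t. g t * s t) n"
      using Linf_mult_integrable[OF p g(1) x] Linf_mult_integrable[OF p g(1) s]
      by (simp add: right_diff_distrib fourier_coeff_diff)
    also have "fourier_coeff (\<lambda>t. g t * s t) n = 0" unfolding s_def by (rule coeff_g_power_sum[OF k n])
    finally show ?thesis by simp
  qed
  then show ?thesis using x' AE unfolding s_def by blast
qed

text \<open>For \<open>k \<ge> 0\<close> a solution for T(g) is divided by \<open>t powi k\<close>.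
  For \<open>k < 0\<close> the equation is solved with right side \<open>t powi int M * y t\<close>,
  up to powers below \<open>M\<close>, and the shift drops these.\<close>

lemma surj: "toeplitz_surjective p (A k)"
  unfolding toeplitz_surjective_def
proof
  fix y assume y: "y \<in> Hp p"
  show "\<exists>x\<in>Hp p. \<forall>n\<ge>0. fourier_coeff (\<lambda>t. A k t * x t) n = fourier_coeff y n"
  proof (cases "0 \<le> k")
    case True
    then obtain N where N: "k = int N" by (rule nonneg_int_cases)
    have "M = 0" unfolding M_def unfolding N by simp
    then obtain x where x: "x \<in> Hp p" "\<forall>n\<ge>0. fourier_coeff (\<lambda>t. g t * x t) n = fourier_coeff y n"
      using extended_range[OF y] unfolding range_toeplitz by auto
    then show ?thesis using divide_power[OF N x(1)] by auto
  next
    case False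
    then have M: "int M = - k" by (simp add: M_def)
    define h where "h = (\<lambda>t. t powi int M * y t)"
    have h: "h \<in> Hp p" unfolding h_def by (rule powers_in_Hp[OF y])
    obtain c x where x: "x \<in> Hp p" "\<And>n. 0 \<le> n \<Longrightarrow> fourier_coeff (\<lambda>t. g t * x t) n = fourier_coeff (\<lambda>t. h t - (\<Sum>i<M. c i * t powi int i)) n"
      using extended_range[OF h] unfolding range_toeplitz by blast
    have "fourier_coeff (\<lambda>t. A k t * x t) n = fourier_coeff y n" if n: "0 \<le> n" for n
    proof -
      have "fourier_coeff (\<lambda>t. A k t * x t) n = fourier_coeff (\<lambda>t. h t - (\<Sum>i<M. c i * t powi int i)) (n + int M)"
      proof -
        have "n - k = n + int M" using M by simp
        then show ?thesis unfolding coeff_A using n by (simp only:) (rule x(2), simp)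
      qed
      also have "\<dots> = fourier_coeff h (n + int M) - (\<Sum>i<M. c i * fourier_coeff (\<lambda>t. t powi int i) (n + int M))"
      proof -
        have i: "integrable \<mu> (\<lambda>t. c i * t powi int i)" for i by (rule integrable_powi_const)
        then have "integrable \<mu> (\<lambda>t. \<Sum>i<M. c i * t powi int i)" by (intro Bochner_Integration.integrable_sum)
        then show ?thesis using i Hp_integrable[OF p1(1) h]
          by (simp only: fourier_coeff_diff fourier_coeff_sum fourier_coeff_scale)
      qed
      also have "(\<Sum>i<M. c i * fourier_coeff (\<lambda>t. t powi int i) (n + int M)) = 0"
        using n by (intro sum.neutral) (auto simp: fourier_coeff_powi)
      also have "fourier_coeff h (n + int M) = fourier_coeff y n"
        unfolding h_def fourier_coeff_powi_mult by simp
      finally show ?thesis by simp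
    qed
    then show ?thesis using x(1) by blast
  qed
qed

text \<open>For \<open>k \<ge> 0\<close> the range is everything and the functions
  \<open>t powi int j * f t\<close>, \<open>j < k\<close>, form a basis of the kernel. For
  \<open>k < 0\<close> the kernel is trivial and the powers of \<open>t\<close> below
  \<open>- k\<close> form a basis of the cokernel.\<close>

lemma index: "fredholm_index p (toeplitz p g) = k"
proof (cases "0 \<le> k")
  case True
  then obtain N where N: "k = int N" by (rule nonneg_int_cases)
  have M: "M = 0" unfolding M_def unfolding N by simp
  have "dim_quot (Hp p) (range_op p (toeplitz p g)) = 0"
    using extended_range M by (intro dim_quot_eqI[OF lin_range, where b = "\<lambda>_ _. 0"]) auto
  moreover have "dim_quot (ker_op p (toeplitz p g)) null_funs = N"
  proof (rule dim_quot_eqI[OF lin_null, where b = "\<lambda>j t. t powi int j * f t"])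
    show "(\<lambda>t. t powi int j * f t) \<in> ker_op p (toeplitz p g)" if "j < N" for j
      unfolding ker_toeplitz using powers_in_Hp[OF f] that N by (auto simp: coeff_power_f)
    show "c j = 0" if "(\<lambda>t. \<Sum>j<N. c j * (t powi int j * f t)) \<in> null_funs" "j < N" for c j
      by (rule powers_independent[OF f f_not_null that])
    fix x assume "x \<in> ker_op p (toeplitz p g)"
    then have x: "x \<in> Hp p" "\<And>n. 0 \<le> n \<Longrightarrow> fourier_coeff (\<lambda>t. g t * x t) n = 0" by (auto simp: ker_toeplitz)
    obtain e x' where x': "x' \<in> Hp p" "\<forall>n\<ge>0. fourier_coeff (\<lambda>t. A k t * x' t) n = fourier_coeff (\<lambda>t. g t * x t) n"
      "AE t in \<mu>. x t - (\<Sum>j<N. e j * (t powi int j * f t)) = t powi k * x' t"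
      using divide_power[OF N x(1)] by blast
    have "AE t in \<mu>. x' t = 0" using inj x' x(2) by (simp add: toeplitz_injective_def)
    with x'(3) have "AE t in \<mu>. x t - (\<Sum>j<N. e j * (t powi int j * f t)) = 0" by eventually_elim simp
    moreover have "(\<lambda>t. x t - (\<Sum>j<N. e j * (t powi int j * f t))) \<in> Hp p"
      by (intro Hp_diff p1 x(1) sum_in_Hp powers_in_Hp f)
    ultimately show "\<exists>c. (\<lambda>t. x t - (\<Sum>j<N. c j * (t powi int j * f t))) \<in> null_funs"
      using Hp_measurable unfolding null_funs_def by blast
  qed
  ultimately show ?thesis by (simp add: fredholm_index_def N)
next
  case False
  then have M: "int M = - k" by (simp add: M_def)
  have null: "AE t in \<mu>. x t = 0" if "x \<in> kernel k" for x
    using inj that injective_iff by blast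
  have "dim_quot (ker_op p (toeplitz p g)) null_funs = 0"
  proof (rule dim_quot_eqI[OF lin_null, where b = "\<lambda>_ _. 0"])
    fix x assume "x \<in> ker_op p (toeplitz p g)"
    then have x: "x \<in> Hp p" "x \<in> kernel k" using False by (auto simp: ker_toeplitz kernel_def)
    then show "\<exists>c. (\<lambda>t. x t - (\<Sum>j<0. c j * 0)) \<in> null_funs"
      using null Hp_measurable by (simp add: null_funs_def)
  qed auto
  moreover have "dim_quot (Hp p) (range_op p (toeplitz p g)) = M"
  proof (rule dim_quot_eqI[OF lin_range, where b = "\<lambda>i t. t powi int i"])
    show "(\<lambda>t. t powi int j) \<in> Hp p" for j by (rule power_in_Hp)
    show "\<exists>c. (\<lambda>t. h t - (\<Sum>i<M. c i * t powi int i)) \<in> range_op p (toeplitz p g)" if "h \<in> Hp p" for h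
      by (rule extended_range[OF that])
    fix c j assume "(\<lambda>t. \<Sum>j<M. c j * t powi int j) \<in> range_op p (toeplitz p g)" and j: "j < M"
    then obtain x where x: "x \<in> Hp p" "\<And>n. 0 \<le> n \<Longrightarrow> fourier_coeff (\<lambda>t. g t * x t) n = fourier_coeff (\<lambda>t. \<Sum>j<M. c j * t powi int j) n"
      unfolding range_toeplitz by blast
    have coeff: "fourier_coeff (\<lambda>t. \<Sum>j<M. c j * t powi int j) n = (\<Sum>j<M. if n = int j then c j else 0)" for n
    proof -
      have "fourier_coeff (\<lambda>t. \<Sum>j<M. c j * t powi int j) n = (\<Sum>j<M. c j * fourier_coeff (\<lambda>t. t powi int j) n)"
        by (subst fourier_coeff_sum) (simp_all only: integrable_powi_const fourier_coeff_scale)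
      also have "\<dots> = (\<Sum>j<M. if n = int j then c j else 0)"
        by (intro sum.cong refl) (simp only: fourier_coeff_powi split: if_splits, simp)
      finally show ?thesis .
    qed
    \<comment> \<open>A combination of these powers stops below index \<open>M\<close>, so a
      preimage \<open>x\<close> would lie in \<open>kernel k\<close>, which is trivial.\<close>
    have "fourier_coeff (\<lambda>t. g t * x t) m = 0" if "int M \<le> m" for m
      using x(2)[of m] that unfolding coeff by (auto intro!: sum.neutral)
    then have "x \<in> kernel k" using x(1) M by (simp add: kernel_def)
    from null[OF this] have AE: "AE t in \<mu>. g t * x t = 0" by eventually_elim simp
    have "fourier_coeff (\<lambda>t. g t * x t) (int j) = fourier_coeff (\<lambda>t. 0) (int j)"
      by (rule fourier_coeff_cong_AE[OF LpD(1)[OF Linf_mult_Hp[OF p g(1) x(1)]] _ AE]) simp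
    then show "c j = 0" using x(2)[of "int j"] j unfolding coeff by simp
  qed
  ultimately show ?thesis using M by (simp add: fredholm_index_def)
qed

lemma invertible: "invertible_matching p (conj_exponent p) (A k) f"
  by unfold_locales (use p A_Linf A_matching inj surj f one in auto)

end

context fredholm_matching
begin

theorem invertible_at_index:
  "\<exists>f. invertible_matching p (conj_exponent p) (\<lambda>t. t powi fredholm_index p (toeplitz p g) * g t) f"
proof -
  obtain k where k: "toeplitz_injective p (A k)" "\<not> toeplitz_injective p (A (k - 1))"
    using critical_shift by blast
  obtain f where f: "f \<in> Hp p" "\<forall>n\<ge>0. fourier_coeff (\<lambda>t. A k t * f t) n = (if n = 0 then 1 else 0)"
    using normalized_solution[OF k] by blast
  interpret critical_fredholm p g k f
    by unfold_locales (use k f in auto)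
  have "A k = (\<lambda>t. t powi fredholm_index p (toeplitz p g) * g t)" by (simp add: fun_eq_iff A_def index)
  then show ?thesis using invertible by metis
qed

end

section \<open>The signature at a point of continuity\<close>

lemma AE_circle_neq: "AE t in \<mu>. t \<noteq> z"
proof -
  have "{t \<in> space (restrict_space borel circle). t \<noteq> z} \<in> sets (restrict_space borel circle)"
    using borel_singleton[of "UNIV - {z}"] by (auto simp: sets_restrict_space space_restrict_space image_iff intro!: bexI[of _ "- {z}"])
  from AE_distr_iff[OF measurable_cis_circle this]
  have "(AE t in \<mu>. t \<noteq> z) \<longleftrightarrow> (AE x in uniform_measure lborel {- pi<..pi}. cis x \<noteq> z)"
    unfolding circle_measure_def .
  moreover have "AE x in lborel. x \<in> {- pi<..pi} \<longrightarrow> cis x \<noteq> z"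
    using AE_lborel_singleton[of "Arg z"]
  proof eventually_elim
    case (elim x)
    then show ?case using Arg_cis[of x] by auto
  qed
  ultimately show ?thesis by (simp add: AE_uniform_measureI)
qed

text \<open>\<open>(t - z) * w = 1\<close> is a recurrence between neighbouring coefficients that
  preserves their modulus, except at index 0, where it forces two moduli to have sum at least 1.
  Approximation in L^1 by a trigonometric polynomial would make all coefficients of large index
  small.\<close>

lemma not_integrable_inverse_diff:
  assumes z: "z \<in> circle"
  shows "\<not> integrable \<mu> (\<lambda>t. 1 / (t - z))"
proof
  define w where "w = (\<lambda>t. 1 / (t - z))"
  assume "integrable \<mu> (\<lambda>t. 1 / (t - z))"
  then have w: "integrable \<mu> w" by (simp add: w_def)
  have tw: "integrable \<mu> (\<lambda>t. t powi 1 * w t)" using integrable_powi[OF w, of 1] by (simp add: mult.commute)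
  have rec: "fourier_coeff w (n - 1) - z * fourier_coeff w n = (if n = 0 then 1 else 0)" for n
  proof -
    have "fourier_coeff w (n - 1) - z * fourier_coeff w n = fourier_coeff (\<lambda>t. t powi 1 * w t - z * w t) n"
      using tw w by (subst fourier_coeff_diff) (simp_all only: fourier_coeff_scale fourier_coeff_powi_mult integrable_mult_right)
    also have "\<dots> = fourier_coeff (\<lambda>t. 1) n"
    proof (rule fourier_coeff_cong_AE)
      show "AE t in \<mu>. t powi 1 * w t - z * w t = 1"
        using AE_circle_neq[of z] by eventually_elim (simp add: w_def diff_divide_distrib[symmetric])
    qed (use tw w borel_measurable_integrable in auto)
    finally show ?thesis by (simp add: fourier_coeff_const)
  qed
  have nz: "norm z = 1" using z by simp
  have up: "norm (fourier_coeff w (int k)) = norm (fourier_coeff w 0)" for k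
  proof (induction k)
    case (Suc k)
    have "fourier_coeff w (int k) = z * fourier_coeff w (int (Suc k))" using rec[of "int (Suc k)"] by simp
    then show ?case using Suc nz by (simp add: norm_mult)
  qed simp
  have down: "norm (fourier_coeff w (- 1 - int k)) = norm (fourier_coeff w (- 1))" for k
  proof (induction k)
    case (Suc k)
    have "fourier_coeff w (- 1 - int (Suc k)) = z * fourier_coeff w (- 1 - int k)"
      using rec[of "- 1 - int k"] by (simp add: algebra_simps)
    then show ?case using Suc nz by (simp add: norm_mult)
  qed simp
  have "w \<in> Lp 1" using w by (simp add: Lp_def borel_measurable_integrable)
  then obtain u where u: "trig u" "Lp_norm 1 (\<lambda>t. w t - u t) < 1 / 4"
    using Lp_trig_approx[of 1 w "1 / 4"] by auto
  have small: "norm (fourier_coeff w n) < 1 / 4" if "fourier_coeff u n = 0" for n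
  proof -
    have uL: "u \<in> Lp 1" by (rule trig_in_Lp[OF _ u(1)]) simp
    have "norm (fourier_coeff (\<lambda>t. w t - u t) n) \<le> Lp_norm 1 (\<lambda>t. w t - u t)"
      by (intro norm_fourier_coeff_le_Lp Lp_diff(1) \<open>w \<in> Lp 1\<close> uL) simp_all
    moreover have "fourier_coeff (\<lambda>t. w t - u t) n = fourier_coeff w n"
      using w Lp_integrable(1)[OF _ uL] that by (simp add: fourier_coeff_diff)
    ultimately show ?thesis using u(2) by simp
  qed
  obtain N where N: "\<And>n. N < \<bar>n\<bar> \<Longrightarrow> fourier_coeff u n = 0"
  proof -
    have "\<exists>N. \<forall>n. N < \<bar>n\<bar> \<longrightarrow> fourier_coeff u n = 0"
      using u(1)
    proof (induction rule: trig.induct)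
      case (trig_monom c k)
      show ?case
        by (intro exI[of _ "\<bar>k\<bar>"]) (auto simp: fourier_coeff_scale fourier_coeff_powi)
    next
      case (trig_add f h)
      then obtain N1 N2 where "\<forall>n. N1 < \<bar>n\<bar> \<longrightarrow> fourier_coeff f n = 0" "\<forall>n. N2 < \<bar>n\<bar> \<longrightarrow> fourier_coeff h n = 0" by blast
      moreover have "integrable \<mu> f" "integrable \<mu> h"
        using Lp_integrable(1)[OF order_refl trig_in_Lp] trig_add(1,2) by auto
      ultimately show ?case by (intro exI[of _ "max N1 N2"]) (simp add: fourier_coeff_add)
    next
      case (trig_cong f h)
      then show ?case using fourier_coeff_cong_circle[of h f] by simp
    qed
    then show ?thesis using that by blast
  qed
  have "norm (fourier_coeff w 0) < 1 / 4"
    using small[OF N, of "int (nat (\<bar>N\<bar> + 1))"] up[of "nat (\<bar>N\<bar> + 1)"] by simp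
  moreover have "norm (fourier_coeff w (- 1)) < 1 / 4"
    using small[OF N, of "- 1 - int (nat (\<bar>N\<bar> + 1))"] down[of "nat (\<bar>N\<bar> + 1)"] by simp
  moreover have "1 \<le> norm (fourier_coeff w (- 1)) + norm (z * fourier_coeff w 0)"
    using norm_triangle_ineq4[of "fourier_coeff w (- 1)" "z * fourier_coeff w 0"] rec[of 0] by simp
  ultimately show False using nz by (simp add: norm_mult)
qed

text \<open>Otherwise \<open>1 / (t - z)\<close> would be bounded, hence integrable. Thus a property
  that holds almost everywhere is met arbitrarily close to \<open>z\<close>.\<close>

lemma near_not_null:
  assumes z: "z \<in> circle" and d: "0 < d"
  shows "\<not> (AE t in \<mu>. d \<le> norm (t - z))"
proof
  assume AE: "AE t in \<mu>. d \<le> norm (t - z)"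
  have "integrable \<mu> (\<lambda>t. 1 / (t - z))"
  proof (rule circle.integrable_const_bound[where B = "1 / d"])
    show "AE t in \<mu>. norm (1 / (t - z)) \<le> 1 / d"
      using AE by eventually_elim (use d in \<open>simp add: norm_divide frac_le\<close>)
  qed measurable
  then show False using not_integrable_inverse_diff[OF z] by simp
qed

lemma inversion_diff:
  assumes "z = 1 \<or> z = (-1::complex)" "t \<in> circle"
  shows "1 / t - z = - z * (t - z) / t" "norm (1 / t - z) = norm (t - z)"
proof -
  show eq: "1 / t - z = - z * (t - z) / t" using assms(1) circle_nonzero[OF assms(2)] by (auto simp: field_simps)
  show "norm (1 / t - z) = norm (t - z)"
    unfolding eq using assms by (auto simp: norm_mult norm_divide)
qed

context invertible_matching
begin

text \<open>
  Suppose \<open>a = - c\<close> near \<open>z\<close>. Then \<open>s = f + reflect f\<close> vanishes near \<open>z\<close>, so \<open>w = s / (t - z)\<close> is in \<open>L\<^sup>p\<close>,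
  and, \<open>s\<close> being even, \<open>f = (t - z) P w\<close>. Since \<open>1 / f\<close> is in \<open>L\<^sup>q\<close>, so that \<open>(P w) / f\<close> is integrable,
  \<open>1 / (t - z)\<close> would be integrable.
\<close>

lemma not_locally_minus_c:
  assumes z: "z = 1 \<or> z = -1" and d: "0 < d"
    and loc: "AE t in \<mu>. norm (t - z) < d \<longrightarrow> a t = - c"
  shows False
proof -
  have zc: "z \<in> circle" and zz: "z * z = 1" using z by auto
  define s where "s = (\<lambda>t. f t + reflect f t)"
  \<comment> \<open>Near \<open>z\<close> the numerator vanishes almost everywhere, and away from
    \<open>z\<close> the division is bounded; so \<open>w\<close> is in L^p.\<close>
  define w where "w = (\<lambda>t. if norm (t - z) < d then 0 else s t / (t - z))"
  have rf: "reflect f \<in> Lp p" by (rule Lp_norm_reflect(1)[OF HpD(1)[OF f]])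
  have s: "s \<in> Lp p" unfolding s_def by (intro Lp_add(1) exponents HpD(1)[OF f] rf)
  note [measurable] = LpD(1)[OF s]
  have [measurable]: "w \<in> borel_measurable \<mu>" unfolding w_def by measurable
  have w: "w \<in> Lp p"
  proof (rule Lp_dominated(1)[OF exponents(2) s])
    show "AE t in \<mu>. norm (w t) \<le> 1 / d * norm (s t)"
    proof (rule AE_I2)
      fix t
      show "norm (w t) \<le> 1 / d * norm (s t)"
      proof (cases "norm (t - z) < d")
        case False
        then have "norm (s t) / norm (t - z) \<le> norm (s t) / d" using d by (intro frac_le) auto
        then show ?thesis using False by (simp add: w_def norm_divide)
      qed (use d in \<open>simp add: w_def\<close>)
    qed
  qed (use d in auto)
  have sw: "AE t in \<mu>. s t = t powi 1 * w t - z * w t"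
    using loc AE_matching
  proof eventually_elim
    case (elim t)
    show ?case
    proof (cases "norm (t - z) < d")
      case True
      then have "- c * f t = c * reflect f t" using elim by simp
      from this[symmetric] have "c * s t = 0" by (simp add: s_def distrib_left)
      then have "s t = 0" using c_cases by auto
      then show ?thesis using True by (simp add: w_def)
    next
      case False
      then have "t \<noteq> z" using d by auto
      then have "(t - z) * w t = s t" using False by (simp add: w_def)
      from this[symmetric] show ?thesis by (simp add: left_diff_distrib)
    qed
  qed
  have wi: "integrable \<mu> w" and twi: "integrable \<mu> (\<lambda>t. t powi 1 * w t)"
    by (rule Lp_integrable(1)[OF exponents(1) w], rule Lp_integrable(1)[OF exponents(1) Lp_powi_mult[OF exponents(2) w]])
  have coeff_sw: "fourier_coeff s n = fourier_coeff w (n - 1) - z * fourier_coeff w n" for n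
  proof -
    have "fourier_coeff s n = fourier_coeff (\<lambda>t. t powi 1 * w t - z * w t) n"
      by (rule fourier_coeff_cong_AE[OF _ _ sw]) measurable
    also have "\<dots> = fourier_coeff w (n - 1) - z * fourier_coeff w n"
      using wi twi by (subst fourier_coeff_diff) (simp_all only: fourier_coeff_scale fourier_coeff_powi_mult integrable_mult_right)
    finally show ?thesis .
  qed
  have coeff_s: "fourier_coeff s n = fourier_coeff f n + fourier_coeff f (- n)" for n
    using Hp_integrable[OF exponents(1) f] Lp_integrable(1)[OF exponents(1) rf]
    by (simp add: s_def fourier_coeff_add fourier_coeff_reflect)
  \<comment> \<open>\<open>s\<close> is invariant under inversion and
    \<open>1 / t - z = - z * (t - z) / t\<close>, hence \<open>reflect w\<close> is
    \<open>- z * t * w\<close>; the coefficients of index 0 are compared.\<close>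
  have parity: "fourier_coeff w 0 = - z * fourier_coeff w (- 1)"
  proof -
    have "fourier_coeff w 0 = fourier_coeff (reflect w) 0" by (simp add: fourier_coeff_reflect)
    also have "\<dots> = fourier_coeff (\<lambda>t. - z * (t powi 1 * w t)) 0"
    proof (rule fourier_coeff_cong_circle)
      fix t :: complex assume t: "t \<in> circle"
      have rs: "s (1 / t) = s t" by (simp add: s_def reflect_def)
      have cancel: "S / (- z * u / t) = - z * (t * (S / u))" for S u using z by (elim disjE) simp_all
      show "reflect w t = - z * (t powi 1 * w t)"
      proof (cases "norm (t - z) < d")
        case False
        have "reflect w t = s t / (- z * (t - z) / t)"
          using False inversion_diff[OF z t] rs by (simp add: reflect_def w_def)
        also have "\<dots> = - z * (t * (s t / (t - z)))" by (rule cancel)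
        finally show ?thesis using False by (simp add: w_def)
      qed (use inversion_diff(2)[OF z t] in \<open>simp add: reflect_def w_def\<close>)
    qed
    also have "\<dots> = - z * fourier_coeff w (- 1)"
      unfolding fourier_coeff_scale fourier_coeff_powi_mult by simp
    finally show ?thesis .
  qed
  define y where "y = riesz_proj p w"
  note y = riesz_proj[OF p w, folded y_def]
  have tyi: "integrable \<mu> (\<lambda>t. t powi 1 * y t)"
    by (rule Lp_integrable(1)[OF exponents(1) Lp_powi_mult[OF exponents(2) HpD(1)[OF y(1)]]])
  have ty: "(\<lambda>t. t powi 1 * y t - z * y t) \<in> Hp p"
    by (intro Hp_diff exponents Hp_powi_mult Hp_scale y(1)) simp
  have "AE t in \<mu>. f t = t powi 1 * y t - z * y t"
  proof (rule Hp_unique[OF exponents(1) exponents(1) f ty])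
    fix n :: int assume n: "0 \<le> n"
    have "fourier_coeff (\<lambda>t. t powi 1 * y t - z * y t) n = fourier_coeff y (n - 1) - z * fourier_coeff y n"
      using tyi Hp_integrable[OF exponents(1) y(1)]
      by (subst fourier_coeff_diff) (simp_all only: fourier_coeff_scale fourier_coeff_powi_mult integrable_mult_right)
    also have "\<dots> = fourier_coeff f n"
    proof (cases "n = 0")
      \<comment> \<open>The projection drops the coefficient of \<open>w\<close> of index -1, which
        by parity equals the retained term \<open>- z * fourier_coeff w 0\<close>. On the other side
        \<open>s\<close> contains the constant term of \<open>f\<close> twice, so both sides are
        halved.\<close>
      case True
      have "fourier_coeff w (- 1) = - z * fourier_coeff w 0"
        using zz by (simp add: parity mult.assoc[symmetric])
      then have "2 * fourier_coeff f 0 = - 2 * (z * fourier_coeff w 0)"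
        using coeff_sw[of 0] coeff_s[of 0] by simp
      then have "fourier_coeff f 0 = - (z * fourier_coeff w 0)" by (simp add: field_simps)
      then show ?thesis using True y(2)[of 0] HpD(2)[OF y(1), of "- 1"] by simp
    next
      case False
      then show ?thesis using n y(2)[of n] y(2)[of "n - 1"] coeff_sw[of n] coeff_s[of n] HpD(2)[OF f, of "- n"] by simp
    qed
    finally show "fourier_coeff f n = fourier_coeff (\<lambda>t. t powi 1 * y t - z * y t) n" by simp
  qed
  then have AE: "AE t in \<mu>. y t * inverse (f t) = 1 / (t - z)"
    using AE_nonzero
  proof eventually_elim
    case (elim t)
    have ft: "f t = (t - z) * y t" using elim(1) by (simp add: left_diff_distrib)
    then have "t - z \<noteq> 0" "y t \<noteq> 0" using elim(2) by auto
    then show ?case by (simp add: ft inverse_eq_divide)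
  qed
  have "integrable \<mu> (\<lambda>t. y t * inverse (f t))"
    by (rule Lp_Hoelder(1)[OF p exponents(3,5) HpD(1)[OF y(1)] HpD(1)[OF inverse_in_Hq]])
  moreover have "(\<lambda>t. y t * inverse (f t)) \<in> borel_measurable \<mu>" "(\<lambda>t. 1 / (t - z)) \<in> borel_measurable \<mu>"
    using Hp_measurable[OF y(1)] by measurable
  ultimately have "integrable \<mu> (\<lambda>t. 1 / (t - z))"
    using integrable_cong_AE[OF _ _ AE] by simp
  then show False using not_integrable_inverse_diff[OF zc] by simp
qed

section \<open>Stability of the sign under small perturbations\<close>

lemma perturbation:
  "\<exists>e>0. \<forall>b. b \<in> Linf \<longrightarrow> matching b \<longrightarrow> (AE t in \<mu>. norm (a t - b t) \<le> e) \<longrightarrow>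
    (\<exists>h. invertible_matching p q b h \<and> fourier_coeff h 0 = c)"
proof -
  obtain C where C: "0 \<le> C" "\<And>x. x \<in> Hp p \<Longrightarrow> Lp_norm p x \<le> C * Lp_norm p (toeplitz p a x)"
    using toeplitz_bounded_below[OF p a(1) inj surj] by blast
  obtain K where K: "0 \<le> K" "\<And>b e x. 0 \<le> e \<Longrightarrow> b \<in> Linf \<Longrightarrow> AE t in \<mu>. norm (b t) \<le> e \<Longrightarrow> x \<in> Hp p \<Longrightarrow>
    Lp_norm p (toeplitz p b x) \<le> K * e * Lp_norm p x"
    using toeplitz_norm_le[OF p] by blast
  define F where "F = Lp_norm p f"
  \<comment> \<open>Chosen so that \<open>C * K * e * (F + 1) \<le> 1 / 2\<close>. As
    \<open>F + 1 \<ge> 1\<close>, this keeps T(b) bounded below and lets successive approximation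
    converge; with the factor \<open>F + 1\<close> it also keeps \<open>h\<close> within distance 1
    of \<open>f\<close>.\<close>
  define e where "e = 1 / (2 * (C * K + 1) * (F + 1))"
  have F: "0 \<le> F" by (simp add: F_def)
  have CK: "0 < C * K + 1" using C K by (simp add: add_nonneg_pos)
  have e: "0 < e" using CK F by (simp add: e_def)
  have eF: "(C * K) * e * (F + 1) \<le> 1 / 2"
  proof -
    have "(C * K) * e * (F + 1) = (C * K) / (2 * (C * K + 1))" using F by (simp add: e_def)
    also have "\<dots> \<le> 1 / 2" using CK by (simp add: divide_le_eq)
    finally show ?thesis .
  qed
  have CKe: "C * K * e \<le> 1 / 2"
  proof -
    have "C * K * e * 1 \<le> (C * K) * e * (F + 1)" using C K e F by (intro mult_left_mono) auto
    then show ?thesis using eF by simp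
  qed
  have "\<exists>h. invertible_matching p q b h \<and> fourier_coeff h 0 = c"
    if b: "b \<in> Linf" "matching b" and close: "AE t in \<mu>. norm (a t - b t) \<le> e" for b
  proof -
    define r where "r = (\<lambda>t. a t - b t)"
    have r: "r \<in> Linf"
      using close LinfD(1)[OF a(1)] LinfD(1)[OF b(1)] by (auto simp: Linf_def r_def)
    have rn: "Lp_norm p (toeplitz p r x) \<le> K * e * Lp_norm p x" if "x \<in> Hp p" for x
      using e by (intro K(2) r that) (use close in \<open>simp_all add: r_def\<close>)
    have split: "AE t in \<mu>. toeplitz p a x t - toeplitz p b x t = toeplitz p r x t" if x: "x \<in> Hp p" for x
    proof (rule Hp_unique[OF exponents(1) exponents(1) _ toeplitz_in_Hp[OF p r x]])
      show "(\<lambda>t. toeplitz p a x t - toeplitz p b x t) \<in> Hp p" by (intro Hp_diff exponents toeplitz_in_Hp p a(1) b(1) x)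
      show "fourier_coeff (\<lambda>t. toeplitz p a x t - toeplitz p b x t) n = fourier_coeff (toeplitz p r x) n" if n: "0 \<le> n" for n
        using Hp_integrable[OF exponents(1) toeplitz_in_Hp[OF p a(1) x]] Hp_integrable[OF exponents(1) toeplitz_in_Hp[OF p b(1) x]]
          Linf_mult_integrable[OF p a(1) x] Linf_mult_integrable[OF p b(1) x]
          fourier_coeff_toeplitz[OF p a(1) x n] fourier_coeff_toeplitz[OF p b(1) x n] fourier_coeff_toeplitz[OF p r x n]
        by (simp add: fourier_coeff_diff r_def left_diff_distrib)
    qed
    have split_norm: "Lp_norm p (\<lambda>t. toeplitz p a x t - toeplitz p b x t) \<le> K * e * Lp_norm p x" if x: "x \<in> Hp p" for x
    proof -
      have "Lp_norm p (\<lambda>t. toeplitz p a x t - toeplitz p b x t) = Lp_norm p (toeplitz p r x)"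
        by (rule Lp_cong_AE(2)[OF _ _ split[OF x]])
           (intro Hp_measurable[of _ p] Hp_diff exponents toeplitz_in_Hp p a(1) b(1) r x)+
      then show ?thesis using rn[OF x] by simp
    qed
    have below: "Lp_norm p x \<le> 2 * C * Lp_norm p (toeplitz p b x)" if x: "x \<in> Hp p" for x
    proof -
      have Ta: "toeplitz p a x \<in> Lp p" and Tb: "toeplitz p b x \<in> Lp p"
        using toeplitz_in_Hp[OF p _ x] a(1) b(1) HpD(1) by auto
      have "Lp_norm p (\<lambda>t. (toeplitz p a x t - toeplitz p b x t) + toeplitz p b x t)
          \<le> Lp_norm p (\<lambda>t. toeplitz p a x t - toeplitz p b x t) + Lp_norm p (toeplitz p b x)"
        by (intro Lp_add(2) Lp_diff(1) exponents Ta Tb)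
      then have "Lp_norm p (toeplitz p a x) \<le> K * e * Lp_norm p x + Lp_norm p (toeplitz p b x)"
        using split_norm[OF x] by simp
      then have "C * Lp_norm p (toeplitz p a x) \<le> C * (K * e * Lp_norm p x + Lp_norm p (toeplitz p b x))"
        using C(1) by (rule mult_left_mono)
      then have "Lp_norm p x \<le> (C * K * e) * Lp_norm p x + C * Lp_norm p (toeplitz p b x)"
        using C(2)[OF x] by (simp add: distrib_left mult.assoc)
      moreover have "(C * K * e) * Lp_norm p x \<le> 1 / 2 * Lp_norm p x"
        using CKe by (intro mult_right_mono) auto
      ultimately show ?thesis by simp
    qed
    have null: "Lp_norm p x = 0 \<longleftrightarrow> (AE t in \<mu>. x t = 0)" if "x \<in> Hp p" for x
      by (rule Lp_norm_eq_0_iff[OF exponents(2) HpD(1)[OF that]])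
    have inj_b: "toeplitz_injective p b"
      unfolding toeplitz_injective_def
    proof (intro ballI impI)
      fix x assume x: "x \<in> Hp p" and "\<forall>n\<ge>0. fourier_coeff (\<lambda>t. b t * x t) n = 0"
      then have "AE t in \<mu>. toeplitz p b x t = 0"
        by (subst toeplitz_AE_eq_iff[OF p b(1) x Hp_zero]) simp
      then have "Lp_norm p (toeplitz p b x) = 0" using null[OF toeplitz_in_Hp[OF p b(1) x]] by simp
      then have "Lp_norm p x = 0" using below[OF x] Lp_norm_nonneg[of p x] by simp
      then show "AE t in \<mu>. x t = 0" using null[OF x] by simp
    qed
    obtain L where L: "0 \<le> L" "bounded_operator (Hp p) (Lp_norm p) (toeplitz p b) L"
      using toeplitz_bounded_operator[OF p b(1)] by blast
    interpret Tb: bounded_operator "Hp p" "Lp_norm p" "toeplitz p b" L by fact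
    \<comment> \<open>The inverse of T(a) solves the equation for T(b) up to half of the norm of
      \<open>y\<close>.\<close>
    have approx: "\<exists>x\<in>Hp p. Lp_norm p x \<le> C * Lp_norm p y \<and> Lp_norm p (\<lambda>t. y t - toeplitz p b x t) \<le> Lp_norm p y / 2"
      if y: "y \<in> Hp p" for y
    proof -
      define x where "x = T_inv y"
      have x: "x \<in> Hp p" unfolding x_def by (rule T_inv(1)[OF y])
      have Ta: "AE t in \<mu>. toeplitz p a x t = y t"
        using T_inv(2)[OF y] by (subst toeplitz_AE_eq_iff[OF p a(1) x y]) (simp add: x_def)
      then have "Lp_norm p (toeplitz p a x) = Lp_norm p y"
        by (intro Lp_cong_AE(2) Hp_measurable[OF toeplitz_in_Hp[OF p a(1) x]] Hp_measurable[OF y])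
      then have xn: "Lp_norm p x \<le> C * Lp_norm p y" using C(2)[OF x] by simp
      have "Lp_norm p (\<lambda>t. y t - toeplitz p b x t) = Lp_norm p (\<lambda>t. toeplitz p a x t - toeplitz p b x t)"
      proof (rule Lp_cong_AE(2))
        show "AE t in \<mu>. y t - toeplitz p b x t = toeplitz p a x t - toeplitz p b x t"
          using Ta by eventually_elim simp
      qed (intro Hp_measurable[of _ p] Hp_diff exponents toeplitz_in_Hp p a(1) b(1) x y)+
      also have "\<dots> \<le> K * e * Lp_norm p x" by (rule split_norm[OF x])
      also have "\<dots> \<le> K * e * (C * Lp_norm p y)" using xn K e by (intro mult_left_mono) auto
      also have "\<dots> = (C * K * e) * Lp_norm p y" by simp
      also have "\<dots> \<le> 1 / 2 * Lp_norm p y" using CKe by (intro mult_right_mono) auto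
      finally show ?thesis using x xn by (intro bexI[of _ x]) auto
    qed
    have surj_b: "\<exists>x\<in>Hp p. \<forall>n\<ge>0. fourier_coeff (\<lambda>t. b t * x t) n = fourier_coeff y n" if y: "y \<in> Hp p" for y
    proof -
      obtain x where x: "x \<in> Hp p" "Lp_norm p (\<lambda>t. y t - toeplitz p b x t) = 0"
        using Tb.successive_approximation[OF approx C(1) L(1) y] by blast
      have "AE t in \<mu>. y t - toeplitz p b x t = 0"
        using null[OF Hp_diff[OF exponents(1) y Tb.maps[OF x(1)]]] x(2) by simp
      then have "AE t in \<mu>. toeplitz p b x t = y t" by eventually_elim simp
      then show ?thesis using toeplitz_AE_eq_iff[OF p b(1) x(1) y] x(1) by blast
    qed
    have one_H: "(\<lambda>t. 1) \<in> Hp p" by (rule HpI) (simp_all add: fourier_coeff_const)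
    obtain h where h: "h \<in> Hp p" "\<forall>n\<ge>0. fourier_coeff (\<lambda>t. b t * h t) n = fourier_coeff (\<lambda>t. 1) n"
      using surj_b[OF one_H] by blast
    have H: "invertible_matching p q b h"
      using p q_def b inj_b surj_b h
      by unfold_locales (auto simp: fourier_coeff_const toeplitz_surjective_def)
    interpret H: invertible_matching p q b h by (rule H)
    have hf: "(\<lambda>t. h t - f t) \<in> Hp p" by (intro Hp_diff exponents h(1) f)
    have "AE t in \<mu>. toeplitz p b (\<lambda>t. h t - f t) t = toeplitz p a f t - toeplitz p b f t"
    proof (subst toeplitz_AE_eq_iff[OF p b(1) hf])
      show "(\<lambda>t. toeplitz p a f t - toeplitz p b f t) \<in> Hp p" by (intro Hp_diff exponents toeplitz_in_Hp p a(1) b(1) f)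
      show "\<forall>n\<ge>0. fourier_coeff (\<lambda>t. b t * (h t - f t)) n = fourier_coeff (\<lambda>t. toeplitz p a f t - toeplitz p b f t) n"
        using Hp_integrable[OF exponents(1) toeplitz_in_Hp[OF p a(1) f]] Hp_integrable[OF exponents(1) toeplitz_in_Hp[OF p b(1) f]]
          Linf_mult_integrable[OF p b(1) h(1)] Linf_mult_integrable[OF p b(1) f]
          fourier_coeff_toeplitz[OF p a(1) f] fourier_coeff_toeplitz[OF p b(1) f] one H.one
        by (simp add: fourier_coeff_diff right_diff_distrib)
    qed
    then have "Lp_norm p (toeplitz p b (\<lambda>t. h t - f t)) = Lp_norm p (\<lambda>t. toeplitz p a f t - toeplitz p b f t)"
      by (intro Lp_cong_AE(2) Hp_measurable[of _ p] Hp_diff exponents toeplitz_in_Hp p a(1) b(1) f hf)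
    also have "\<dots> \<le> K * e * F" unfolding F_def by (rule split_norm[OF f])
    finally have "2 * C * Lp_norm p (toeplitz p b (\<lambda>t. h t - f t)) \<le> 2 * C * (K * e * F)"
      using C(1) by (intro mult_left_mono) auto
    then have "Lp_norm p (\<lambda>t. h t - f t) \<le> 2 * ((C * K) * e * F)"
      using below[OF hf] by (simp add: mult_ac)
    also have "\<dots> \<le> 2 * ((C * K) * e * (F + 1))"
      using C(1) K(1) e by (intro mult_left_mono) auto
    also have "\<dots> \<le> 1" using eF by simp
    finally have "norm (fourier_coeff h 0 - fourier_coeff f 0) \<le> 1"
      using norm_fourier_coeff_le_Lp[OF exponents(1) HpD(1)[OF hf], of 0]
        Hp_integrable[OF exponents(1) h(1)] Hp_integrable[OF exponents(1) f]
      by (simp add: fourier_coeff_diff)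
    \<comment> \<open>Both numbers are 1 or -1, and different signs would be at distance 2.\<close>
    then have "H.c = c" using c_cases H.c_cases by (auto simp: c_def[symmetric] H.c_def[symmetric])
    then show ?thesis using H by (auto simp: H.c_def)
  qed
  then show ?thesis using e by blast
qed

text \<open>If the square of \<open>a z\<close> were not 1, matching would fail on an arc about
  \<open>z\<close>, which inversion fixes. If \<open>a z\<close> were \<open>- c\<close>, flattening
  the symbol on a small arc would preserve the sign \<open>c\<close> and lead to the locally
  constant case, which is impossible.\<close>

lemma value_at_point:
  assumes z: "z = 1 \<or> z = -1" and cont: "continuous (at z within circle) a"
  shows "a z = c"
proof -
  have zc: "z \<in> circle" and iz: "1 / z = z" using z by auto
  have square: "a z * a z = 1"
  proof (rule ccontr)
    assume neq: "a z * a z \<noteq> 1"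
    have lim: "(a \<longlongrightarrow> a z) (at z within circle)" using cont by (simp add: continuous_within)
    have "continuous (at z within circle) (\<lambda>t. a t * a (1 / t))"
    proof (intro continuous_mult cont)
      show "continuous (at z within circle) (\<lambda>t. a (1 / t))"
      proof (rule continuous_within_compose2[where f = "\<lambda>t. 1 / t"])
        show "continuous (at z within circle) (\<lambda>t. 1 / t)"
          using z by (intro continuous_intros) auto
        have "(\<lambda>t. 1 / t) ` circle \<subseteq> circle" by (auto simp: norm_divide)
        then show "continuous (at (1 / z) within (\<lambda>t. 1 / t) ` circle) a"
          unfolding iz by (rule continuous_within_subset[OF cont])
      qed
    qed
    then obtain d where d: "0 < d" "\<And>t. t \<in> circle \<Longrightarrow> dist t z < d \<Longrightarrow> a t * a (1 / t) \<noteq> 1"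
      using continuous_within_avoid[of z circle "\<lambda>t. a t * a (1 / t)" 1] neq iz by (auto simp: dist_commute)
    have "AE t in \<mu>. d \<le> norm (t - z)"
    proof -
      have "AE t in \<mu>. t \<in> circle" by (rule AE_circle)
      with a(2)[unfolded matching_def] show ?thesis
      proof eventually_elim
        case (elim t)
        then show ?case using d(2)[of t] by (force simp: reflect_def dist_norm not_less[symmetric])
      qed
    qed
    then show False using near_not_null[OF zc d(1)] by simp
  qed
  show ?thesis
  proof (rule ccontr)
    assume "a z \<noteq> c"
    then have az: "a z = - c" using square c_cases square_eq_1_iff[of "a z"] by auto
    obtain e where e: "0 < e" "\<And>b. b \<in> Linf \<Longrightarrow> matching b \<Longrightarrow> AE t in \<mu>. norm (a t - b t) \<le> e \<Longrightarrow>
      \<exists>h. invertible_matching p q b h \<and> fourier_coeff h 0 = c"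
      using perturbation by blast
    obtain d where d: "0 < d" "\<And>t. t \<in> circle \<Longrightarrow> dist t z < d \<Longrightarrow> dist (a t) (a z) < e"
      using cont e(1) unfolding continuous_within_eps_delta by blast
    \<comment> \<open>The arc is invariant under inversion and \<open>a z * a z = 1\<close>, so
      flattening preserves the matching relation.\<close>
    define b where "b = (\<lambda>t. if norm (t - z) < d then a z else a t)"
    note [measurable] = LinfD(1)[OF a(1)]
    have [measurable]: "b \<in> borel_measurable \<mu>" unfolding b_def by measurable
    obtain B where B: "AE t in \<mu>. norm (a t) \<le> B" using LinfD(2)[OF a(1)] by blast
    have "AE t in \<mu>. norm (b t) \<le> max B (norm (a z))"
      using B by eventually_elim (auto simp: b_def)
    then have bL: "b \<in> Linf" by (auto simp: Linf_def)
    have bm: "matching b"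
    proof -
      have "AE t in \<mu>. norm (1 / t - z) = norm (t - z)"
        by (rule AE_circle) (rule inversion_diff(2)[OF z])
      then show ?thesis
        using a(2) unfolding matching_def
        by eventually_elim (auto simp: b_def reflect_def square)
    qed
    have "AE t in \<mu>. norm (a t - b t) \<le> e"
    proof (rule AE_circle)
      fix t :: complex assume "t \<in> circle"
      then show "norm (a t - b t) \<le> e"
        using d(2)[of t] e(1) by (auto simp: b_def dist_norm less_imp_le)
    qed
    then obtain h where h: "invertible_matching p q b h" "fourier_coeff h 0 = c"
      using e(2)[OF bL bm] by blast
    interpret H: invertible_matching p q b h by (rule h(1))
    have "AE t in \<mu>. norm (t - z) < d \<longrightarrow> b t = - H.c"
      using h(2) by (auto simp: b_def az H.c_def)
    then show False by (rule H.not_locally_minus_c[OF z d(1)])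
  qed
qed

end

theorem corollary5p6:
  fixes p :: real and g :: "complex \<Rightarrow> complex" and n :: int
  assumes "1 < p"
    and "g \<in> Linf"
    and "matching g"
    and "continuous_at_circle_point g 1 \<or> continuous_at_circle_point g (-1)"
    and "fredholm p (toeplitz p g)"
    and "n = fredholm_index p (toeplitz p g)"
  shows "(continuous_at_circle_point g 1 \<longrightarrow> factorization_signature p g = g 1) \<and>
         (continuous_at_circle_point g (-1) \<longrightarrow>
            factorization_signature p g = g (-1) * (-1) powi n)"
proof -
  interpret fredholm_matching p g by unfold_locales (fact assms)+
  obtain f where f: "invertible_matching p (conj_exponent p) (\<lambda>t. t powi n * g t) f"
    using invertible_at_index assms(6) by blast
  interpret F: invertible_matching p "conj_exponent p" "\<lambda>t. t powi n * g t" f by (rule f)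
  have sig: "factorization_signature p g = F.c" by (rule F.signature[of n]) simp
  \<comment> \<open>The sign is read off from the shifted symbol, whose value at \<open>z\<close> is
    \<open>g z\<close> times \<open>z powi n\<close>, that is, times 1 or
    \<open>(-1) powi n\<close>.\<close>
  have "F.c = z powi n * g z" if "z = 1 \<or> z = -1" "continuous_at_circle_point g z" for z
  proof (rule F.value_at_point[OF that(1), symmetric])
    show "continuous (at z within circle) (\<lambda>t. t powi n * g t)"
      using that by (intro continuous_intros) (auto simp: continuous_at_circle_point_def)
  qed
  from this[of 1] this[of "-1"] show ?thesis by (simp add: sig mult.commute)
qed

end
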